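(* Let $G_2=\mathrm{Aut}(\mathbb{O})$, $\mathfrak{g}_2=\mathfrak{der}(\mathbb{O})$, and $$M_8:=\{\mathfrak{s}\le\mathfrak{g}_2:\ \mathfrak{s}\text{ is a principal three-dimensional subalgebra of }\mathfrak{g}_2\}.$$ The group $G_2$ acts on $M_8$ by $f\cdot\mathfrak{s}=\{fsf^{-1}:s\in\mathfrak{s}\}$. This action is transitive, and for every $\mathfrak{s}\in M_8$ the Lie algebra of the isotropy subgroup of $\mathfrak{s}$ is $\mathfrak{s}$ itself. Thus $M_8$ can be identified, as a $G_2$-homogeneous space, with $G_2/\mathrm{SO}(3)^{\mathrm{irr}}$.
   Context: $\mathbb{O}$ is the real octonion division algebra, $\mathrm{Aut}(\mathbb{O})$ its automorphism group (the compact Lie group $G_2$) and $\mathfrak{der}(\mathbb{O})$ its derivation algebra, the Lie algebra of $G_2$. In a complex semisimple Lie algebra $\mathfrak{g}$, an $\mathfrak{sl}_2$-triple is a triple $\{e,h,f\}$ with $[h,e]=2e$, $[h,f]=-2f$, $[e,f]=h$. A nilpotent element $e$ is principal if its centralizer $\{z\in\mathfrak{g}:[z,e]=0\}$ has dimension equal to $\mathrm{rank}\,\mathfrak{g}$. A principal subalgebra of $\mathfrak{g}$ is the span of an $\mathfrak{sl}_2$-triple $\{e,h,f\}$ with $e$ a principal nilpotent. A three-dimensional simple subalgebra of a simple compact real Lie algebra is called principal if its complexification is a principal subalgebra of the complexified Lie algebra. Here $\mathrm{SO}(3)^{\mathrm{irr}}$ denotes the connected Lie subgroup of $G_2$ whose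 Lie algebra is a fixed principal three-dimensional subalgebra of $\mathfrak{g}_2$ (unique up to conjugation). *)

theory Defs
  imports
    "HOL-Analysis.Analysis"
    "HOL-Algebra.Group_Action"
    "HOL-Algebra.Left_Coset"
    "HOL-Algebra.Generated_Groups"
begin

section \<open>Matrix Lie algebras over a field\<close>

definition mscale :: "'a::field \<Rightarrow> 'a^'n^'n \<Rightarrow> 'a^'n^'n"
  where "mscale c A = (\<chi> i j. c * A $ i $ j)"

interpretation mat: vector_space "mscale :: 'a::field \<Rightarrow> 'a^'n^'n \<Rightarrow> 'a^'n^'n"
  by unfold_locales (simp_all add: mscale_def vec_eq_iff algebra_simps)

definition lie_bracket :: "'a::field^'n^'n \<Rightarrow> 'a^'n^'n \<Rightarrow> 'a^'n^'n"
  where "lie_bracket A B = A ** B - B ** A"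

definition lie_subalgebra :: "('a::field^'n^'n) set \<Rightarrow> bool"
  where "lie_subalgebra L \<longleftrightarrow> mat.subspace L \<and> (\<forall>x\<in>L. \<forall>y\<in>L. lie_bracket x y \<in> L)"

definition lie_ideal :: "('a::field^'n^'n) set \<Rightarrow> ('a^'n^'n) set \<Rightarrow> bool"
  where "lie_ideal L I \<longleftrightarrow> mat.subspace I \<and> I \<subseteq> L \<and> (\<forall>x\<in>L. \<forall>y\<in>I. lie_bracket x y \<in> I)"

definition lie_simple :: "('a::field^'n^'n) set \<Rightarrow> bool"
  where "lie_simple L \<longleftrightarrow> lie_subalgebra L \<and> (\<exists>x\<in>L. \<exists>y\<in>L. lie_bracket x y \<noteq> 0) \<and>
    (\<forall>I. lie_ideal L I \<longrightarrow> I = {0} \<or> I = L)"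

primrec lower_central :: "('a::field^'n^'n) set \<Rightarrow> nat \<Rightarrow> ('a^'n^'n) set"
  where
    "lower_central L 0 = L"
  | "lower_central L (Suc k) = mat.span {lie_bracket x y | x y. x \<in> L \<and> y \<in> lower_central L k}"

definition lie_nilpotent :: "('a::field^'n^'n) set \<Rightarrow> bool"
  where "lie_nilpotent L \<longleftrightarrow> lie_subalgebra L \<and> (\<exists>k. lower_central L k = {0})"

definition cartan_subalgebra :: "('a::field^'n^'n) set \<Rightarrow> ('a^'n^'n) set \<Rightarrow> bool"
  where "cartan_subalgebra L H \<longleftrightarrow> H \<subseteq> L \<and> lie_nilpotent H \<and>
    {z \<in> L. \<forall>h\<in>H. lie_bracket z h \<in> H} = H"

text \<open>The rank is the dimension of a Cartan subalgebra. In a complex Lie algebra all Cartan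
  subalgebras have the same dimension, so that the minimum below only makes the choice
  definite.\<close>

definition lie_rank :: "('a::field^'n^'n) set \<Rightarrow> nat"
  where "lie_rank L = (LEAST d. \<exists>H. cartan_subalgebra L H \<and> mat.dim H = d)"

definition lie_centralizer :: "('a::field^'n^'n) set \<Rightarrow> 'a^'n^'n \<Rightarrow> ('a^'n^'n) set"
  where "lie_centralizer L e = {z \<in> L. lie_bracket z e = 0}"

definition nilpotent_element :: "('a::field^'n^'n) set \<Rightarrow> 'a^'n^'n \<Rightarrow> bool"
  where "nilpotent_element L e \<longleftrightarrow> e \<in> L \<and> (\<exists>k. \<forall>z\<in>L. (lie_bracket e ^^ k) z = 0)"

definition principal_nilpotent :: "('a::field^'n^'n) set \<Rightarrow> 'a^'n^'n \<Rightarrow> bool"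
  where "principal_nilpotent L e \<longleftrightarrow>
    nilpotent_element L e \<and> mat.dim (lie_centralizer L e) = lie_rank L"

definition sl2_triple ::
  "('a::field^'n^'n) set \<Rightarrow> 'a^'n^'n \<Rightarrow> 'a^'n^'n \<Rightarrow> 'a^'n^'n \<Rightarrow> bool"
  where "sl2_triple L e h f \<longleftrightarrow> e \<in> L \<and> h \<in> L \<and> f \<in> L \<and>
    lie_bracket h e = mscale 2 e \<and> lie_bracket h f = mscale (-2) f \<and> lie_bracket e f = h"

definition principal_subalgebra :: "('a::field^'n^'n) set \<Rightarrow> ('a^'n^'n) set \<Rightarrow> bool"
  where "principal_subalgebra L S \<longleftrightarrow>
    (\<exists>e h f. sl2_triple L e h f \<and> principal_nilpotent L e \<and> S = mat.span {e, h, f})"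

text \<open>For a real subspace \<open>L\<close> of real matrices, \<open>X \<otimes> 1 + Y \<otimes> \<i> \<mapsto> X + \<i> Y\<close> identifies the
  complexification of \<open>L\<close> with the following set of complex matrices.\<close>

definition complexification :: "(real^'n^'n) set \<Rightarrow> (complex^'n^'n) set"
  where "complexification L = {(\<chi> i j. Complex (X $ i $ j) (Y $ i $ j)) | X Y. X \<in> L \<and> Y \<in> L}"

definition principal_3dim_subalgebra :: "(real^'n^'n) set \<Rightarrow> (real^'n^'n) set \<Rightarrow> bool"
  where "principal_3dim_subalgebra L S \<longleftrightarrow> S \<subseteq> L \<and> mat.dim S = 3 \<and> lie_simple S \<and>
    principal_subalgebra (complexification L) (complexification S)"


section \<open>Lie algebras of matrix groups\<close>

definition mexp :: "real^'n^'n \<Rightarrow> real^'n^'n"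
  where "mexp A = (\<Sum>k. (1 / fact k) *\<^sub>R (((**) A) ^^ k) (mat 1))"

definition lie_algebra_of :: "(real^'n^'n) set \<Rightarrow> (real^'n^'n) set"
  where "lie_algebra_of H = {A. \<forall>t::real. mexp (t *\<^sub>R A) \<in> H}"

text \<open>The connected Lie subgroup (analytic subgroup) with Lie algebra \<open>S\<close> is the subgroup
  generated by the image of \<open>S\<close> under the exponential map.\<close>

definition connected_lie_subgroup ::
  "(real^'n^'n) monoid \<Rightarrow> (real^'n^'n) set \<Rightarrow> (real^'n^'n) set"
  where "connected_lie_subgroup G S = generate G (mexp ` S)"


section \<open>Octonions\<close>

text \<open>Octonions are coordinate vectors with respect to the basis \<open>1 = e\<^sub>0, e\<^sub>1, \<dots>, e\<^sub>7\<close>, where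
  \<open>e\<^sub>i e\<^sub>i = -1\<close> and \<open>e\<^sub>i e\<^sub>j = e\<^sub>k = - e\<^sub>j e\<^sub>i\<close> for the seven triples
  \<open>(i, j, k) = (i, i + 1, i + 3)\<close>, read modulo 7 in \<open>{1, \<dots>, 7}\<close>, and their cyclic permutations.\<close>

type_synonym octonion = "real^8"

definition octonion_mult :: "octonion \<Rightarrow> octonion \<Rightarrow> octonion"  (infixl \<open>\<odot>\<close> 70)
  where "x \<odot> y =
   (let a = (\<lambda>i j. x $ i * y $ j - x $ j * y $ i);
        s = (\<lambda>i. x $ 0 * y $ i + x $ i * y $ 0)
    in \<chi> k.
      if k = 0 then x $ 0 * y $ 0 - (\<Sum>i\<in>UNIV - {0}. x $ i * y $ i)
      else if k = 1 then s 1 + a 2 4 + a 3 7 + a 5 6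
      else if k = 2 then s 2 + a 3 5 + a 4 1 + a 6 7
      else if k = 3 then s 3 + a 4 6 + a 5 2 + a 7 1
      else if k = 4 then s 4 + a 5 7 + a 6 3 + a 1 2
      else if k = 5 then s 5 + a 6 1 + a 7 4 + a 2 3
      else if k = 6 then s 6 + a 7 2 + a 1 5 + a 3 4
      else s 7 + a 1 3 + a 2 6 + a 4 5)"

definition G2 :: "(real^8^8) monoid"
  where "G2 = \<lparr>carrier = {g. invertible g \<and> (\<forall>x y. g *v (x \<odot> y) = (g *v x) \<odot> (g *v y))},
    mult = (**), one = mat 1\<rparr>"

definition g2 :: "(real^8^8) set"
  where "g2 = {d. \<forall>x y. d *v (x \<odot> y) = (d *v x) \<odot> y + x \<odot> (d *v y)}"

definition M8 :: "(real^8^8) set set"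
  where "M8 = {S. principal_3dim_subalgebra g2 S}"

text \<open>The locale \<^locale>\<open>group_action\<close> wants the action maps to be extensional on \<open>M8\<close>.\<close>

definition M8_action :: "real^8^8 \<Rightarrow> (real^8^8) set \<Rightarrow> (real^8^8) set"
  where "M8_action g = (\<lambda>S\<in>M8. (\<lambda>A. g ** A ** matrix_inv g) ` S)"

abbreviation SO3_irr :: "(real^8^8) set \<Rightarrow> (real^8^8) set"
  where "SO3_irr S \<equiv> connected_lie_subgroup G2 S"

end

(* Every derivation of the octonions kills some imaginary unit u and is diagonal on two further units a, b
   such that (u, a, b) generate the octonions. Since automorphisms act transitively on such triples, it can be
   moved into a fixed maximal torus, with weights p, q, p + q on the imaginary octonions and 0 <= p <= q.
   A principal three-dimensional subalgebra has a basis X, Y, Z with the brackets of so(3), and e = X + iY is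
   its principal nilpotent. Put Z into the torus. Then e is a sum of positive root vectors for roots with
   value 1 on Z. As the centralizer of e has dimension two, no root vanishes on Z, and [e, conj e] = -2iZ leaves
   only p = 1, q = 2, with e a sum of simple root vectors of prescribed lengths. The torus corrects their phases,
   so all principal subalgebras are conjugate. An automorphism normalizing one of them acts on it as a rotation,
   hence as the exponential of an element of the axis; since the centralizer is trivial, the stabilizer is
   exactly the image of the exponential map. *)
theory Submission
  imports Defs
begin


section \<open>Octonion arithmetic\<close>

text \<open>Principal subalgebras are defined by complex triples e, h, f, whereas only the real
  group acts. The trace form is the bridge: tr(e e) = 0 holds in every triple, so the real and
  imaginary parts of e are orthogonal of equal length. Completed to an orthogonal basis of S and
  rescaled, they give X, Y, Z with X + iY proportional to e. Principality enters through the
  dimension of the centralizer of e, which requires the rank. Since \<open>lie_rank\<close> is a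
  minimum, Cartan subalgebras of dimension at most one must be excluded: the alternating form
  tr([h, x] y) on a 14-dimensional space has even rank, so its radical, the centralizer of h, is
  never just the line of h. The torus form of Z comes from linear algebra: if d kills the unit u,
  then x -> u (d x) is symmetric, and a, b are eigenvectors of it. At p = 1, q = 2 both simple roots
  t1 and t2 - t1 take the value 1. The squared moduli 3/2 and 5/2 of the two coefficients of e solve
  the linear equations contained in [e, conj e] = -2iZ.\<close>

lemma exhaust_8: "(i::8) = 0 \<or> i = 1 \<or> i = 2 \<or> i = 3 \<or> i = 4 \<or> i = 5 \<or> i = 6 \<or> i = 7"
proof (cases i)
  case (of_int z)
  then have "z \<in> {0,1,2,3,4,5,6,7}" by auto
  then show ?thesis using of_int by auto
qed

lemma forall_8: "(\<forall>i::8. P i) \<longleftrightarrow> P 0 \<and> P 1 \<and> P 2 \<and> P 3 \<and> P 4 \<and> P 5 \<and> P 6 \<and> P 7"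
  by (metis exhaust_8)

lemma UNIV_8: "(UNIV::8 set) = {0,1,2,3,4,5,6,7}"
  using exhaust_8 by auto

lemma sum_8: "sum f (UNIV::8 set) = f 0 + f 1 + f 2 + f 3 + f 4 + f 5 + f 6 + f 7"
  unfolding UNIV_8 by (simp add: add.assoc)

lemma sum_7: "sum f (UNIV - {0::8}) = f 1 + f 2 + f 3 + f 4 + f 5 + f 6 + f 7"
proof -
  have "UNIV - {0::8} = {1,2,3,4,5,6,7}" unfolding UNIV_8 by auto
  then show ?thesis by (simp add: add.assoc)
qed

lemma octonion_mult_nth:
  "(x \<odot> y)$0 = x$0 * y$0 - (x$1*y$1 + x$2*y$2 + x$3*y$3 + x$4*y$4 + x$5*y$5 + x$6*y$6 + x$7*y$7)"
  "(x \<odot> y)$1 = x$0*y$1 + x$1*y$0 + (x$2*y$4 - x$4*y$2) + (x$3*y$7 - x$7*y$3) + (x$5*y$6 - x$6*y$5)"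
  "(x \<odot> y)$2 = x$0*y$2 + x$2*y$0 + (x$3*y$5 - x$5*y$3) + (x$4*y$1 - x$1*y$4) + (x$6*y$7 - x$7*y$6)"
  "(x \<odot> y)$3 = x$0*y$3 + x$3*y$0 + (x$4*y$6 - x$6*y$4) + (x$5*y$2 - x$2*y$5) + (x$7*y$1 - x$1*y$7)"
  "(x \<odot> y)$4 = x$0*y$4 + x$4*y$0 + (x$5*y$7 - x$7*y$5) + (x$6*y$3 - x$3*y$6) + (x$1*y$2 - x$2*y$1)"
  "(x \<odot> y)$5 = x$0*y$5 + x$5*y$0 + (x$6*y$1 - x$1*y$6) + (x$7*y$4 - x$4*y$7) + (x$2*y$3 - x$3*y$2)"
  "(x \<odot> y)$6 = x$0*y$6 + x$6*y$0 + (x$7*y$2 - x$2*y$7) + (x$1*y$5 - x$5*y$1) + (x$3*y$4 - x$4*y$3)"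
  "(x \<odot> y)$7 = x$0*y$7 + x$7*y$0 + (x$1*y$3 - x$3*y$1) + (x$2*y$6 - x$6*y$2) + (x$4*y$5 - x$5*y$4)"
  by (simp_all add: octonion_mult_def Let_def sum_7)

lemmas octonion_coords = vec_eq_iff forall_8 octonion_mult_nth inner_vec_def sum_8

lemma bilinear_octonion_mult: "bilinear (\<odot>)"
  unfolding bilinear_def linear_iff
  by (simp add: octonion_coords) (simp add: algebra_simps)

lemma bounded_bilinear_octonion_mult: "bounded_bilinear (\<odot>)"
  using bilinear_octonion_mult bilinear_conv_bounded_bilinear by blast

lemmas octonion_bilinear =
  bilinear_ladd[OF bilinear_octonion_mult] bilinear_radd[OF bilinear_octonion_mult]
  bilinear_lmul[OF bilinear_octonion_mult] bilinear_rmul[OF bilinear_octonion_mult]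
  bilinear_lneg[OF bilinear_octonion_mult] bilinear_rneg[OF bilinear_octonion_mult]
  bilinear_lsub[OF bilinear_octonion_mult] bilinear_rsub[OF bilinear_octonion_mult]
  bilinear_lzero[OF bilinear_octonion_mult] bilinear_rzero[OF bilinear_octonion_mult]

definition oct_unit :: "8 \<Rightarrow> octonion" where "oct_unit i = axis i 1"

lemma oct_unit_nth [simp]: "oct_unit i$j = (if j = i then 1 else 0)"
  by (simp add: oct_unit_def axis_def)

lemma oct_one_mult [simp]: "oct_unit 0 \<odot> x = x" "x \<odot> oct_unit 0 = x"
  by (simp_all add: octonion_coords)

text \<open>Degen's eight-square identity, checked as a polynomial identity in the
  coordinates.\<close>

lemma oct_norm_mult: "(x \<odot> y) \<bullet> (x \<odot> y) = (x \<bullet> x) * (y \<bullet> y)"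
  by (simp add: octonion_coords) (simp add: algebra_simps)

lemma imag_square: "x$0 = 0 \<Longrightarrow> x \<odot> x = - (x \<bullet> x) *\<^sub>R oct_unit 0"
  by (simp add: octonion_coords)

lemma imag_anticomm: "x$0 = 0 \<Longrightarrow> y$0 = 0 \<Longrightarrow> x \<odot> y = - (y \<odot> x) - (2 * (x \<bullet> y)) *\<^sub>R oct_unit 0"
  by (simp add: octonion_coords)

lemma imag_left_skew: "x$0 = 0 \<Longrightarrow> (x \<odot> y) \<bullet> z = - (y \<bullet> (x \<odot> z))"
  by (simp add: octonion_coords) (simp add: algebra_simps)

lemma imag_right_skew: "x$0 = 0 \<Longrightarrow> (y \<odot> x) \<bullet> z = - (y \<bullet> (z \<odot> x))"
  by (simp add: octonion_coords) (simp add: algebra_simps)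

text \<open>Linearization of \<open>imag_left_square\<close>: left multiplications by imaginary
  octonions satisfy the Clifford relations. In the product computations below this replaces
  associativity.\<close>

lemma imag_left_alt:
  "x$0 = 0 \<Longrightarrow> y$0 = 0 \<Longrightarrow> x \<odot> (y \<odot> z) = - (y \<odot> (x \<odot> z)) - (2 * (x \<bullet> y)) *\<^sub>R z"
  by (simp add: octonion_coords) (simp add: algebra_simps)

lemma imag_left_square: "x$0 = 0 \<Longrightarrow> x \<odot> (x \<odot> z) = - (x \<bullet> x) *\<^sub>R z"
  by (simp add: octonion_coords) (simp add: algebra_simps)

lemma oct_mult_real: "(x \<odot> y)$0 = x$0 * y$0 - (x \<bullet> y - x$0 * y$0)"
  by (simp add: octonion_coords)


section \<open>Automorphisms and derivations of the octonions\<close>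

lemma matrix_vector_oct_unit: "(A *v oct_unit j)$i = A$i$j"
  unfolding oct_unit_def by (simp add: matrix_vector_mul_component matrix_vector_mult_basis column_def)

lemma oct_matrix_eqI:
  fixes A B :: "real^8^8"
  assumes "\<And>i. A *v oct_unit i = B *v oct_unit i"
  shows "A = B"
  using assms by (metis matrix_vector_oct_unit vec_eq_iff)

text \<open>The units 4, 5, 6, 7 arise from 1, 2, 3 by products, so an automorphism or a derivation
  is determined by three values.\<close>

lemma oct_unit_mults:
  "oct_unit 1 \<odot> oct_unit 2 = oct_unit 4"
  "oct_unit 1 \<odot> oct_unit 3 = oct_unit 7"
  "oct_unit 2 \<odot> oct_unit 3 = oct_unit 5"
  "oct_unit 1 \<odot> oct_unit 5 = oct_unit 6"
  by (simp_all add: octonion_coords)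

lemma inner_oct_unit [simp]: "x \<bullet> oct_unit i = x$i" "oct_unit i \<bullet> x = x$i"
  by (simp_all add: oct_unit_def inner_axis inner_commute[of "axis i 1"])

lemma G2_iff: "g \<in> carrier G2 \<longleftrightarrow> invertible g \<and> (\<forall>x y. g *v (x \<odot> y) = (g *v x) \<odot> (g *v y))"
  by (simp add: G2_def)

lemma G2_mult: "g \<in> carrier G2 \<Longrightarrow> g *v (x \<odot> y) = (g *v x) \<odot> (g *v y)"
  by (simp add: G2_iff)

lemma G2_unit:
  assumes "g \<in> carrier G2" shows "g *v oct_unit 0 = oct_unit 0"
proof -
  obtain h where h: "g ** h = mat 1" using assms by (auto simp: G2_iff invertible_def)
  have "g *v (oct_unit 0 \<odot> (h *v oct_unit 0)) = (g *v oct_unit 0) \<odot> (g *v (h *v oct_unit 0))"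
    using assms by (rule G2_mult)
  then show ?thesis by (simp add: matrix_vector_mul_assoc h)
qed

text \<open>Being imaginary and having a given norm can be read off the square, hence off the
  multiplication alone. This is why automorphisms preserve both.\<close>

lemma square_neg_real:
  assumes "y \<odot> y = - c *\<^sub>R oct_unit 0" "c \<ge> 0"
  shows "y$0 = 0 \<and> y \<bullet> y = c"
proof -
  have e: "(y \<odot> y)$i = - c * (if i = 0 then 1 else 0)" for i using assms(1) by simp
  have "\<forall>i. i \<noteq> 0 \<longrightarrow> 2 * y$0 * y$i = 0"
    unfolding forall_8 using e[of 1] e[of 2] e[of 3] e[of 4] e[of 5] e[of 6] e[of 7]
    by (auto simp: octonion_mult_nth)
  \<comment> \<open>If the imaginary part vanishes, the square of y is a nonnegative real, but it
    also equals -c.\<close>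
  moreover have "y$0 = 0" if "\<forall>i. i \<noteq> 0 \<longrightarrow> y$i = 0"
  proof -
    have "y$0 * y$0 = - c" using e[of 0] that by (simp add: octonion_mult_nth)
    then show ?thesis using assms(2) by (metis mult_eq_0_iff neg_le_0_iff_le not_square_less_zero order_le_less)
  qed
  ultimately have y0: "y$0 = 0" by auto
  have "y \<odot> y = - (y \<bullet> y) *\<^sub>R oct_unit 0" by (rule imag_square[OF y0])
  with assms(1) have "(y \<bullet> y) *\<^sub>R oct_unit 0 = c *\<^sub>R oct_unit 0" by simp
  then have "((y \<bullet> y) *\<^sub>R oct_unit 0)$0 = (c *\<^sub>R oct_unit 0)$0" by (rule arg_cong)
  then show ?thesis using y0 by simp
qed

lemma G2_imag_norm:
  assumes g: "g \<in> carrier G2" and x: "x$0 = 0"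
  shows "(g *v x)$0 = 0 \<and> (g *v x) \<bullet> (g *v x) = x \<bullet> x"
proof -
  have "(g *v x) \<odot> (g *v x) = g *v (x \<odot> x)" using G2_mult[OF g] by simp
  also have "\<dots> = - (x \<bullet> x) *\<^sub>R oct_unit 0"
    by (simp only: imag_square[OF x] matrix_vector_mult_scaleR G2_unit[OF g])
  finally show ?thesis by (intro square_neg_real) auto
qed

lemma G2_norm:
  assumes g: "g \<in> carrier G2"
  shows "(g *v x) \<bullet> (g *v x) = x \<bullet> x"
proof -
  define v where "v = x - x$0 *\<^sub>R oct_unit 0"
  have v0: "v$0 = 0" by (simp add: v_def)
  have x: "x = x$0 *\<^sub>R oct_unit 0 + v" by (simp add: v_def)
  have gx: "g *v x = x$0 *\<^sub>R oct_unit 0 + g *v v"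
    by (subst x) (simp only: matrix_vector_right_distrib matrix_vector_mult_scaleR G2_unit[OF g])
  show ?thesis
    unfolding gx using G2_imag_norm[OF g v0] v0
    by (subst (2) x, subst (3) x) (simp add: inner_add_left inner_add_right)
qed

lemma G2_inner:
  assumes g: "g \<in> carrier G2"
  shows "(g *v x) \<bullet> (g *v y) = x \<bullet> y"
proof -
  have "(g *v (x + y)) \<bullet> (g *v (x + y)) = (x + y) \<bullet> (x + y)" by (rule G2_norm[OF g])
  then show ?thesis
    using G2_norm[OF g, of x] G2_norm[OF g, of y]
    by (simp add: matrix_vector_right_distrib inner_add_left inner_add_right inner_commute)
qed

lemma G2_nth_0: "g \<in> carrier G2 \<Longrightarrow> (g *v x)$0 = x$0"
  using G2_inner[of g x "oct_unit 0"] by (simp add: G2_unit)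

lemma G2_orthogonal_matrix:
  assumes g: "g \<in> carrier G2"
  shows "transpose g ** g = mat 1" "g ** transpose g = mat 1"
proof -
  have "orthogonal_transformation ((*v) g)"
    unfolding orthogonal_transformation_def using G2_inner[OF g] by (simp add: matrix_vector_mul_linear)
  then have "orthogonal_matrix g" by (simp add: orthogonal_transformation_matrix)
  then show "transpose g ** g = mat 1" "g ** transpose g = mat 1"
    by (auto simp: orthogonal_matrix_def)
qed

lemma matrix_inv_unique:
  fixes g h :: "real^'n^'n"
  assumes "g ** h = mat 1" shows "matrix_inv g = h"
proof -
  have hg: "h ** g = mat 1" using assms matrix_left_right_inverse by blast
  have inv: "invertible g" using assms hg by (auto simp: invertible_def)
  have "matrix_inv g = matrix_inv g ** (g ** h)" by (simp add: assms)
  also have "\<dots> = h" using someI_ex[OF inv[unfolded invertible_def]] by (simp add: matrix_mul_assoc matrix_inv_def)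
  finally show ?thesis .
qed

lemma G2_matrix_inv: "g \<in> carrier G2 \<Longrightarrow> matrix_inv g = transpose g"
  by (intro matrix_inv_unique G2_orthogonal_matrix)

lemma G2_iff_orthogonal:
  "g \<in> carrier G2 \<longleftrightarrow> transpose g ** g = mat 1 \<and> (\<forall>x y. g *v (x \<odot> y) = (g *v x) \<odot> (g *v y))"
proof
  assume "transpose g ** g = mat 1 \<and> (\<forall>x y. g *v (x \<odot> y) = (g *v x) \<odot> (g *v y))"
  then show "g \<in> carrier G2"
    unfolding G2_iff invertible_def using matrix_left_right_inverse by blast
qed (auto simp: G2_orthogonal_matrix G2_mult)

lemma G2_mat_1: "mat 1 \<in> carrier G2"
  by (simp add: G2_iff_orthogonal)

lemma G2_times: "g \<in> carrier G2 \<Longrightarrow> h \<in> carrier G2 \<Longrightarrow> g ** h \<in> carrier G2"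
  by (simp add: G2_iff invertible_mult matrix_vector_mul_assoc[symmetric])

lemma G2_transpose:
  assumes g: "g \<in> carrier G2" shows "transpose g \<in> carrier G2"
proof -
  note o = G2_orthogonal_matrix[OF g]
  have c: "transpose g *v (g *v x) = x" "g *v (transpose g *v x) = x" for x
    by (simp_all add: matrix_vector_mul_assoc o del: transpose_matrix_vector)
  have "transpose g *v (x \<odot> y) = (transpose g *v x) \<odot> (transpose g *v y)" for x y
  proof -
    have "transpose g *v (g *v ((transpose g *v x) \<odot> (transpose g *v y))) = (transpose g *v x) \<odot> (transpose g *v y)"
      by (rule c)
    then show ?thesis by (simp add: G2_mult[OF g] c del: transpose_matrix_vector)
  qed
  then show ?thesis by (simp add: G2_iff_orthogonal o)
qed

lemma G2_cancel:
  assumes "g \<in> carrier G2"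
  shows "transpose g ** (g ** A) = A" "g ** (transpose g ** A) = A"
    "A ** g ** transpose g = A" "A ** transpose g ** g = A"
proof -
  note o = G2_orthogonal_matrix[OF assms]
  show "transpose g ** (g ** A) = A" "g ** (transpose g ** A) = A"
    by (simp_all only: matrix_mul_assoc o matrix_mul_lid)
  show "A ** g ** transpose g = A" "A ** transpose g ** g = A"
    by (simp_all only: matrix_mul_assoc[symmetric] o matrix_mul_rid)
qed

lemma group_G2: "group G2"
proof (rule groupI)
  fix x y z assume "x \<in> carrier G2" "y \<in> carrier G2" "z \<in> carrier G2"
  then show "x \<otimes>\<^bsub>G2\<^esub> y \<in> carrier G2" "x \<otimes>\<^bsub>G2\<^esub> y \<otimes>\<^bsub>G2\<^esub> z = x \<otimes>\<^bsub>G2\<^esub> (y \<otimes>\<^bsub>G2\<^esub> z)"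
    using G2_times by (simp_all add: G2_def matrix_mul_assoc)
next
  show "\<one>\<^bsub>G2\<^esub> \<in> carrier G2" using G2_mat_1 by (simp add: G2_def)
next
  fix x assume x: "x \<in> carrier G2"
  then show "\<one>\<^bsub>G2\<^esub> \<otimes>\<^bsub>G2\<^esub> x = x" by (simp add: G2_def)
  show "\<exists>y\<in>carrier G2. y \<otimes>\<^bsub>G2\<^esub> x = \<one>\<^bsub>G2\<^esub>"
    using G2_transpose[OF x] G2_orthogonal_matrix[OF x] by (auto simp: G2_def)
qed

lemma G2_mult_eq: "g \<otimes>\<^bsub>G2\<^esub> h = g ** h"
  by (simp add: G2_def)

lemma G2_generators_fixed:
  assumes g: "g \<in> carrier G2" and h: "h \<in> carrier G2"
    and eq: "g *v oct_unit 1 = h *v oct_unit 1" "g *v oct_unit 2 = h *v oct_unit 2"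
      "g *v oct_unit 3 = h *v oct_unit 3"
  shows "g = h"
proof -
  have 4: "g *v oct_unit 4 = h *v oct_unit 4" and 7: "g *v oct_unit 7 = h *v oct_unit 7"
    and 5: "g *v oct_unit 5 = h *v oct_unit 5"
    by (simp_all add: oct_unit_mults[symmetric] G2_mult[OF g] G2_mult[OF h] eq)
  have 6: "g *v oct_unit 6 = h *v oct_unit 6"
    by (simp add: oct_unit_mults(4)[symmetric] G2_mult[OF g] G2_mult[OF h] eq 5)
  have "\<forall>i. g *v oct_unit i = h *v oct_unit i"
    unfolding forall_8 using G2_unit g h eq 4 5 6 7 by simp
  then show ?thesis by (intro oct_matrix_eqI) simp
qed

section \<open>Derivations are skew and take imaginary values\<close>

lemma imag_anticomm_real:
  "x$0 = 0 \<Longrightarrow> y \<odot> x + x \<odot> y = (2 * y$0) *\<^sub>R x - (2 * (x \<bullet> y)) *\<^sub>R oct_unit 0"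
  by (simp add: octonion_coords)

lemma g2_iff: "d \<in> g2 \<longleftrightarrow> (\<forall>x y. d *v (x \<odot> y) = (d *v x) \<odot> y + x \<odot> (d *v y))"
  by (simp add: g2_def)

lemma g2_mult: "d \<in> g2 \<Longrightarrow> d *v (x \<odot> y) = (d *v x) \<odot> y + x \<odot> (d *v y)"
  by (simp add: g2_iff)

lemma g2_unit: "d \<in> g2 \<Longrightarrow> d *v oct_unit 0 = 0"
  using g2_mult[of d "oct_unit 0" "oct_unit 0"] by simp

text \<open>The square of an imaginary x is a real multiple of 1, so d kills it and (dx)x + x(dx) =
  0. The imaginary part of this sum is 2x times the real coordinate of dx; its real part yields
  \<open>g2_inner_self\<close>.\<close>

lemma g2_nth_0:
  assumes d: "d \<in> g2" shows "(d *v x)$0 = 0"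
proof -
  have imag: "(d *v x)$0 = 0" if x: "x$0 = 0" for x
  proof (cases "x = 0")
    case False
    have "d *v (x \<odot> x) = (d *v x) \<odot> x + x \<odot> (d *v x)" by (rule g2_mult[OF d])
    moreover have "d *v (x \<odot> x) = 0"
      by (simp only: imag_square[OF x] matrix_vector_mult_scaleR g2_unit[OF d]) simp
    ultimately have "(2 * (d *v x)$0) *\<^sub>R x = (2 * (x \<bullet> (d *v x))) *\<^sub>R oct_unit 0"
      using imag_anticomm_real[OF x, of "d *v x"] by simp
    then have "2 * (d *v x)$0 * x$i = 2 * (x \<bullet> (d *v x)) * oct_unit 0$i" for i
      by (metis vector_scaleR_component real_scaleR_def)
    then have "(d *v x)$0 * x$i = 0" for i using x by (cases "i = 0") auto
    with False show ?thesis by (auto simp: vec_eq_iff)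
  qed simp
  have "d *v (x - x$0 *\<^sub>R oct_unit 0) = d *v x"
    by (simp add: matrix_vector_mult_diff_distrib matrix_vector_mult_scaleR g2_unit[OF d])
  then show ?thesis using imag[of "x - x$0 *\<^sub>R oct_unit 0"] by simp
qed

lemma g2_inner_self:
  assumes d: "d \<in> g2" shows "(d *v x) \<bullet> x = 0"
proof -
  define v where "v = x - x$0 *\<^sub>R oct_unit 0"
  have v: "v$0 = 0" and dv: "d *v v = d *v x"
    by (simp_all add: v_def matrix_vector_mult_diff_distrib matrix_vector_mult_scaleR g2_unit[OF d])
  have "d *v (v \<odot> v) = (d *v v) \<odot> v + v \<odot> (d *v v)" by (rule g2_mult[OF d])
  moreover have "d *v (v \<odot> v) = 0"
    by (simp only: imag_square[OF v] matrix_vector_mult_scaleR g2_unit[OF d]) simp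
  ultimately have "((d *v v) \<odot> v + v \<odot> (d *v v))$0 = 0" by simp
  then have "(d *v v) \<bullet> v = 0" using v g2_nth_0[OF d, of v]
    by (simp add: oct_mult_real inner_commute)
  then show ?thesis unfolding dv by (simp add: v_def inner_diff_right g2_nth_0[OF d])
qed

lemma g2_inner:
  assumes d: "d \<in> g2" shows "(d *v x) \<bullet> y = - (x \<bullet> (d *v y))"
  using g2_inner_self[OF d, of "x + y"] g2_inner_self[OF d, of x] g2_inner_self[OF d, of y]
  by (simp add: matrix_vector_right_distrib inner_add_left inner_add_right inner_commute)

lemma g2_skew: "d \<in> g2 \<Longrightarrow> d$i$j = - d$j$i"
  using g2_inner[of d "oct_unit j" "oct_unit i"] by (simp add: matrix_vector_oct_unit)

lemma g2_transpose: "transpose d = - d" if "d \<in> g2"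
proof -
  have "transpose d$i$j = (- d)$i$j" for i j
    using g2_skew[OF that, of j i] by (simp add: transpose_def)
  then show ?thesis by (simp add: vec_eq_iff)
qed

lemma g2_generators:
  assumes g: "g \<in> g2" and h: "h \<in> g2"
    and eq: "g *v oct_unit 1 = h *v oct_unit 1" "g *v oct_unit 2 = h *v oct_unit 2"
      "g *v oct_unit 3 = h *v oct_unit 3"
  shows "g = h"
proof -
  have 4: "g *v oct_unit 4 = h *v oct_unit 4" and 7: "g *v oct_unit 7 = h *v oct_unit 7"
    and 5: "g *v oct_unit 5 = h *v oct_unit 5"
    by (simp_all add: oct_unit_mults[symmetric] g2_mult[OF g] g2_mult[OF h] eq)
  have 6: "g *v oct_unit 6 = h *v oct_unit 6"
    by (simp add: oct_unit_mults(4)[symmetric] g2_mult[OF g] g2_mult[OF h] eq 5)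
  have "\<forall>i. g *v oct_unit i = h *v oct_unit i"
    unfolding forall_8 using g2_unit g h eq 4 5 6 7 by simp
  then show ?thesis by (intro oct_matrix_eqI) simp
qed

lemma matrix_vector_mult_minus: "(- A) *v x = - (A *v x)" for A :: "'a::ring_1^'n^'m"
  by (simp add: matrix_vector_mult_def vec_eq_iff sum_negf)

lemma g2_zero: "0 \<in> g2" and g2_add: "c \<in> g2 \<Longrightarrow> d \<in> g2 \<Longrightarrow> c + d \<in> g2"
  and g2_scale: "d \<in> g2 \<Longrightarrow> r *\<^sub>R d \<in> g2" and g2_neg: "d \<in> g2 \<Longrightarrow> - d \<in> g2"
  and g2_diff: "c \<in> g2 \<Longrightarrow> d \<in> g2 \<Longrightarrow> c - d \<in> g2"
  by (auto simp: g2_iff matrix_vector_mult_add_rdistrib matrix_vector_mult_diff_rdistrib octonion_bilinear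
     scaleR_matrix_vector_assoc[symmetric] scaleR_add_right matrix_vector_mult_minus)

lemma subspace_g2: "subspace g2"
  by (simp add: subspace_def g2_zero g2_add g2_scale)

lemma lie_bracket_mult_vec: "lie_bracket c d *v x = c *v (d *v x) - d *v (c *v x)" for c d :: "real^'n^'n"
  by (simp add: lie_bracket_def matrix_vector_mult_diff_rdistrib matrix_vector_mul_assoc)

lemma g2_bracket: "c \<in> g2 \<Longrightarrow> d \<in> g2 \<Longrightarrow> lie_bracket c d \<in> g2"
  unfolding g2_iff[of "lie_bracket c d"] lie_bracket_mult_vec
  by (simp add: g2_mult matrix_vector_right_distrib octonion_bilinear)

lemma g2_conj:
  assumes g: "g \<in> carrier G2" and d: "d \<in> g2"
  shows "g ** d ** transpose g \<in> g2"
proof -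
  have c: "g *v (transpose g *v x) = x" for x
    by (simp add: matrix_vector_mul_assoc G2_orthogonal_matrix[OF g] del: transpose_matrix_vector)
  show ?thesis
    unfolding g2_iff matrix_vector_mul_assoc[symmetric] G2_mult[OF G2_transpose[OF g]] g2_mult[OF d]
      matrix_vector_right_distrib G2_mult[OF g] c by simp
qed


section \<open>Basic triples\<close>

text \<open>The last condition, together with the orthogonality to u and a, puts b into the
  complement of the quaternion algebra spanned by 1, u, a, ua. The model is e1, e2, e3.\<close>

definition basic_triple :: "octonion \<Rightarrow> octonion \<Rightarrow> octonion \<Rightarrow> bool" where
  "basic_triple u a b \<longleftrightarrow> u$0 = 0 \<and> a$0 = 0 \<and> b$0 = 0 \<and>
    u \<bullet> u = 1 \<and> a \<bullet> a = 1 \<and> b \<bullet> b = 1 \<and> u \<bullet> a = 0 \<and> u \<bullet> b = 0 \<and> a \<bullet> b = 0 \<and> (u \<odot> a) \<bullet> b = 0"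

text \<open>An orthonormal imaginary pair and its product multiply like the quaternion units i, j,
  k.\<close>

lemma unit_product:
  assumes x: "x$0 = 0" "x \<bullet> x = 1" and y: "y$0 = 0" "y \<bullet> y = 1" and xy: "x \<bullet> y = 0"
    and z: "x \<odot> y = z"
  shows "z$0 = 0" "z \<bullet> z = 1" "x \<bullet> z = 0" "y \<bullet> z = 0" "y \<odot> x = - z" "y \<odot> z = x" "z \<odot> y = - x"
    "z \<odot> x = y" "x \<odot> z = - y"
proof -
  show z0: "z$0 = 0" using x y xy by (simp add: z[symmetric] oct_mult_real)
  show "z \<bullet> z = 1" using x y by (simp add: z[symmetric] oct_norm_mult)
  show yx: "y \<odot> x = - z" using imag_anticomm[OF y(1) x(1)] xy z by (simp add: inner_commute)
  show xz: "x \<odot> z = - y" using imag_left_square[OF x(1), of y] x z by simp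
  have yz': "y \<odot> (y \<odot> x) = - x" using imag_left_square[OF y(1), of x] y by simp
  then show yz: "y \<odot> z = x" by (simp add: yx octonion_bilinear)
  show xz0: "x \<bullet> z = 0"
    using imag_left_skew[OF x(1), of y x] imag_square[OF x(1)] x y z by (simp add: inner_commute)
  show yz0: "y \<bullet> z = 0"
    using imag_right_skew[OF y(1), of x y] imag_square[OF y(1)] x y z by (simp add: inner_commute)
  show "z \<odot> y = - x" using imag_anticomm[OF z0 y(1)] yz yz0 by (simp add: inner_commute)
  show "z \<odot> x = y" using imag_anticomm[OF z0 x(1)] xz xz0 by (simp add: inner_commute)
qed

text \<open>Any two of the seven imaginary units lie on a common line of the Fano plane, so the
  multiplication table consists of seven instances \<open>l1\<close>, ..., \<open>l7\<close> of
  \<open>unit_product\<close>. Four lines hold by the choice of c, d, e, f; the products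
  \<open>bc_e\<close>, \<open>cd_f\<close> and \<open>ef_a\<close> on the other three are found by
  moving factors with \<open>imag_left_alt\<close>.\<close>

lemma basic_triple_products:
  assumes t: "basic_triple u a b"
  defines "w \<equiv> (\<lambda>i::8. if i = 0 then oct_unit 0 else if i = 1 then u else if i = 2 then a else if i = 3 then b
      else if i = 4 then u \<odot> a else if i = 5 then a \<odot> b else if i = 6 then u \<odot> (a \<odot> b) else u \<odot> b)"
  shows "(\<Sum>i\<in>UNIV. x$i *\<^sub>R w i) \<odot> (\<Sum>i\<in>UNIV. y$i *\<^sub>R w i) = (\<Sum>i\<in>UNIV. (x \<odot> y)$i *\<^sub>R w i)"
proof -
  have u: "u$0 = 0" "u \<bullet> u = 1" and a: "a$0 = 0" "a \<bullet> a = 1" and b: "b$0 = 0" "b \<bullet> b = 1"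
    and ua: "u \<bullet> a = 0" and ub: "u \<bullet> b = 0" and ab: "a \<bullet> b = 0" and uab: "(u \<odot> a) \<bullet> b = 0"
    using t by (auto simp: basic_triple_def)
  define c d e f where "c = u \<odot> a" and "d = a \<odot> b" and "e = u \<odot> d" and "f = u \<odot> b"
  note l1 = unit_product[OF u a ua c_def[symmetric]]
  note l2 = unit_product[OF a b ab d_def[symmetric]]
  have ud: "u \<bullet> d = 0"
    using imag_right_skew[OF b(1), of a u] imag_left_skew[OF u(1), of a b] uab
      imag_anticomm[OF b(1) u(1)] ub a u b by (simp add: d_def inner_commute imag_right_skew)
  note l3 = unit_product[OF u l2(1,2) ud e_def[symmetric]]
  note l7 = unit_product[OF u b ub f_def[symmetric]]
  have bc: "b \<bullet> c = 0" using uab by (simp add: c_def inner_commute)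
  have bc_e: "b \<odot> c = e"
    using imag_left_alt[OF b(1) u(1), of a] ub l2(5) by (simp add: c_def e_def inner_commute octonion_bilinear)
  note l4 = unit_product[OF b l1(1,2) bc bc_e]
  have cd: "c \<bullet> d = 0"
    using imag_left_skew[OF a(1), of u "d"] l1(5) l2(9) ub
    by (simp add: inner_commute)
  have ca: "c \<bullet> a = 0" using l1(4) by (simp add: inner_commute)
  have cd_f: "c \<odot> d = f"
  proof -
    have "c \<odot> d = - (a \<odot> (c \<odot> b))" using imag_left_alt[OF l1(1) a(1), of b] ca by (simp add: d_def)
    also have "\<dots> = a \<odot> e" by (simp add: l4(5) octonion_bilinear)
    also have "\<dots> = - (u \<odot> (a \<odot> d))" using imag_left_alt[OF a(1) u(1), of d] ua by (simp add: e_def inner_commute)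
    also have "\<dots> = f" by (simp add: l2(9) f_def octonion_bilinear)
    finally show ?thesis .
  qed
  note l5 = unit_product[OF l1(1,2) l2(1,2) cd cd_f]
  have ef: "e \<bullet> f = 0"
  proof -
    have "e \<bullet> f = - (d \<bullet> (u \<odot> f))" unfolding e_def by (rule imag_left_skew[OF u(1)])
    then show ?thesis using l7(9) l2(4) by (simp add: inner_commute)
  qed
  have eu: "e \<bullet> u = 0" using l3(3) by (simp add: inner_commute)
  have ef_a: "e \<odot> f = a"
  proof -
    have "e \<odot> f = - (u \<odot> (e \<odot> b))" using imag_left_alt[OF l3(1) u(1), of b] eu by (simp add: f_def)
    also have "e \<odot> b = c" using l4(8) .
    finally show ?thesis by (simp add: l1(9))
  qed
  note l6 = unit_product[OF l3(1,2) l7(1,2) ef ef_a]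
  have sq: "x \<odot> x = - oct_unit 0" if "x$0 = 0" "x \<bullet> x = 1" for x
    using imag_square[OF that(1)] that by simp
  note tab = l1(5-9) l2(5-9) l3(5-9) l4(5-9) l5(5-9) l6(5-9) l7(5-9) sq[OF u] sq[OF a] sq[OF b]
    sq[OF l1(1,2)] sq[OF l2(1,2)] sq[OF l3(1,2)] sq[OF l7(1,2)] bc_e cd_f ef_a
    c_def[symmetric] d_def[symmetric] e_def[symmetric] f_def[symmetric]
  have w: "w 0 = oct_unit 0" "w 1 = u" "w 2 = a" "w 3 = b" "w 4 = c" "w 5 = d" "w 6 = e" "w 7 = f"
    by (simp_all add: w_def c_def d_def e_def f_def)
  show ?thesis
    unfolding sum_8 w octonion_mult_nth
    by (simp only: octonion_bilinear tab oct_one_mult) (simp add: algebra_simps)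
qed

theorem basic_triple_automorphism:
  assumes t: "basic_triple u a b"
  obtains g where "g \<in> carrier G2" "g *v oct_unit 1 = u" "g *v oct_unit 2 = a" "g *v oct_unit 3 = b"
proof -
  define w where "w = (\<lambda>i::8. if i = 0 then oct_unit 0 else if i = 1 then u else if i = 2 then a else if i = 3 then b
      else if i = 4 then u \<odot> a else if i = 5 then a \<odot> b else if i = 6 then u \<odot> (a \<odot> b) else u \<odot> b)"
  define g :: "real^8^8" where "g = (\<chi> i j. w j$i)"
  have g: "g *v x = (\<Sum>i\<in>UNIV. x$i *\<^sub>R w i)" for x
    by (simp add: g_def matrix_vector_mult_def vec_eq_iff mult.commute)
  have mult: "g *v (x \<odot> y) = (g *v x) \<odot> (g *v y)" for x y
    unfolding g w_def basic_triple_products[OF t] ..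
  have gu: "g *v oct_unit i = w i" for i
    by (simp add: g if_distrib[of "\<lambda>r. r *\<^sub>R _"] cong: if_cong)
  have "x = 0" if "g *v x = 0" for x
  proof -
    \<comment> \<open>The octonion conjugate of x: the product xy is the squared norm, which g
      cannot annihilate.\<close>
    define y where "y = (2 * x$0) *\<^sub>R oct_unit 0 - x"
    have "x \<odot> y = (x \<bullet> x) *\<^sub>R oct_unit 0"
      unfolding y_def by (simp add: octonion_coords)
    then have "(x \<bullet> x) *\<^sub>R (g *v oct_unit 0) = (g *v x) \<odot> (g *v y)"
      by (metis mult matrix_vector_mult_scaleR)
    then have "(x \<bullet> x) *\<^sub>R oct_unit 0 = 0" using that gu by (simp add: octonion_bilinear w_def)
    then have "((x \<bullet> x) *\<^sub>R oct_unit 0)$0 = (0::octonion)$0" by (rule arg_cong)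
    then show ?thesis by simp
  qed
  then have "invertible g"
    by (simp add: invertible_left_inverse matrix_left_invertible_ker)
  then have "g \<in> carrier G2" using mult by (simp add: G2_iff)
  moreover have "g *v oct_unit 1 = u" "g *v oct_unit 2 = a" "g *v oct_unit 3 = b"
    by (simp_all add: gu w_def)
  ultimately show ?thesis using that by blast
qed

section \<open>Normal form of a derivation\<close>

text \<open>First-order condition for a minimum at t = 0. Evaluation at t = -b / (c + 1) also covers
  c = 0.\<close>

lemma linear_term_vanishes:
  assumes "\<And>t::real. 0 \<le> 2 * t * b + t\<^sup>2 * c" shows "b = 0"
proof -
  have c: "0 \<le> c" using assms[of 1] assms[of "-1"] by simp
  define s where "s = c + 1"
  have s: "s > 0" and cs: "c = s - 1" using c by (auto simp: s_def)
  have "0 \<le> 2 * (- b / s) * b + (- b / s)\<^sup>2 * c" by (rule assms)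
  also have "\<dots> = - b\<^sup>2 * (s + 1) / s\<^sup>2" unfolding cs using s by (simp add: field_simps power2_eq_square)
  finally have "b\<^sup>2 * (s + 1) \<le> 0" using s by (simp add: field_simps)
  then show ?thesis using s by (simp add: mult_le_0_iff)
qed

text \<open>The Rayleigh quotient has a maximum k on the unit sphere of W, attained at v. The form k
  (y . y) - y . T y is then nonnegative on W and zero at v, so its derivative at v vanishes, in
  particular in the direction T v - k v.\<close>

lemma symmetric_eigenvector:
  fixes T :: "'a::euclidean_space \<Rightarrow> 'a"
  assumes lin: "linear T" and W: "subspace W" "W \<noteq> {0}" and inv: "\<And>x. x \<in> W \<Longrightarrow> T x \<in> W"
    and sym: "\<And>x y. x \<in> W \<Longrightarrow> y \<in> W \<Longrightarrow> T x \<bullet> y = x \<bullet> T y"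
  obtains v k where "v \<in> W" "v \<bullet> v = 1" "T v = k *\<^sub>R v"
proof -
  have cpt: "compact (sphere 0 1 \<inter> W)" by (intro compact_Int_closed compact_sphere closed_subspace W)
  obtain w where w: "w \<in> W" "w \<noteq> 0" using W subspace_0 by blast
  have "(1 / norm w) *\<^sub>R w \<in> sphere 0 1 \<inter> W" using w W by (simp add: subspace_scale)
  then have ne: "sphere 0 1 \<inter> W \<noteq> {}" by blast
  have "continuous_on (sphere 0 1 \<inter> W) (\<lambda>x. x \<bullet> T x)"
    by (intro continuous_intros linear_continuous_on linear_conv_bounded_linear[THEN iffD1] lin)
  from continuous_attains_sup[OF cpt ne this] obtain v where v: "v \<in> W" "norm v = 1"
    and max: "\<And>y. y \<in> W \<Longrightarrow> norm y = 1 \<Longrightarrow> y \<bullet> T y \<le> v \<bullet> T v" by auto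
  define k where "k = v \<bullet> T v"
  have Q: "0 \<le> k * (y \<bullet> y) - y \<bullet> T y" if y: "y \<in> W" for y
  proof (cases "y = 0")
    case False
    define z where "z = (1 / norm y) *\<^sub>R y"
    have yz: "y = norm y *\<^sub>R z" using False by (simp add: z_def)
    have z: "z \<in> W" "norm z = 1" using y W False by (auto simp: z_def subspace_scale)
    have zz: "z \<bullet> z = 1" using z by (simp add: norm_eq_1)
    have "y \<bullet> T y = (norm y * norm y) * (z \<bullet> T z)"
      by (subst (1 2) yz) (simp add: linear_scale[OF lin])
    also have "\<dots> \<le> (norm y * norm y) * k" using max[OF z] by (intro mult_left_mono) (auto simp: k_def)
    finally show ?thesis by (simp add: dot_square_norm power2_eq_square mult.commute)
  qed simp
  have vv: "v \<bullet> v = 1" using v by (simp add: norm_eq_1)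
  define y where "y = T v - k *\<^sub>R v"
  have y: "y \<in> W" using v W inv by (simp add: y_def subspace_diff subspace_scale)
  have "(k *\<^sub>R v - T v) \<bullet> y = 0"
  proof (rule linear_term_vanishes)
    fix t :: real
    have "v + t *\<^sub>R y \<in> W" using v y W by (simp add: subspace_add subspace_scale)
    from Q[OF this] show "0 \<le> 2 * t * ((k *\<^sub>R v - T v) \<bullet> y) + t\<^sup>2 * (k * (y \<bullet> y) - y \<bullet> T y)"
      using sym[OF v(1) y] vv
      by (simp add: linear_add[OF lin] linear_scale[OF lin] inner_add_left inner_add_right inner_diff_left
           k_def[symmetric] power2_eq_square inner_commute algebra_simps)
  qed
  moreover have "k *\<^sub>R v - T v = - y" by (simp add: y_def)
  ultimately have "y = 0" by simp
  then have "T v = k *\<^sub>R v" by (simp add: y_def)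
  with v vv that show ?thesis by blast
qed

text \<open>The unit \<open>e\<^sub>0\<close> is split off by adding \<open>1\<close> to the corner; the sign matrix \<open>J\<close> of determinant \<open>-1\<close>
  then maps the result to its transpose.\<close>

lemma skew_kernel:
  assumes d: "d \<in> g2"
  obtains u where "u$0 = 0" "u \<bullet> u = 1" "d *v u = 0"
proof -
  have z: "d$0$j = 0" "d$j$0 = 0" for j
    using g2_nth_0[OF d, of "oct_unit j"] g2_unit[OF d] by (simp_all add: matrix_vector_oct_unit[symmetric])
  define E :: "real^8^8" where "E = (\<chi> i j. if i = 0 \<and> j = 0 then 1 else 0)"
  define J :: "real^8^8" where "J = (\<chi> i j. if i = j then (if i = 0 then 1 else -1) else 0)"
  have "det J = (\<Prod>i\<in>UNIV. J$i$i)" by (rule det_diagonal) (simp add: J_def)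
  also have "\<dots> = -1" unfolding UNIV_8 by (simp add: J_def)
  finally have J: "det J = -1" .
  have "J ** (d + E) = transpose (d + E)"
  proof -
    have "(J ** (d + E))$i$j = transpose (d + E)$i$j" for i j
    proof -
      have "(J ** (d + E))$i$j = (\<Sum>k\<in>UNIV. J$i$k * (d + E)$k$j)"
        by (simp add: matrix_matrix_mult_def)
      also have "\<dots> = (\<Sum>k\<in>UNIV. (if i = k then (if i = 0 then 1 else -1) * (d + E)$k$j else 0))"
        by (rule sum.cong) (auto simp: J_def)
      also have "\<dots> = (if i = 0 then 1 else -1) * (d + E)$i$j" by simp
      also have "\<dots> = transpose (d + E)$i$j"
        using g2_skew[OF d, of i j] z by (auto simp: transpose_def E_def)
      finally show ?thesis .
    qed
    then show ?thesis by (simp add: vec_eq_iff)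
  qed
  then have "det J * det (d + E) = det (d + E)" by (metis det_mul det_transpose)
  then have "det (d + E) = 0" using J by simp
  then have "\<not> invertible (d + E)" by (simp add: invertible_det_nz)
  then obtain x where x: "x \<noteq> 0" "(d + E) *v x = 0"
    by (auto simp: invertible_left_inverse matrix_left_invertible_ker)
  have Ex: "E *v x = x$0 *\<^sub>R oct_unit 0"
    by (auto simp: vec_eq_iff matrix_vector_mult_def E_def sum_8)
  have "((d + E) *v x)$0 = x$0"
    by (simp add: matrix_vector_mult_add_rdistrib Ex g2_nth_0[OF d])
  then have x0: "x$0 = 0" using x by simp
  have dx: "d *v x = 0" using x(2) by (simp add: matrix_vector_mult_add_rdistrib Ex x0)
  define u where "u = (1 / norm x) *\<^sub>R x"
  show thesis
  proof (rule that)
    show "u$0 = 0" "d *v u = 0" using x0 dx by (simp_all add: u_def matrix_vector_mult_scaleR)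
    show "u \<bullet> u = 1" using x by (simp add: u_def dot_square_norm power2_eq_square)
  qed
qed

text \<open>For a derivation d this says that the automorphism sending e1, e2, e3 to u, a, b carries
  \<open>real_torus p q\<close> to d: the planes of a, ua and of b, ub are rotated with speeds p and
  q.\<close>

definition torus_frame :: "real^8^8 \<Rightarrow> octonion \<Rightarrow> octonion \<Rightarrow> octonion \<Rightarrow> real \<Rightarrow> real \<Rightarrow> bool" where
  "torus_frame d u a b p q \<longleftrightarrow> basic_triple u a b \<and> d *v u = 0 \<and> d *v a = p *\<^sub>R (u \<odot> a) \<and> d *v b = q *\<^sub>R (u \<odot> b)"

text \<open>Left multiplication by u and d are skew, and they commute since d u = 0; hence T is
  symmetric. An eigenvector a satisfies d a = -k (u a). As u a has the same eigenvalue, T preserves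
  the complement \<open>W2\<close> of the quaternion algebra of u and a, and b is an eigenvector
  there.\<close>

lemma torus_frame_exists:
  assumes d: "d \<in> g2"
  obtains u a b p q where "torus_frame d u a b p q"
proof -
  obtain u where u: "u$0 = 0" "u \<bullet> u = 1" "d *v u = 0" using skew_kernel[OF d] .
  define T where "T x = u \<odot> (d *v x)" for x
  have lin: "linear T"
    unfolding T_def by (intro linearI) (simp_all add: matrix_vector_right_distrib matrix_vector_mult_scaleR octonion_bilinear)
  have sym: "T x \<bullet> y = x \<bullet> T y" for x y
    by (simp add: T_def imag_left_skew[OF u(1)] g2_inner[OF d] g2_mult[OF d] u octonion_bilinear)
  have T0: "T x$0 = 0" for x
    using sym[of x "oct_unit 0"] by (simp add: T_def g2_unit[OF d] octonion_bilinear)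
  have Tu: "u \<bullet> T x = 0" for x
    using sym[of x u] by (simp add: T_def u octonion_bilinear inner_commute)
  have eig: "d *v v = (- k) *\<^sub>R (u \<odot> v)" if "T v = k *\<^sub>R v" for v k
    using imag_left_square[OF u(1), of "d *v v"] that u by (simp add: T_def octonion_bilinear neg_equal_iff_equal)
  define W1 where "W1 = {x. x$0 = 0 \<and> u \<bullet> x = 0}"
  have W1: "subspace W1" by (auto simp: W1_def subspace_def inner_add_right)
  have "dim (span {oct_unit 0, u}) < DIM(octonion)"
    using dim_le_card'[of "{oct_unit 0, u}"] card_length[of "[oct_unit 0, u]"] by simp
  then obtain x where x: "x \<noteq> 0" "\<And>y. y \<in> span {oct_unit 0, u} \<Longrightarrow> orthogonal x y"
    using orthogonal_to_subspace_exists by (metis span_span dim_span)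
  have "y \<bullet> x = 0" if "y \<in> {oct_unit 0, u}" for y
    using x(2)[OF span_base[OF that]] by (simp add: orthogonal_def inner_commute)
  from this[of "oct_unit 0"] this[of u] have "x \<noteq> 0 \<and> x \<in> W1" using x(1) by (simp add: W1_def)
  then have ne: "W1 \<noteq> {0}" by blast
  obtain a k where a: "a \<in> W1" "a \<bullet> a = 1" "T a = k *\<^sub>R a"
    using symmetric_eigenvector[OF lin W1 ne] T0 Tu sym by (auto simp: W1_def)
  have da: "d *v a = (- k) *\<^sub>R (u \<odot> a)" by (rule eig[OF a(3)])
  have a0: "a$0 = 0" "u \<bullet> a = 0" using a by (auto simp: W1_def)
  have Tua: "T (u \<odot> a) = k *\<^sub>R (u \<odot> a)"
    using da imag_left_square[OF u(1), of a] u by (simp add: T_def g2_mult[OF d] octonion_bilinear)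
  define W2 where "W2 = {x. x$0 = 0 \<and> u \<bullet> x = 0 \<and> a \<bullet> x = 0 \<and> (u \<odot> a) \<bullet> x = 0}"
  have W2: "subspace W2" by (auto simp: W2_def subspace_def inner_add_right)
  have c4: "card {oct_unit 0, u, a, u \<odot> a} \<le> 4"
    using card_length[of "[oct_unit 0, u, a, u \<odot> a]"] by simp
  have "dim (span {oct_unit 0, u, a, u \<odot> a}) < DIM(octonion)"
    using dim_le_card'[of "{oct_unit 0, u, a, u \<odot> a}"] c4 by simp
  then obtain x where x: "x \<noteq> 0" "\<And>y. y \<in> span {oct_unit 0, u, a, u \<odot> a} \<Longrightarrow> orthogonal x y"
    using orthogonal_to_subspace_exists by (metis span_span dim_span)
  have "y \<bullet> x = 0" if "y \<in> {oct_unit 0, u, a, u \<odot> a}" for y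
    using x(2)[OF span_base[OF that]] by (simp add: orthogonal_def inner_commute)
  from this[of "oct_unit 0"] this[of u] this[of a] this[of "u \<odot> a"] have "x \<in> W2" by (simp add: W2_def)
  then have ne2: "W2 \<noteq> {0}" using x by blast
  have inv2: "T x \<in> W2" if "x \<in> W2" for x
    using that T0 Tu sym[of a x] sym[of "u \<odot> a" x] a(3) Tua by (auto simp: W2_def)
  obtain b l where b: "b \<in> W2" "b \<bullet> b = 1" "T b = l *\<^sub>R b"
    using symmetric_eigenvector[OF lin W2 ne2 inv2] sym by auto
  have "basic_triple u a b"
    using u a b a0 by (auto simp: basic_triple_def W2_def)
  then have "torus_frame d u a b (- k) (- l)"
    using u da eig[OF b(3)] by (simp add: torus_frame_def)
  then show ?thesis using that by blast
qed

lemma torus_frame_swap: "torus_frame d u a b p q \<Longrightarrow> torus_frame d u b a q p"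
  using imag_left_skew[of u a b] by (auto simp: torus_frame_def basic_triple_def inner_commute)

lemma torus_frame_neg: "torus_frame d u a b p q \<Longrightarrow> torus_frame d (- u) a b (- p) (- q)"
  by (auto simp: torus_frame_def basic_triple_def octonion_bilinear matrix_vector_mult_minus
      linear_neg[OF matrix_vector_mul_linear])

text \<open>The planes of a, b and ab carry the weights p, q, -(p + q), which sum to zero. This
  exchange of b with ab, the swap of a and b, and the sign change of u generate the action of the
  Weyl group of order 12 on the weights.\<close>

lemma torus_frame_third:
  assumes d: "d \<in> g2" and t: "torus_frame d u a b p q"
  shows "torus_frame d u a (a \<odot> b) p (- (p + q))"
proof -
  have u: "u$0 = 0" "u \<bullet> u = 1" and a: "a$0 = 0" "a \<bullet> a = 1" and b: "b$0 = 0" "b \<bullet> b = 1"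
    and ua: "u \<bullet> a = 0" and ub: "u \<bullet> b = 0" and ab: "a \<bullet> b = 0" and uab: "(u \<odot> a) \<bullet> b = 0"
    and dd: "d *v u = 0" "d *v a = p *\<^sub>R (u \<odot> a)" "d *v b = q *\<^sub>R (u \<odot> b)"
    using t by (auto simp: basic_triple_def torus_frame_def)
  note l2 = unit_product[OF a b ab refl]
  note l1 = unit_product[OF u a ua refl]
  have "(u \<odot> a) \<odot> b = - (b \<odot> (u \<odot> a))"
    using imag_anticomm[OF l1(1) b(1)] uab by simp
  also have "b \<odot> (u \<odot> a) = u \<odot> (a \<odot> b)"
    using imag_left_alt[OF b(1) u(1), of a] ub l2(5) by (simp add: inner_commute octonion_bilinear)
  finally have 1: "(u \<odot> a) \<odot> b = - (u \<odot> (a \<odot> b))" .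
  have 2: "a \<odot> (u \<odot> b) = - (u \<odot> (a \<odot> b))"
    using imag_left_alt[OF a(1) u(1), of b] ua by (simp add: inner_commute)
  have "d *v (a \<odot> b) = (- (p + q)) *\<^sub>R (u \<odot> (a \<odot> b))"
    by (simp add: g2_mult[OF d] dd octonion_bilinear 1 2 scaleR_add_left scaleR_diff_left)
  moreover have "u \<bullet> (a \<odot> b) = 0"
    using imag_left_skew[OF a(1), of b u] uab l1(5) by (simp add: inner_commute)
  moreover have "(u \<odot> a) \<bullet> (a \<odot> b) = 0"
    using imag_left_skew[OF a(1), of u "a \<odot> b"] l1(5) l2(9) ub by simp
  ultimately show ?thesis
    using l2 u a b ua dd by (simp add: torus_frame_def basic_triple_def)
qed

text \<open>Among three numbers with sum zero two have the same weak sign. Choosing these, then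
  adjusting sign and order, reaches the closed Weyl chamber of the simple roots t1 and t2 -
  t1.\<close>

theorem torus_frame_dominant:
  assumes d: "d \<in> g2"
  obtains u a b p q where "torus_frame d u a b p q" "0 \<le> p" "p \<le> q"
proof -
  obtain u a b p q where t: "torus_frame d u a b p q" using torus_frame_exists[OF d] .
  have same_sign: thesis if t: "torus_frame d u a b p q" and "0 \<le> p" "0 \<le> q" for u a b p q
    using that torus_frame_swap[OF t] \<open>\<And>u a b p q. torus_frame d u a b p q \<Longrightarrow> 0 \<le> p \<Longrightarrow> p \<le> q \<Longrightarrow> thesis\<close>
    by (meson linear)
  have same_sign': thesis if t: "torus_frame d u a b p q" and "p \<le> 0" "q \<le> 0" for u a b p q
    using same_sign[OF torus_frame_neg[OF t]] that by simp
  have mixed: thesis if t: "torus_frame d u a b p q" and "p \<ge> 0" "q \<le> 0" for u a b p q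
  proof (cases "p + q \<le> 0")
    case True
    then show ?thesis using same_sign[OF torus_frame_third[OF d t]] that by simp
  next
    case False
    then show ?thesis using same_sign'[OF torus_frame_third[OF d torus_frame_swap[OF t]]] that by simp
  qed
  show thesis using same_sign[OF t] same_sign'[OF t] mixed[OF t] mixed[OF torus_frame_swap[OF t]] by linarith
qed


section \<open>Root coordinates on the complexified algebra\<close>

definition of_rows :: "'a list list \<Rightarrow> 'a^8^8" where
  "of_rows xs = (let ix = (\<lambda>i::8. if i = 0 then 0 else if i = 1 then 1 else if i = 2 then 2 else if i = 3 then 3
     else if i = 4 then 4 else if i = 5 then 5 else if i = 6 then 6 else 7) in \<chi> i j. xs ! ix i ! ix j)"

lemma matrix_entry_lie_bracket:
  "lie_bracket A B$i$j = (\<Sum>k\<in>UNIV. A$i$k * B$k$j) - (\<Sum>k\<in>UNIV. B$i$k * A$k$j)"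
  by (simp add: lie_bracket_def matrix_matrix_mult_def)

text \<open>Besides skew symmetry, one equation for each imaginary unit \<open>e\<^sub>k\<close>: it sums over the three
  products \<open>e\<^sub>i e\<^sub>j = e\<^sub>k\<close>.\<close>

definition derivation_eqs :: "'a::field^8^8 \<Rightarrow> bool" where
  "derivation_eqs D \<longleftrightarrow> transpose D = - D \<and> (\<forall>i. D$i$i = 0) \<and> (\<forall>j. D$0$j = 0) \<and>
    D$2$4 + D$3$7 + D$5$6 = 0 \<and> D$3$5 + D$4$1 + D$6$7 = 0 \<and>
    D$4$6 + D$5$2 + D$7$1 = 0 \<and> D$5$7 + D$6$3 + D$1$2 = 0 \<and>
    D$6$1 + D$7$4 + D$2$3 = 0 \<and> D$7$2 + D$1$5 + D$3$4 = 0 \<and>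
    D$1$3 + D$2$6 + D$4$5 = 0"

lemma g2_derivation_eqs:
  assumes d: "d \<in> g2" shows "derivation_eqs d"
proof -
  have e: "(d *v (oct_unit i \<odot> oct_unit j))$k = ((d *v oct_unit i) \<odot> oct_unit j + oct_unit i \<odot> (d *v oct_unit j))$k" for i j k
    by (simp add: g2_mult[OF d])
  have m: "oct_unit 2 \<odot> oct_unit 3 = oct_unit 5" "oct_unit 3 \<odot> oct_unit 4 = oct_unit 6"
    "oct_unit 4 \<odot> oct_unit 5 = oct_unit 7" "oct_unit 5 \<odot> oct_unit 6 = oct_unit 1"
    "oct_unit 6 \<odot> oct_unit 7 = oct_unit 2" "oct_unit 7 \<odot> oct_unit 1 = oct_unit 3"
    "oct_unit 1 \<odot> oct_unit 2 = oct_unit 4"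
    by (simp_all add: octonion_coords)
  note s = g2_skew[OF d]
  have z: "d$i$i = 0" for i using s[of i i] by simp
  have "d$0$j = 0" for j using g2_nth_0[OF d, of "oct_unit j"] by (simp add: matrix_vector_oct_unit)
  moreover have
    "d$2$4 + d$3$7 + d$5$6 = 0" "d$3$5 + d$4$1 + d$6$7 = 0"
    "d$4$6 + d$5$2 + d$7$1 = 0" "d$5$7 + d$6$3 + d$1$2 = 0"
    "d$6$1 + d$7$4 + d$2$3 = 0" "d$7$2 + d$1$5 + d$3$4 = 0"
    "d$1$3 + d$2$6 + d$4$5 = 0"
    \<comment> \<open>One coordinate of one product rule per equation: the coordinate 6 for e2 e3 =
      e5, and its rotations of the indices modulo 7.\<close>
    using e[of 2 3 6] e[of 3 4 7] e[of 4 5 1] e[of 5 6 2] e[of 6 7 3] e[of 7 1 4] e[of 1 2 5]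
      s[of 4 2] s[of 7 3] s[of 6 5] s[of 5 3] s[of 1 4] s[of 7 6] s[of 6 4] s[of 2 5] s[of 1 7]
      s[of 7 5] s[of 3 6] s[of 2 1] s[of 1 6] s[of 4 7] s[of 3 2] s[of 2 7] s[of 5 1] s[of 4 3]
      s[of 3 1] s[of 6 2] s[of 5 4]
    by (simp_all add: m octonion_mult_nth matrix_vector_oct_unit)
  ultimately show ?thesis using g2_transpose[OF d] z unfolding derivation_eqs_def by blast
qed

text \<open>Solved form for rewriting: of the 21 entries above the diagonal between imaginary units,
  seven are eliminated, which leaves the 14 parameters of the algebra.\<close>

lemma derivation_eqs_unfold:
  fixes D :: "'a::field^8^8"
  assumes "derivation_eqs D"
  shows "D$0$i = 0" "D$i$0 = 0" "D$i$i = 0"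
    "D$2$1 = - D$1$2" "D$3$1 = - D$1$3" "D$4$1 = - D$1$4" "D$5$1 = - D$1$5" "D$6$1 = - D$1$6" "D$7$1 = - D$1$7"
    "D$3$2 = - D$2$3" "D$4$2 = - D$2$4" "D$5$2 = - D$2$5" "D$6$2 = - D$2$6" "D$7$2 = - D$2$7"
    "D$4$3 = - D$3$4" "D$5$3 = - D$3$5" "D$6$3 = - D$3$6" "D$7$3 = - D$3$7"
    "D$5$4 = - D$4$5" "D$6$4 = - D$4$6" "D$7$4 = - D$4$7"
    "D$6$5 = - D$5$6" "D$7$5 = - D$5$7" "D$7$6 = - D$6$7"
    "D$5$6 = - D$2$4 - D$3$7" "D$6$7 = D$1$4 - D$3$5" "D$4$6 = D$2$5 + D$1$7"
    "D$5$7 = D$3$6 - D$1$2" "D$4$7 = D$2$3 - D$1$6" "D$3$4 = D$2$7 - D$1$5" "D$4$5 = - D$1$3 - D$2$6"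
proof -
  have s: "D$i$j = - D$j$i" for i j
  proof -
    have "transpose D$j$i = (- D)$j$i" using assms by (simp add: derivation_eqs_def)
    then show ?thesis by (simp add: transpose_def)
  qed
  show "D$0$i = 0" "D$i$i = 0" using assms by (simp_all add: derivation_eqs_def)
  then show "D$i$0 = 0" using s[of i 0] by simp
  show "D$2$1 = - D$1$2" "D$3$1 = - D$1$3" "D$4$1 = - D$1$4" "D$5$1 = - D$1$5" "D$6$1 = - D$1$6" "D$7$1 = - D$1$7"
    "D$3$2 = - D$2$3" "D$4$2 = - D$2$4" "D$5$2 = - D$2$5" "D$6$2 = - D$2$6" "D$7$2 = - D$2$7"
    "D$4$3 = - D$3$4" "D$5$3 = - D$3$5" "D$6$3 = - D$3$6" "D$7$3 = - D$3$7"
    "D$5$4 = - D$4$5" "D$6$4 = - D$4$6" "D$7$4 = - D$4$7"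
    "D$6$5 = - D$5$6" "D$7$5 = - D$5$7" "D$7$6 = - D$6$7" by (rule s)+
  have E: "D$2$4 + D$3$7 + D$5$6 = 0" "D$3$5 + D$4$1 + D$6$7 = 0"
    "D$4$6 + D$5$2 + D$7$1 = 0" "D$5$7 + D$6$3 + D$1$2 = 0"
    "D$6$1 + D$7$4 + D$2$3 = 0" "D$7$2 + D$1$5 + D$3$4 = 0"
    "D$1$3 + D$2$6 + D$4$5 = 0" using assms by (simp_all add: derivation_eqs_def)
  show "D$5$6 = - D$2$4 - D$3$7" "D$6$7 = D$1$4 - D$3$5" "D$4$6 = D$2$5 + D$1$7"
    "D$5$7 = D$3$6 - D$1$2" "D$4$7 = D$2$3 - D$1$6" "D$3$4 = D$2$7 - D$1$5" "D$4$5 = - D$1$3 - D$2$6"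
    using E s[of 4 1] s[of 5 2] s[of 7 1] s[of 6 3] s[of 6 1] s[of 7 4] s[of 7 2] by algebra+
qed

lemma matrix_vector_mult_8: "(A *v x)$i = A$i$0 * x$0 + A$i$1 * x$1 + A$i$2 * x$2 + A$i$3 * x$3 + A$i$4 * x$4
    + A$i$5 * x$5 + A$i$6 * x$6 + A$i$7 * x$7" for A :: "real^8^8"
  by (simp add: matrix_vector_mult_def sum_8)

lemma g2_iff_derivation_eqs: "d \<in> g2 \<longleftrightarrow> derivation_eqs d"
proof
  assume "derivation_eqs d"
  note e = derivation_eqs_unfold[OF this]
  show "d \<in> g2"
    unfolding g2_iff vec_eq_iff forall_8
    by (simp add: octonion_mult_nth matrix_vector_mult_8 e) (simp add: algebra_simps)
qed (rule g2_derivation_eqs)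

section \<open>The complexified algebra in root coordinates\<close>

definition cmat :: "real^'n^'n \<Rightarrow> real^'n^'n \<Rightarrow> complex^'n^'n" where
  "cmat X Y = (\<chi> i j. Complex (X$i$j) (Y$i$j))"

lemma cmat_nth [simp]: "cmat X Y$i$j = Complex (X$i$j) (Y$i$j)"
  by (simp add: cmat_def)

lemma complexification_cmat: "complexification L = {cmat X Y | X Y. X \<in> L \<and> Y \<in> L}"
  by (simp add: complexification_def cmat_def)

lemma cmat_cases: obtains X Y where "Z = cmat X Y"
  by (rule that[of "\<chi> i j. Re (Z$i$j)" "\<chi> i j. Im (Z$i$j)"]) (simp add: vec_eq_iff)

lemma cmat_eq_iff: "cmat X Y = cmat X' Y' \<longleftrightarrow> X = X' \<and> Y = Y'"
  by (auto simp: vec_eq_iff)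

lemma derivation_eqs_cmat: "derivation_eqs (cmat X Y) \<longleftrightarrow> derivation_eqs X \<and> derivation_eqs Y"
proof -
  have "transpose (cmat X Y) = - cmat X Y \<longleftrightarrow> transpose X = - X \<and> transpose Y = - Y"
    by (auto simp: vec_eq_iff transpose_def complex_eq_iff)
  then show ?thesis
    unfolding derivation_eqs_def cmat_nth by (auto simp: complex_eq_iff)
qed

text \<open>The equations are linear with integer coefficients, so a complex matrix satisfies them
  exactly when its real and imaginary parts do.\<close>

lemma complexification_g2: "complexification g2 = {D. derivation_eqs D}"
proof
  show "complexification g2 \<subseteq> {D. derivation_eqs D}"
    by (auto simp: complexification_cmat derivation_eqs_cmat g2_iff_derivation_eqs)
  show "{D. derivation_eqs D} \<subseteq> complexification g2"
  proof
    fix D :: "complex^8^8" assume D: "D \<in> {D. derivation_eqs D}"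
    obtain X Y where "D = cmat X Y" using cmat_cases .
    with D show "D \<in> complexification g2"
      by (auto simp: complexification_cmat derivation_eqs_cmat g2_iff_derivation_eqs)
  qed
qed

text \<open>The torus \<open>(t1, t2)\<close> rotates the planes \<open>(e\<^sub>2, e\<^sub>4)\<close>, \<open>(e\<^sub>3, e\<^sub>7)\<close>, \<open>(e\<^sub>5, e\<^sub>6)\<close> with speeds
  \<open>t1\<close>, \<open>t2\<close>, \<open>- t1 - t2\<close>. The coordinates \<open>a1, \<dots>, a6\<close> belong to the positive roots \<open>t1\<close>, \<open>t2 - t1\<close>, \<open>t2\<close>,
  \<open>t1 + t2\<close>, \<open>2 t1 + t2\<close>, \<open>t1 + 2 t2\<close>, and \<open>b1, \<dots>, b6\<close> to their negatives; the matrices of the latter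
  are the complex conjugates of those of the former.\<close>

definition root_matrix :: "complex \<Rightarrow> complex \<Rightarrow> complex \<Rightarrow> complex \<Rightarrow> complex \<Rightarrow> complex \<Rightarrow> complex \<Rightarrow> complex \<Rightarrow>
    complex \<Rightarrow> complex \<Rightarrow> complex \<Rightarrow> complex \<Rightarrow> complex \<Rightarrow> complex \<Rightarrow> complex^8^8" where
  "root_matrix t1 t2 a1 a2 a3 a4 a5 a6 b1 b2 b3 b4 b5 b6 = of_rows [
    [0, 0, 0, 0, 0, 0, 0, 0],
    [0, 0, - 2 * \<i> * a1 + 2 * \<i> * b1, - 2 * \<i> * a3 + 2 * \<i> * b3, 2 * a1 + 2 * b1, - 2 * \<i> * a4 + 2 * \<i> * b4, - 2 * a4 - 2 * b4, 2 * a3 + 2 * b3],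
    [0, 2 * \<i> * a1 - 2 * \<i> * b1, 0, a2 - a4 + b2 - b4, - t1, - a3 + a5 - b3 + b5, \<i> * a3 - \<i> * a5 - \<i> * b3 + \<i> * b5, \<i> * a2 - \<i> * a4 - \<i> * b2 + \<i> * b4],
    [0, 2 * \<i> * a3 - 2 * \<i> * b3, - a2 + a4 - b2 + b4, 0, \<i> * a2 + \<i> * a4 - \<i> * b2 - \<i> * b4, a1 - a6 + b1 - b6, - \<i> * a1 + \<i> * a6 + \<i> * b1 - \<i> * b6, - t2],
    [0, - 2 * a1 - 2 * b1, t1, - \<i> * a2 - \<i> * a4 + \<i> * b2 + \<i> * b4, 0, \<i> * a3 + \<i> * a5 - \<i> * b3 - \<i> * b5, a3 + a5 + b3 + b5, a2 + a4 + b2 + b4],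
    [0, 2 * \<i> * a4 - 2 * \<i> * b4, a3 - a5 + b3 - b5, - a1 + a6 - b1 + b6, - \<i> * a3 - \<i> * a5 + \<i> * b3 + \<i> * b5, 0, t1 + t2, \<i> * a1 + \<i> * a6 - \<i> * b1 - \<i> * b6],
    [0, 2 * a4 + 2 * b4, - \<i> * a3 + \<i> * a5 + \<i> * b3 - \<i> * b5, \<i> * a1 - \<i> * a6 - \<i> * b1 + \<i> * b6, - a3 - a5 - b3 - b5, - t1 - t2, 0, a1 + a6 + b1 + b6],
    [0, - 2 * a3 - 2 * b3, - \<i> * a2 + \<i> * a4 + \<i> * b2 - \<i> * b4, t2, - a2 - a4 - b2 - b4, - \<i> * a1 - \<i> * a6 + \<i> * b1 + \<i> * b6, - a1 - a6 - b1 - b6, 0]]"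

context
  fixes t1 t2 a1 a2 a3 a4 a5 a6 b1 b2 b3 b4 b5 b6 :: complex
begin

abbreviation (input) "RM \<equiv> root_matrix t1 t2 a1 a2 a3 a4 a5 a6 b1 b2 b3 b4 b5 b6"

lemma root_matrix_nth:
    "RM$0$0 = 0" "RM$0$1 = 0" "RM$0$2 = 0" "RM$0$3 = 0" "RM$0$4 = 0" "RM$0$5 = 0" "RM$0$6 = 0" "RM$0$7 = 0" "RM$1$0 = 0"
    "RM$1$1 = 0" "RM$1$2 = - 2 * \<i> * a1 + 2 * \<i> * b1" "RM$1$3 = - 2 * \<i> * a3 + 2 * \<i> * b3"
    "RM$1$4 = 2 * a1 + 2 * b1" "RM$1$5 = - 2 * \<i> * a4 + 2 * \<i> * b4" "RM$1$6 = - 2 * a4 - 2 * b4"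
    "RM$1$7 = 2 * a3 + 2 * b3" "RM$2$0 = 0" "RM$2$1 = 2 * \<i> * a1 - 2 * \<i> * b1" "RM$2$2 = 0"
    "RM$2$3 = a2 - a4 + b2 - b4" "RM$2$4 = - t1" "RM$2$5 = - a3 + a5 - b3 + b5"
    "RM$2$6 = \<i> * a3 - \<i> * a5 - \<i> * b3 + \<i> * b5" "RM$2$7 = \<i> * a2 - \<i> * a4 - \<i> * b2 + \<i> * b4"
    "RM$3$0 = 0" "RM$3$1 = 2 * \<i> * a3 - 2 * \<i> * b3" "RM$3$2 = - a2 + a4 - b2 + b4" "RM$3$3 = 0"
    "RM$3$4 = \<i> * a2 + \<i> * a4 - \<i> * b2 - \<i> * b4" "RM$3$5 = a1 - a6 + b1 - b6"
    "RM$3$6 = - \<i> * a1 + \<i> * a6 + \<i> * b1 - \<i> * b6" "RM$3$7 = - t2" "RM$4$0 = 0" "RM$4$1 = - 2 * a1 - 2 * b1"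
    "RM$4$2 = t1" "RM$4$3 = - \<i> * a2 - \<i> * a4 + \<i> * b2 + \<i> * b4" "RM$4$4 = 0"
    "RM$4$5 = \<i> * a3 + \<i> * a5 - \<i> * b3 - \<i> * b5" "RM$4$6 = a3 + a5 + b3 + b5" "RM$4$7 = a2 + a4 + b2 + b4"
    "RM$5$0 = 0" "RM$5$1 = 2 * \<i> * a4 - 2 * \<i> * b4" "RM$5$2 = a3 - a5 + b3 - b5" "RM$5$3 = - a1 + a6 - b1 + b6"
    "RM$5$4 = - \<i> * a3 - \<i> * a5 + \<i> * b3 + \<i> * b5" "RM$5$5 = 0" "RM$5$6 = t1 + t2"
    "RM$5$7 = \<i> * a1 + \<i> * a6 - \<i> * b1 - \<i> * b6" "RM$6$0 = 0" "RM$6$1 = 2 * a4 + 2 * b4"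
    "RM$6$2 = - \<i> * a3 + \<i> * a5 + \<i> * b3 - \<i> * b5" "RM$6$3 = \<i> * a1 - \<i> * a6 - \<i> * b1 + \<i> * b6"
    "RM$6$4 = - a3 - a5 - b3 - b5" "RM$6$5 = - t1 - t2" "RM$6$6 = 0" "RM$6$7 = a1 + a6 + b1 + b6" "RM$7$0 = 0"
    "RM$7$1 = - 2 * a3 - 2 * b3" "RM$7$2 = - \<i> * a2 + \<i> * a4 + \<i> * b2 - \<i> * b4" "RM$7$3 = t2"
    "RM$7$4 = - a2 - a4 - b2 - b4" "RM$7$5 = - \<i> * a1 - \<i> * a6 + \<i> * b1 + \<i> * b6"
    "RM$7$6 = - a1 - a6 - b1 - b6" "RM$7$7 = 0"
  unfolding root_matrix_def of_rows_def Let_def by simp_all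

lemma derivation_eqs_root_matrix: "derivation_eqs (RM)"
  unfolding derivation_eqs_def vec_eq_iff forall_8 by (simp add: root_matrix_nth transpose_def)

end

lemma root_matrix_cases:
  fixes D :: "complex^8^8"
  assumes "derivation_eqs D"
  obtains t1 t2 a1 a2 a3 a4 a5 a6 b1 b2 b3 b4 b5 b6 where "D = root_matrix t1 t2 a1 a2 a3 a4 a5 a6 b1 b2 b3 b4 b5 b6"
proof
  note e = derivation_eqs_unfold[OF assms]
  \<comment> \<open>Row 1 determines the coordinates 1, 3 and 4, since each pair a, b appears there
    in two entries as sum and difference. Rows 2 and 3 then give the coordinates 2, 5 and 6.\<close>
  let ?a1 = "(D$1$4 + \<i> * D$1$2) / 4" and ?b1 = "(D$1$4 - \<i> * D$1$2) / 4"
  let ?a3 = "(D$1$7 + \<i> * D$1$3) / 4" and ?b3 = "(D$1$7 - \<i> * D$1$3) / 4"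
  let ?a4 = "(\<i> * D$1$5 - D$1$6) / 4" and ?b4 = "(- \<i> * D$1$5 - D$1$6) / 4"
  let ?a2 = "?a4 + (D$2$3 - \<i> * D$2$7) / 2" and ?b2 = "?b4 + (D$2$3 + \<i> * D$2$7) / 2"
  let ?a5 = "?a3 + (D$2$5 + \<i> * D$2$6) / 2" and ?b5 = "?b3 + (D$2$5 - \<i> * D$2$6) / 2"
  let ?a6 = "?a1 - (D$3$5 + \<i> * D$3$6) / 2" and ?b6 = "?b1 - (D$3$5 - \<i> * D$3$6) / 2"
  have i2: "\<i> * (\<i> * z) = - z" for z :: complex by (simp add: mult.assoc[symmetric])
  show "D = root_matrix (- D$2$4) (- D$3$7) ?a1 ?a2 ?a3 ?a4 ?a5 ?a6 ?b1 ?b2 ?b3 ?b4 ?b5 ?b6"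
    unfolding vec_eq_iff forall_8 root_matrix_nth
    by (simp add: e) (simp add: field_simps i2)
qed

lemma root_matrix_eq_0_iff:
  "root_matrix t1 t2 a1 a2 a3 a4 a5 a6 b1 b2 b3 b4 b5 b6 = 0 \<longleftrightarrow> t1 = 0 \<and> t2 = 0 \<and> a1 = 0 \<and> a2 = 0 \<and> a3 = 0 \<and> a4 = 0 \<and> a5 = 0 \<and> a6 = 0 \<and> b1 = 0 \<and> b2 = 0 \<and> b3 = 0 \<and> b4 = 0 \<and> b5 = 0 \<and> b6 = 0"
proof
  assume "root_matrix t1 t2 a1 a2 a3 a4 a5 a6 b1 b2 b3 b4 b5 b6 = 0"
  then have z: "root_matrix t1 t2 a1 a2 a3 a4 a5 a6 b1 b2 b3 b4 b5 b6$i$j = 0" for i j by simp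
  have "t1 = 0" "t2 = 0" using z[of 4 2] z[of 7 3] by (simp_all add: root_matrix_nth)
  moreover have "a1 = 0 \<and> b1 = 0" using z[of 1 2] z[of 1 4] by (simp add: root_matrix_nth)
  moreover have "a3 = 0 \<and> b3 = 0" using z[of 1 3] z[of 1 7] by (simp add: root_matrix_nth)
  moreover have "a4 = 0 \<and> b4 = 0" using z[of 1 5] z[of 1 6] by (simp add: root_matrix_nth)
  ultimately have "a2 = 0 \<and> b2 = 0" "a5 = 0 \<and> b5 = 0" "a6 = 0 \<and> b6 = 0"
    using z[of 2 3] z[of 2 7] z[of 2 5] z[of 2 6] z[of 3 5] z[of 3 6] by (simp_all add: root_matrix_nth)
  then show "t1 = 0 \<and> t2 = 0 \<and> a1 = 0 \<and> a2 = 0 \<and> a3 = 0 \<and> a4 = 0 \<and> a5 = 0 \<and> a6 = 0 \<and> b1 = 0 \<and> b2 = 0 \<and> b3 = 0 \<and> b4 = 0 \<and> b5 = 0 \<and> b6 = 0" using \<open>t1 = 0\<close> \<open>t2 = 0\<close> \<open>a1 = 0 \<and> b1 = 0\<close> \<open>a3 = 0 \<and> b3 = 0\<close> \<open>a4 = 0 \<and> b4 = 0\<close> by simp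
next
  assume "t1 = 0 \<and> t2 = 0 \<and> a1 = 0 \<and> a2 = 0 \<and> a3 = 0 \<and> a4 = 0 \<and> a5 = 0 \<and> a6 = 0 \<and> b1 = 0 \<and> b2 = 0 \<and> b3 = 0 \<and> b4 = 0 \<and> b5 = 0 \<and> b6 = 0"
  then show "root_matrix t1 t2 a1 a2 a3 a4 a5 a6 b1 b2 b3 b4 b5 b6 = 0"
    unfolding vec_eq_iff forall_8 by (simp add: root_matrix_nth)
qed

lemma root_matrix_add: "root_matrix t1 t2 a1 a2 a3 a4 a5 a6 b1 b2 b3 b4 b5 b6 + root_matrix t1' t2' a1' a2' a3' a4' a5' a6' b1' b2' b3' b4' b5' b6' = root_matrix (t1 + t1') (t2 + t2') (a1 + a1') (a2 + a2') (a3 + a3') (a4 + a4') (a5 + a5') (a6 + a6') (b1 + b1') (b2 + b2') (b3 + b3') (b4 + b4') (b5 + b5') (b6 + b6')"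
  unfolding vec_eq_iff forall_8 vector_add_component root_matrix_nth by (simp add: algebra_simps)

lemma root_matrix_scale: "mscale c (root_matrix t1 t2 a1 a2 a3 a4 a5 a6 b1 b2 b3 b4 b5 b6) = root_matrix (c * t1) (c * t2) (c * a1) (c * a2) (c * a3) (c * a4) (c * a5) (c * a6) (c * b1) (c * b2) (c * b3) (c * b4) (c * b5) (c * b6)"
  unfolding vec_eq_iff forall_8 mscale_def by (simp add: root_matrix_nth) (simp add: algebra_simps)

lemma root_matrix_minus: "root_matrix t1 t2 a1 a2 a3 a4 a5 a6 b1 b2 b3 b4 b5 b6 - root_matrix t1' t2' a1' a2' a3' a4' a5' a6' b1' b2' b3' b4' b5' b6' = root_matrix (t1 - t1') (t2 - t2') (a1 - a1') (a2 - a2') (a3 - a3') (a4 - a4') (a5 - a5') (a6 - a6') (b1 - b1') (b2 - b2') (b3 - b3') (b4 - b4') (b5 - b5') (b6 - b6')"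
  unfolding vec_eq_iff forall_8 vector_minus_component root_matrix_nth by (simp add: algebra_simps)

lemma root_matrix_eq_iff:
  "root_matrix t1 t2 a1 a2 a3 a4 a5 a6 b1 b2 b3 b4 b5 b6 = root_matrix t1' t2' a1' a2' a3' a4' a5' a6' b1' b2' b3' b4' b5' b6' \<longleftrightarrow> t1 = t1' \<and> t2 = t2' \<and> a1 = a1' \<and> a2 = a2' \<and> a3 = a3' \<and> a4 = a4' \<and> a5 = a5' \<and> a6 = a6' \<and> b1 = b1' \<and> b2 = b2' \<and> b3 = b3' \<and> b4 = b4' \<and> b5 = b5' \<and> b6 = b6'"
  using root_matrix_eq_0_iff[of "t1 - t1'" "t2 - t2'" "a1 - a1'" "a2 - a2'" "a3 - a3'" "a4 - a4'" "a5 - a5'" "a6 - a6'" "b1 - b1'" "b2 - b2'" "b3 - b3'" "b4 - b4'" "b5 - b5'" "b6 - b6'"]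
  unfolding root_matrix_minus[symmetric] by simp

text \<open>Confirms the labelling by roots: the eigenvalue on an a-coordinate is -i times its root.
  Since [Z, X + iY] = -i (X + iY) in an so(3) triple, the relevant roots are those with value 1 on
  Z.\<close>

lemma lie_bracket_torus_root_matrix:
  "lie_bracket (root_matrix p q 0 0 0 0 0 0 0 0 0 0 0 0) (root_matrix t1 t2 a1 a2 a3 a4 a5 a6 b1 b2 b3 b4 b5 b6) =
    root_matrix (0) (0) (- \<i> * p * a1) (\<i> * p * a2 - \<i> * q * a2) (- \<i> * q * a3) (- \<i> * p * a4 - \<i> * q * a4) (- 2 * \<i> * p * a5 - \<i> * q * a5) (- \<i> * p * a6 - 2 * \<i> * q * a6) (\<i> * p * b1) (- \<i> * p * b2 + \<i> * q * b2) (\<i> * q * b3) (\<i> * p * b4 + \<i> * q * b4) (2 * \<i> * p * b5 + \<i> * q * b5) (\<i> * p * b6 + 2 * \<i> * q * b6)"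
  unfolding vec_eq_iff forall_8 matrix_entry_lie_bracket sum_8 root_matrix_nth by (simp add: algebra_simps)

lemma lie_bracket_principal_root_matrix:
  "lie_bracket (root_matrix 0 0 x y 0 0 0 0 0 0 0 0 0 0) (root_matrix t1 t2 a1 a2 a3 a4 a5 a6 b1 b2 b3 b4 b5 b6) =
    root_matrix (- 8 * \<i> * x * b1 + 4 * \<i> * y * b2) (4 * \<i> * x * b1 - 4 * \<i> * y * b2) (\<i> * x * t1) (- \<i> * y * t1 + \<i> * y * t2) (2 * x * a2 - 2 * y * a1) (- 4 * x * a3) (6 * x * a4) (2 * y * a5) (2 * y * b3) (- 6 * x * b3) (4 * x * b4) (- 2 * x * b5) (- 2 * y * b6) (0)"
  unfolding vec_eq_iff forall_8 matrix_entry_lie_bracket sum_8 root_matrix_nth by (simp add: algebra_simps)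

text \<open>With the roots numbered like their coordinates, the nonzero terms come from 1 + 2 = 3, 1
  + 3 = 4, 1 + 4 = 5 and 2 + 5 = 3 + 4 = 6.\<close>

lemma lie_bracket_positive_root_matrix:
  "lie_bracket (root_matrix 0 0 c1 c2 c3 c4 c5 c6 0 0 0 0 0 0) (root_matrix 0 0 a1 a2 a3 a4 a5 a6 0 0 0 0 0 0) =
    root_matrix (0) (0) (0) (0) (2 * c1 * a2 - 2 * c2 * a1) (- 4 * c1 * a3 + 4 * c3 * a1) (6 * c1 * a4 - 6 * c4 * a1) (2 * c2 * a5 - 6 * c3 * a4 + 6 * c4 * a3 - 2 * c5 * a2) (0) (0) (0) (0) (0) (0)"
  unfolding vec_eq_iff forall_8 matrix_entry_lie_bracket sum_8 root_matrix_nth by (simp add: algebra_simps)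


section \<open>The matrix exponential\<close>

lemma bounded_bilinear_matrix_mult: "bounded_bilinear ((**) :: real^'n^'n \<Rightarrow> real^'n^'n \<Rightarrow> real^'n^'n)"
  unfolding bilinear_conv_bounded_bilinear[symmetric] bilinear_def linear_iff
  by (simp add: matrix_matrix_mult_def vec_eq_iff sum.distrib sum_distrib_left algebra_simps)

lemma bounded_bilinear_matrix_vector_mult: "bounded_bilinear ((*v) :: real^'n^'n \<Rightarrow> real^'n \<Rightarrow> real^'n)"
  unfolding bilinear_conv_bounded_bilinear[symmetric] bilinear_def linear_iff
  by (simp add: matrix_vector_right_distrib matrix_vector_mult_add_rdistrib matrix_vector_mult_scaleR
      scaleR_matrix_vector_assoc)

lemmas matrix_add_rdistrib = bounded_bilinear.add_left[OF bounded_bilinear_matrix_mult]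
lemmas matrix_mult_minus =
  bounded_bilinear.minus_left[OF bounded_bilinear_matrix_mult]
  bounded_bilinear.minus_right[OF bounded_bilinear_matrix_mult]
lemmas matrix_mult_diff =
  bounded_bilinear.diff_left[OF bounded_bilinear_matrix_mult]
  bounded_bilinear.diff_right[OF bounded_bilinear_matrix_mult]
lemmas matrix_mult_scaleR =
  bounded_bilinear.scaleR_left[OF bounded_bilinear_matrix_mult]
  bounded_bilinear.scaleR_right[OF bounded_bilinear_matrix_mult]

definition mpow :: "real^'n^'n \<Rightarrow> nat \<Rightarrow> real^'n^'n" where
  "mpow A k = (((**) A) ^^ k) (mat 1)"

lemma mpow_0 [simp]: "mpow A 0 = mat 1" and mpow_Suc: "mpow A (Suc k) = A ** mpow A k"
  by (simp_all add: mpow_def)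

lemma mpow_commute: "A ** mpow A k = mpow A k ** A"
proof (induction k)
  case (Suc k)
  then show ?case by (metis mpow_Suc matrix_mul_assoc)
qed simp

lemma mpow_scaleR: "mpow (t *\<^sub>R A) k = t ^ k *\<^sub>R mpow A k"
  by (induction k) (simp_all add: mpow_Suc matrix_mult_scaleR)

text \<open>The sum of the absolute values of all entries majorizes every row sum, so each entry of
  the exponential series is dominated by a scalar exponential series.\<close>

lemma mpow_bound: "\<bar>mpow A k$i$j\<bar> \<le> (\<Sum>i\<in>UNIV. \<Sum>j\<in>UNIV. \<bar>A$i$j\<bar>) ^ k"
proof (induction k arbitrary: i j)
  case 0
  then show ?case by (simp add: mat_def)
next
  case (Suc k)
  let ?K = "\<Sum>i\<in>UNIV. \<Sum>j\<in>UNIV. \<bar>A$i$j\<bar>"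
  have "\<bar>mpow A (Suc k)$i$j\<bar> \<le> (\<Sum>l\<in>UNIV. \<bar>A$i$l\<bar> * \<bar>mpow A k$l$j\<bar>)"
    by (simp add: mpow_Suc matrix_matrix_mult_def abs_mult[symmetric])
  also have "\<dots> \<le> (\<Sum>l\<in>UNIV. \<bar>A$i$l\<bar> * ?K ^ k)"
    by (intro sum_mono mult_left_mono Suc) auto
  also have "\<dots> = (\<Sum>l\<in>UNIV. \<bar>A$i$l\<bar>) * ?K ^ k" by (simp add: sum_distrib_right)
  also have "\<dots> \<le> ?K * ?K ^ k"
    by (intro mult_right_mono member_le_sum[of i UNIV "\<lambda>i. \<Sum>l\<in>UNIV. \<bar>A$i$l\<bar>"]) (auto intro!: sum_nonneg zero_le_power)
  finally show ?case by simp
qed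

lemma mexp_entry_summable: "summable (\<lambda>k. (mpow A k$i$j / fact k) * t ^ k)"
proof (rule summable_comparison_test')
  let ?K = "\<Sum>i\<in>UNIV. \<Sum>j\<in>UNIV. \<bar>A$i$j\<bar>"
  show "summable (\<lambda>k. inverse (fact k) * (?K * \<bar>t\<bar>) ^ k)" by (rule summable_exp)
  fix k :: nat
  have "norm (mpow A k$i$j / fact k * t ^ k) = inverse (fact k) * (\<bar>mpow A k$i$j\<bar> * \<bar>t\<bar> ^ k)"
    by (simp add: abs_mult power_abs divide_inverse mult_ac)
  also have "\<dots> \<le> inverse (fact k) * (?K ^ k * \<bar>t\<bar> ^ k)"
    by (intro mult_left_mono mult_right_mono mpow_bound) auto
  finally show "norm (mpow A k$i$j / fact k * t ^ k) \<le> inverse (fact k) * (?K * \<bar>t\<bar>) ^ k"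
    by (simp add: power_mult_distrib)
qed

lemma mexp_sums: "(\<lambda>k. (1 / fact k) *\<^sub>R mpow A k) sums mexp A"
proof -
  have "(\<lambda>k. ((1 / fact k) *\<^sub>R mpow A k)$i$j) sums (\<Sum>k. ((1 / fact k) *\<^sub>R mpow A k)$i$j)" for i j
    using summable_sums[OF mexp_entry_summable[of A i j 1]] by simp
  then have "(\<lambda>k. (1 / fact k) *\<^sub>R mpow A k) sums (\<chi> i j. \<Sum>k. ((1 / fact k) *\<^sub>R mpow A k)$i$j)"
    unfolding sums_def by (intro vec_tendstoI) (simp add: sum_component)
  then show ?thesis unfolding mexp_def mpow_def[symmetric] by (simp add: sums_iff)
qed

lemma mexp_scaleR_nth: "mexp (t *\<^sub>R A)$i$j = (\<Sum>k. (mpow A k$i$j / fact k) * t ^ k)"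
proof -
  have "(\<lambda>k. ((1 / fact k) *\<^sub>R mpow (t *\<^sub>R A) k)$i) sums mexp (t *\<^sub>R A)$i"
    by (rule bounded_linear.sums[OF bounded_linear_vec_nth mexp_sums])
  then have "(\<lambda>k. ((1 / fact k) *\<^sub>R mpow (t *\<^sub>R A) k)$i$j) sums mexp (t *\<^sub>R A)$i$j"
    by (rule bounded_linear.sums[OF bounded_linear_vec_nth])
  then show ?thesis by (simp add: mpow_scaleR sums_iff mult.commute)
qed

lemma has_vector_derivative_matrixI:
  fixes F :: "real \<Rightarrow> real^'n^'m"
  assumes "\<And>i j. ((\<lambda>t. F t$i$j) has_real_derivative F'$i$j) (at x)"
  shows "(F has_vector_derivative F') (at x)"
proof -
  have "((\<lambda>t. F t \<bullet> b) has_derivative (\<lambda>h. (h *\<^sub>R F') \<bullet> b)) (at x)" if "b \<in> Basis" for b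
  proof -
    obtain i j where b: "b = axis i (axis j 1)" using \<open>b \<in> Basis\<close> by (auto simp: Basis_vec_def)
    have "((\<lambda>t. F t$i$j) has_derivative (\<lambda>h. h * F'$i$j)) (at x)"
      using assms[of i j] by (simp add: has_field_derivative_def mult_commute_abs)
    then show ?thesis by (simp add: b inner_axis)
  qed
  then show ?thesis
    unfolding has_vector_derivative_def by (subst has_derivative_componentwise_within) simp
qed

lemma mexp_has_vector_derivative:
  "((\<lambda>t. mexp (t *\<^sub>R A)) has_vector_derivative A ** mexp (x *\<^sub>R A)) (at x)"
proof (rule has_vector_derivative_matrixI)
  fix i j
  let ?c = "\<lambda>k. mpow A k$i$j / fact k"
  have "((\<lambda>t. \<Sum>k. ?c k * t ^ k) has_real_derivative (\<Sum>k. diffs ?c k * x ^ k)) (at x)"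
    by (rule termdiffs_strong_converges_everywhere) (rule mexp_entry_summable)
  also have "(\<Sum>k. diffs ?c k * x ^ k) = (\<Sum>k. \<Sum>l\<in>UNIV. A$i$l * ((mpow A k$l$j / fact k) * x ^ k))"
  proof (rule suminf_cong)
    fix k
    \<comment> \<open>Differentiation shifts the series by one: the factor k + 1 cancels in the
      factorial, and the extra power splits off one factor A.\<close>
    have "diffs ?c k = mpow A (Suc k)$i$j / fact k"
      by (simp add: diffs_def field_simps del: of_nat_Suc)
    also have "\<dots> = (\<Sum>l\<in>UNIV. A$i$l * (mpow A k$l$j / fact k))"
      by (simp add: mpow_Suc matrix_matrix_mult_def sum_divide_distrib)
    finally show "diffs ?c k * x ^ k = (\<Sum>l\<in>UNIV. A$i$l * ((mpow A k$l$j / fact k) * x ^ k))"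
      by (simp only: sum_distrib_right mult.assoc)
  qed
  also have "\<dots> = (\<Sum>l\<in>UNIV. A$i$l * (\<Sum>k. (mpow A k$l$j / fact k) * x ^ k))"
    by (subst suminf_sum) (simp_all only: summable_mult mexp_entry_summable suminf_mult)
  also have "\<dots> = (A ** mexp (x *\<^sub>R A))$i$j"
    by (simp add: matrix_matrix_mult_def mexp_scaleR_nth)
  finally show "((\<lambda>t. mexp (t *\<^sub>R A)$i$j) has_real_derivative (A ** mexp (x *\<^sub>R A))$i$j) (at x)"
    by (simp only: mexp_scaleR_nth)
qed

lemma mexp_0 [simp]: "mexp 0 = mat 1"
proof -
  have "mpow (0 :: real^'n^'n) k = 0" if "k \<noteq> 0" for k
    using that by (cases k) (simp_all add: mpow_Suc bounded_bilinear.zero_left[OF bounded_bilinear_matrix_mult])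
  then have "(\<lambda>k. (1 / fact k) *\<^sub>R mpow (0 :: real^'n^'n) k) sums (\<Sum>k\<in>{0}. (1 / fact k) *\<^sub>R mpow 0 k)"
    by (intro sums_finite) auto
  then show ?thesis using sums_unique2[OF mexp_sums[of 0]] by simp
qed

lemma mexp_commute: "A ** mexp A = mexp A ** A"
proof -
  have 1: "A ** ((1 / fact k) *\<^sub>R mpow A k) = ((1 / fact k) *\<^sub>R mpow A k) ** A" for k
    by (simp only: matrix_mult_scaleR mpow_commute)
  have 2: "(\<lambda>k. ((1 / fact k) *\<^sub>R mpow A k) ** A) sums (A ** mexp A)"
    unfolding 1[symmetric]
    by (rule bounded_linear.sums[OF bounded_bilinear.bounded_linear_right[OF bounded_bilinear_matrix_mult] mexp_sums])
  have 3: "(\<lambda>k. ((1 / fact k) *\<^sub>R mpow A k) ** A) sums (mexp A ** A)"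
    by (rule bounded_linear.sums[OF bounded_bilinear.bounded_linear_left[OF bounded_bilinear_matrix_mult] mexp_sums])
  show ?thesis by (rule sums_unique2[OF 2 3])
qed

lemma mexp_scaleR_commute: "A ** mexp (t *\<^sub>R A) = mexp (t *\<^sub>R A) ** A"
proof (cases "t = 0")
  case False
  have "t *\<^sub>R (A ** mexp (t *\<^sub>R A)) = t *\<^sub>R (mexp (t *\<^sub>R A) ** A)"
    using mexp_commute[of "t *\<^sub>R A"] by (simp add: matrix_mult_scaleR)
  then show ?thesis using False by simp
qed simp

lemma mexp_neg_has_vector_derivative:
  "((\<lambda>t. mexp (- (t *\<^sub>R A))) has_vector_derivative - (mexp (- (x *\<^sub>R A)) ** A)) (at x)"
  using mexp_has_vector_derivative[of "- A" x] mexp_scaleR_commute[of "- A" x] by (simp add: matrix_mult_minus)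

lemma has_vector_derivative_constant:
  fixes F :: "real \<Rightarrow> 'a::real_normed_vector"
  assumes "\<And>t. (F has_vector_derivative 0) (at t)"
  shows "F t = F 0"
proof -
  have "(F has_derivative (\<lambda>h. 0)) (at x within UNIV)" for x
    using assms[of x] by (simp add: has_vector_derivative_def)
  from has_derivative_zero_constant[OF convex_UNIV this] show ?thesis by auto
qed

lemma mexp_neg_mult: "mexp (- (t *\<^sub>R A)) ** mexp (t *\<^sub>R A) = mat 1"
proof -
  have "((\<lambda>t. mexp (- (t *\<^sub>R A)) ** mexp (t *\<^sub>R A)) has_vector_derivative 0) (at t)" for t
    using bounded_bilinear.has_vector_derivative[OF bounded_bilinear_matrix_mult
        mexp_neg_has_vector_derivative[of A t] mexp_has_vector_derivative[of A t]]
    by (simp add: matrix_mult_minus matrix_mul_assoc)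
  from has_vector_derivative_constant[OF this, of t] show ?thesis by simp
qed

lemma mexp_mult_neg: "mexp (t *\<^sub>R A) ** mexp (- (t *\<^sub>R A)) = mat 1"
  using mexp_neg_mult[of t A] matrix_left_right_inverse by blast

text \<open>By the bracket relations G(t) = cos t X + sin t Y solves G' = ZG - GZ. Hence exp(-tZ)
  G(t) exp(tZ) has derivative zero and stays equal to X.\<close>

lemma mexp_rotation:
  fixes X Y Z :: "real^'n^'n"
  assumes "Z ** X - X ** Z = Y" "Z ** Y - Y ** Z = - X"
  shows "mexp (t *\<^sub>R Z) ** X ** mexp (- (t *\<^sub>R Z)) = cos t *\<^sub>R X + sin t *\<^sub>R Y"
proof -
  let ?E = "\<lambda>t. mexp (t *\<^sub>R Z)" and ?N = "\<lambda>t. mexp (- (t *\<^sub>R Z))" and ?G = "\<lambda>t. cos t *\<^sub>R X + sin t *\<^sub>R Y"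
  have G: "(?G has_vector_derivative - sin t *\<^sub>R X + cos t *\<^sub>R Y) (at t)" for t
    by (auto intro!: derivative_eq_intros)
  have ZG: "Z ** ?G t - ?G t ** Z = - sin t *\<^sub>R X + cos t *\<^sub>R Y" for t
  proof -
    have "Z ** ?G t - ?G t ** Z = cos t *\<^sub>R (Z ** X - X ** Z) + sin t *\<^sub>R (Z ** Y - Y ** Z)"
      by (simp add: matrix_add_ldistrib matrix_add_rdistrib matrix_mult_scaleR algebra_simps)
    then show ?thesis by (simp add: assms)
  qed
  have key: "(N ** H) ** (Z ** E) + (N ** (Z ** H - H ** Z) + - (N ** Z) ** H) ** E = 0"
    for N H E :: "real^'n^'n"
    by (simp only: matrix_mult_minus matrix_mult_diff matrix_add_rdistrib matrix_mul_assoc) simp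
  have "((\<lambda>t. ?N t ** ?G t ** ?E t) has_vector_derivative 0) (at t)" for t
  proof -
    have "((\<lambda>t. ?N t ** ?G t ** ?E t) has_vector_derivative
       (?N t ** ?G t) ** (Z ** ?E t) + (?N t ** (- sin t *\<^sub>R X + cos t *\<^sub>R Y) + - (?N t ** Z) ** ?G t) ** ?E t) (at t)"
      by (rule bounded_bilinear.has_vector_derivative[OF bounded_bilinear_matrix_mult
          bounded_bilinear.has_vector_derivative[OF bounded_bilinear_matrix_mult mexp_neg_has_vector_derivative G]
          mexp_has_vector_derivative])
    also have "(?N t ** ?G t) ** (Z ** ?E t) + (?N t ** (- sin t *\<^sub>R X + cos t *\<^sub>R Y) + - (?N t ** Z) ** ?G t) ** ?E t = 0"
      unfolding ZG[symmetric] by (rule key)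
    finally show ?thesis .
  qed
  from has_vector_derivative_constant[OF this, of t]
  have "?N t ** ?G t ** ?E t = X" by simp
  then have "?E t ** X ** ?N t = (?E t ** ?N t) ** ?G t ** (?E t ** ?N t)"
    by (metis matrix_mul_assoc)
  then show ?thesis by (simp add: mexp_mult_neg)
qed

text \<open>By the product rule of A, the product m(t) of the two moving vectors solves m' = A m, so
  exp(-tA) m(t) is constant. This is multiplicativity.\<close>

lemma mexp_in_G2:
  assumes A: "A \<in> g2" shows "mexp (t *\<^sub>R A) \<in> carrier G2"
proof -
  let ?E = "\<lambda>t. mexp (t *\<^sub>R A)" and ?N = "\<lambda>t. mexp (- (t *\<^sub>R A))"
  have dv: "((\<lambda>t. ?E t *v x) has_vector_derivative A *v (?E t *v x)) (at t)" for x t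
    using bounded_linear.has_vector_derivative[OF
        bounded_bilinear.bounded_linear_left[OF bounded_bilinear_matrix_vector_mult] mexp_has_vector_derivative]
    by (simp add: matrix_vector_mul_assoc)
  have mult: "?E t *v (x \<odot> y) = (?E t *v x) \<odot> (?E t *v y)" for t x y
  proof -
    let ?m = "\<lambda>t. (?E t *v x) \<odot> (?E t *v y)"
    have dm: "(?m has_vector_derivative A *v ?m t) (at t)" for t
      using bounded_bilinear.has_vector_derivative[OF bounded_bilinear_octonion_mult dv[of x t] dv[of y t]]
      by (simp add: g2_mult[OF A] add.commute)
    have "((\<lambda>t. ?N t *v ?m t) has_vector_derivative 0) (at t)" for t
      using bounded_bilinear.has_vector_derivative[OF bounded_bilinear_matrix_vector_mult
          mexp_neg_has_vector_derivative[of A t] dm[of t]]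
      by (simp add: matrix_vector_mult_minus matrix_vector_mul_assoc)
    from has_vector_derivative_constant[OF this, of t] have "?N t *v ?m t = x \<odot> y" by simp
    then have "?E t *v (x \<odot> y) = (?E t ** ?N t) *v ?m t" by (metis matrix_vector_mul_assoc)
    then show ?thesis by (simp add: mexp_mult_neg)
  qed
  have "invertible (?E t)" unfolding invertible_def using mexp_mult_neg mexp_neg_mult by blast
  with mult show ?thesis by (simp add: G2_iff)
qed

lemma transpose_mexp:
  assumes "mexp (t *\<^sub>R A) \<in> carrier G2"
  shows "transpose (mexp (t *\<^sub>R A)) = mexp (- (t *\<^sub>R A))"
  using G2_matrix_inv[OF assms] matrix_inv_unique[OF mexp_mult_neg[of t A]] by simp

lemma mexp_derivative_0: "((\<lambda>t. mexp (t *\<^sub>R A)) has_vector_derivative A) (at 0)"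
  using mexp_has_vector_derivative[of A 0] by simp

lemma lie_algebra_of_G2:
  assumes "\<And>t. mexp (t *\<^sub>R A) \<in> carrier G2"
  shows "A \<in> g2"
  unfolding g2_iff
proof (intro allI)
  fix x y
  let ?E = "\<lambda>t. mexp (t *\<^sub>R A)"
  have dv: "((\<lambda>t. ?E t *v x) has_vector_derivative A *v x) (at 0)" for x
    by (rule bounded_linear.has_vector_derivative[OF
        bounded_bilinear.bounded_linear_left[OF bounded_bilinear_matrix_vector_mult] mexp_derivative_0])
  have "((\<lambda>t. ?E t *v (x \<odot> y)) has_vector_derivative x \<odot> (A *v y) + (A *v x) \<odot> y) (at 0)"
    using bounded_bilinear.has_vector_derivative[OF bounded_bilinear_octonion_mult dv[of x] dv[of y]]
    by (simp add: G2_mult[OF assms])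
  from vector_derivative_unique_at[OF this dv] show "A *v (x \<odot> y) = (A *v x) \<odot> y + x \<odot> (A *v y)"
    by (simp add: add.commute)
qed

text \<open>The component of F orthogonal to S is constantly zero, hence so is that of its
  derivative.\<close>

lemma derivative_in_subspace:
  fixes S :: "'a::euclidean_space set"
  assumes S: "subspace S" and F: "\<And>t. F t \<in> S" and d: "(F has_vector_derivative D) (at x)"
  shows "D \<in> S"
proof -
  obtain y z where yz: "y \<in> span S" "\<And>w. w \<in> span S \<Longrightarrow> orthogonal z w" "D = y + z"
    using orthogonal_subspace_decomp_exists[of S D] by metis
  have y: "y \<in> S" using yz(1) S by (metis span_eq_iff)
  have zS: "w \<bullet> z = 0" if "w \<in> S" for w
    using yz(2)[OF span_base[OF that]] by (simp add: orthogonal_def inner_commute)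
  have "((\<lambda>t. F t \<bullet> z) has_vector_derivative D \<bullet> z) (at x)"
    by (rule bounded_linear.has_vector_derivative[OF bounded_linear_inner_left d])
  then have "((\<lambda>t. 0) has_vector_derivative D \<bullet> z) (at x)" using zS[OF F] by simp
  then have "D \<bullet> z = 0" by (metis has_vector_derivative_const vector_derivative_unique_at)
  then have "z = 0" using yz(3) zS[OF y] by (simp add: inner_add_left)
  then show ?thesis using yz(3) y by simp
qed

text \<open>The bracket is the derivative at t = 0 of the conjugate of X by exp(tA), a curve inside
  S.\<close>

lemma lie_algebra_of_normalizer:
  assumes S: "subspace S" and G: "\<And>t. mexp (t *\<^sub>R A) \<in> carrier G2"
    and inv: "\<And>t. mexp (t *\<^sub>R A) ** X ** transpose (mexp (t *\<^sub>R A)) \<in> S"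
  shows "lie_bracket A X \<in> S"
proof (rule derivative_in_subspace[OF S])
  let ?E = "\<lambda>t. mexp (t *\<^sub>R A)" and ?N = "\<lambda>t. mexp (- (t *\<^sub>R A))"
  show "?E t ** X ** ?N t \<in> S" for t using inv[of t] by (simp add: transpose_mexp[OF G])
  show "((\<lambda>t. ?E t ** X ** ?N t) has_vector_derivative lie_bracket A X) (at 0)"
    using bounded_bilinear.has_vector_derivative[OF bounded_bilinear_matrix_mult
        bounded_linear.has_vector_derivative[OF
          bounded_bilinear.bounded_linear_left[OF bounded_bilinear_matrix_mult, of X] mexp_derivative_0[of A]]
        mexp_neg_has_vector_derivative[of A 0]]
    by (simp add: lie_bracket_def matrix_mult_minus)
qed


section \<open>The rank of the complexified algebra\<close>

text \<open>Adding \<open>s\<close> to the \<open>j\<close>-th diagonal entry of a singular skew matrix of even size makes the determinant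
  linear in \<open>s\<close>, but transposition shows that it is an even function of \<open>s\<close>. Hence it vanishes.\<close>

lemma skew_second_kernel_vector:
  fixes M :: "'a::field_char_0^'n^'n"
  assumes ev: "even CARD('n)" and skew: "transpose M = - M" and c: "c \<noteq> 0" "M *v c = 0"
  obtains d where "M *v d = 0" "\<And>k. d \<noteq> k *s c"
proof -
  obtain j where cj: "c$j \<noteq> 0" using c by (auto simp: vec_eq_iff)
  define P where "P s = (\<chi> i. if i = j then M$i + s *s axis j 1 else M$i)" for s
  define Q :: "'a^'n^'n" where "Q = (\<chi> i. if i = j then axis j 1 else M$i)"
  have detM: "det M = 0"
    using c by (metis invertible_det_nz invertible_left_inverse matrix_left_invertible_ker)
  have P: "det (P s) = s * det Q" for s
  proof -
    have "det (P s) = det (\<chi> i. if i = j then M$i else M$i) + det (\<chi> i. if i = j then s *s axis j 1 else M$i)"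
      unfolding P_def by (rule det_row_add)
    also have "det (\<chi> i. if i = j then s *s axis j 1 else M$i) = s * det Q"
      unfolding Q_def by (rule det_row_mul)
    finally show ?thesis using detM by (simp add: vec_lambda_eta)
  qed
  have neg: "det (- A) = det A" for A :: "'a^'n^'n"
  proof -
    have "mat (-1) ** A = - A"
      by (simp add: vec_eq_iff matrix_matrix_mult_def mat_def if_distrib[of "\<lambda>x. x * _"] cong: if_cong)
    moreover have "det (mat (-1) :: 'a^'n^'n) = 1"
      using ev by (subst det_diagonal) (auto simp: mat_def)
    ultimately show ?thesis by (metis det_mul mult_1)
  qed
  have M: "M$i$k = - M$k$i" for i k
  proof -
    have "transpose M$k$i = (- M)$k$i" by (simp add: skew)
    then show ?thesis by (simp add: transpose_def)
  qed
  have "transpose (P 1)$i$k = (- P (-1))$i$k" for i k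
    using M[of k i] by (auto simp: transpose_def P_def axis_def)
  then have "transpose (P 1) = - P (-1)" by (simp add: vec_eq_iff)
  then have "det (P 1) = det (P (-1))" by (metis neg det_transpose)
  then have "det (P 1) = 0" by (simp add: P)
  then obtain d where d: "d \<noteq> 0" "P 1 *v d = 0"
    by (metis invertible_det_nz invertible_left_inverse matrix_left_invertible_ker)
  have Md: "(M *v d)$i = (if i = j then - d$j else 0)" for i
  proof -
    have "(P 1 *v d)$i = (M *v d)$i + (if i = j then d$j else 0)"
      by (simp add: matrix_vector_mult_def P_def axis_def distrib_right sum.distrib if_distrib[of "\<lambda>x. x * _"] cong: if_cong)
    then show ?thesis using d(2) by (auto simp: add_eq_0_iff2)
  qed
  \<comment> \<open>By skewness M d is orthogonal to the kernel vector c. As M d is supported at j,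
    where c is nonzero, this forces the j-th coordinate of d to vanish; so d lies in the kernel of M
    and is no multiple of c.\<close>
  have "(\<Sum>i\<in>UNIV. c$i * (M *v d)$i) = (\<Sum>i\<in>UNIV. \<Sum>k\<in>UNIV. c$i * (M$i$k * d$k))"
    by (simp add: matrix_vector_mult_def sum_distrib_left)
  also have "\<dots> = (\<Sum>k\<in>UNIV. \<Sum>i\<in>UNIV. c$i * (M$i$k * d$k))" by (rule sum.swap)
  also have "\<dots> = - (\<Sum>k\<in>UNIV. d$k * (M *v c)$k)"
    by (simp add: matrix_vector_mult_def sum_distrib_left sum_negf[symmetric])
       (intro sum.cong refl, subst M, simp add: mult_ac)
  finally have "(\<Sum>i\<in>UNIV. c$i * (M *v d)$i) = 0" using c by simp
  then have "c$j * d$j = 0"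
    by (simp add: Md if_distrib[of "\<lambda>x. _ * x"] cong: if_cong)
  then have dj: "d$j = 0" using cj by simp
  have "M *v d = 0" by (simp add: vec_eq_iff Md dj)
  moreover have "d \<noteq> k *s c" for k
  proof
    assume "d = k *s c"
    then show False using dj cj d(1) by auto
  qed
  ultimately show ?thesis using that by blast
qed

section \<open>The 14-dimensional algebra, its trace form and its torus\<close>

abbreviation g2C :: "(complex^8^8) set" where "g2C \<equiv> complexification g2"

lemma g2C_iff: "D \<in> g2C \<longleftrightarrow> derivation_eqs D"
  by (simp add: complexification_g2)

lemma root_matrix_in_g2C: "root_matrix t1 t2 a1 a2 a3 a4 a5 a6 b1 b2 b3 b4 b5 b6 \<in> g2C"
  by (simp add: g2C_iff derivation_eqs_root_matrix)

lemma lie_bracket_cmat: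
  "lie_bracket (cmat X Y) (cmat X' Y') =
    cmat (lie_bracket X X' - lie_bracket Y Y') (lie_bracket X Y' + lie_bracket Y X')"
  by (simp add: vec_eq_iff matrix_entry_lie_bracket complex_eq_iff sum.distrib sum_subtractf sum_negf algebra_simps)

lemma g2C_bracket:
  assumes "D \<in> g2C" "D' \<in> g2C" shows "lie_bracket D D' \<in> g2C"
proof -
  obtain A B A' B' where "D = cmat A B" "D' = cmat A' B'" "A \<in> g2" "B \<in> g2" "A' \<in> g2" "B' \<in> g2"
    using assms by (auto simp: complexification_cmat)
  then show ?thesis
    unfolding complexification_cmat lie_bracket_cmat by (blast intro: g2_bracket g2_add g2_diff lie_bracket_cmat)
qed

lemma lie_bracket_swap: "lie_bracket A B = - lie_bracket B A"
  by (simp add: lie_bracket_def)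

lemma lie_bracket_self [simp]: "lie_bracket A A = 0"
  by (simp add: lie_bracket_def)

lemma mscale_minus_one: "- A = mscale (-1) A"
  by (simp add: mscale_def vec_eq_iff)

lemma linear_lie_bracket: "Vector_Spaces.linear mscale mscale (lie_bracket A)"
  by unfold_locales
    (simp_all add: vec_eq_iff matrix_entry_lie_bracket mscale_def sum.distrib sum_distrib_left algebra_simps)

lemma linear_trace_mult: "Vector_Spaces.linear mscale (*) (\<lambda>Y. trace (X ** Y))"
  by unfold_locales
    (simp_all add: trace_def matrix_matrix_mult_def mscale_def sum.distrib sum_distrib_left algebra_simps)

text \<open>Coordinates in a vector type of even dimension 14: a bilinear form on the algebra
  becomes a square matrix, to which \<open>skew_second_kernel_vector\<close> applies.\<close>

definition root_vector :: "complex^14 \<Rightarrow> complex^8^8" where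
  "root_vector z = root_matrix (z$0) (z$1) (z$2) (z$3) (z$4) (z$5) (z$6) (z$7) (z$8) (z$9) (z$10) (z$11) (z$12) (z$13)"

lemma exhaust_14: "(i::14) = 0 \<or> i = 1 \<or> i = 2 \<or> i = 3 \<or> i = 4 \<or> i = 5 \<or> i = 6 \<or> i = 7
    \<or> i = 8 \<or> i = 9 \<or> i = 10 \<or> i = 11 \<or> i = 12 \<or> i = 13"
proof (cases i)
  case (of_int z)
  then have "0 \<le> z" "z < 14" by simp_all
  then have "z = 0 \<or> z = 1 \<or> z = 2 \<or> z = 3 \<or> z = 4 \<or> z = 5 \<or> z = 6 \<or> z = 7
    \<or> z = 8 \<or> z = 9 \<or> z = 10 \<or> z = 11 \<or> z = 12 \<or> z = 13" by presburger
  then show ?thesis unfolding of_int(1) by (elim disjE) simp_all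
qed

lemma linear_root_vector: "Vector_Spaces.linear (*s) mscale root_vector"
proof -
  have "vector_space ((*s) :: complex \<Rightarrow> complex^14 \<Rightarrow> complex^14)" by (rule vec.vector_space_axioms)
  then show ?thesis
    unfolding Vector_Spaces.linear_iff
    by (simp add: mat.vector_space_axioms root_vector_def root_matrix_add root_matrix_scale)
qed

lemmas module_hom_root_vector = linear_root_vector[unfolded linear_iff_module_hom]

lemma root_vector_eq_0: "z = 0" if "root_vector z = 0"
proof -
  have "z$i = 0" for i
    using that exhaust_14[of i] unfolding root_vector_def root_matrix_eq_0_iff by auto
  then show ?thesis by (simp add: vec_eq_iff)
qed

lemma root_vector_range: "range root_vector = g2C"
proof
  show "range root_vector \<subseteq> g2C" by (auto simp: root_vector_def root_matrix_in_g2C)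
  show "g2C \<subseteq> range root_vector"
  proof
    fix D assume "D \<in> g2C"
    then obtain t1 t2 a1 a2 a3 a4 a5 a6 b1 b2 b3 b4 b5 b6 where D: "D = root_matrix t1 t2 a1 a2 a3 a4 a5 a6 b1 b2 b3 b4 b5 b6"
      using root_matrix_cases unfolding g2C_iff by blast
    have "D = root_vector (\<chi> i. if i = 0 then t1 else if i = 1 then t2 else if i = 2 then a1 else if i = 3 then a2
       else if i = 4 then a3 else if i = 5 then a4 else if i = 6 then a5 else if i = 7 then a6 else if i = 8 then b1
       else if i = 9 then b2 else if i = 10 then b3 else if i = 11 then b4 else if i = 12 then b5 else b6)"
      by (simp add: root_vector_def D)
    then show "D \<in> range root_vector" by blast
  qed
qed

text \<open>Pair Y = A + iB with its conjugate A - iB. Since A and B are skew, the trace of the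
  product is minus the sum of all squared entries of A and B.\<close>

lemma trace_pairing_nondegenerate:
  assumes Y: "Y \<in> g2C" and 0: "\<And>i. trace (Y ** root_vector (axis i 1)) = 0"
  shows "Y = 0"
proof -
  obtain A B where AB: "Y = cmat A B" "A \<in> g2" "B \<in> g2" using Y by (auto simp: complexification_cmat)
  have lin: "Vector_Spaces.linear (*s) (*) (\<lambda>z. trace (Y ** root_vector z))"
    using Vector_Spaces.linear_compose[OF linear_root_vector linear_trace_mult[of Y]] by (simp add: o_def)
  have all0: "trace (Y ** root_vector z) = 0" for z
  proof -
    have "trace (Y ** root_vector z) = trace (Y ** root_vector (\<Sum>i\<in>UNIV. z$i *s axis i 1))"
      by (simp add: basis_expansion)
    also have "\<dots> = (\<Sum>i\<in>UNIV. z$i * trace (Y ** root_vector (axis i 1)))"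
      using module_hom.sum[OF lin[unfolded linear_iff_module_hom], of "\<lambda>i. z$i *s axis i 1" UNIV]
        module_hom.scale[OF lin[unfolded linear_iff_module_hom]] by simp
    finally show ?thesis using 0 by simp
  qed
  have "cmat A (- B) \<in> g2C" using AB g2_neg by (auto simp: complexification_cmat)
  then obtain z where "cmat A (- B) = root_vector z" using root_vector_range by blast
  then have "trace (Y ** cmat A (- B)) = 0" using all0 by simp
  moreover have "trace (Y ** cmat A (- B)) = - of_real (\<Sum>i\<in>UNIV. \<Sum>k\<in>UNIV. (A$i$k)\<^sup>2 + (B$i$k)\<^sup>2)"
  proof -
    have "Complex (A$i$k) (B$i$k) * Complex (A$k$i) (- B$k$i) = - of_real ((A$i$k)\<^sup>2 + (B$i$k)\<^sup>2)" for i k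
      unfolding g2_skew[OF AB(2), of k i] g2_skew[OF AB(3), of k i] by (simp add: complex_eq_iff power2_eq_square)
    then show ?thesis
      by (simp add: trace_def matrix_matrix_mult_def AB(1) sum_negf sum_subtractf sum.distrib)
  qed
  ultimately have "complex_of_real (\<Sum>i\<in>UNIV. \<Sum>k\<in>UNIV. (A$i$k)\<^sup>2 + (B$i$k)\<^sup>2) = 0"
    by (simp only: neg_equal_0_iff_equal)
  then have "(\<Sum>i\<in>UNIV. \<Sum>k\<in>UNIV. (A$i$k)\<^sup>2 + (B$i$k)\<^sup>2) = 0"
    by (simp only: of_real_eq_0_iff)
  then have "(\<Sum>k\<in>UNIV. (A$i$k)\<^sup>2 + (B$i$k)\<^sup>2) = 0" for i
    using sum_nonneg_eq_0_iff[of UNIV "\<lambda>i. \<Sum>k\<in>UNIV. (A$i$k)\<^sup>2 + (B$i$k)\<^sup>2"]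
    by (simp add: sum_nonneg)
  then have "(A$i$k)\<^sup>2 + (B$i$k)\<^sup>2 = 0" for i k
    using sum_nonneg_eq_0_iff[of UNIV "\<lambda>k. (A$i$k)\<^sup>2 + (B$i$k)\<^sup>2"] by simp
  then show ?thesis using AB(1) by (simp add: vec_eq_iff complex_eq_iff sum_power2_eq_zero_iff)
qed

lemma matrix_diff_mult: "(A - B) ** C = A ** C - B ** C" for A B :: "'a::ring_1^'n^'m"
  by (simp add: matrix_matrix_mult_def vec_eq_iff sum_subtractf algebra_simps)

text \<open>The alternating form \<open>tr ([h, x] y)\<close> on the 14-dimensional algebra has even rank, and its radical is the
  centralizer of \<open>h\<close>.\<close>

lemma centralizer_not_line:
  assumes h: "h \<in> g2C" "h \<noteq> 0"
  obtains z where "z \<in> g2C" "lie_bracket h z = 0" "\<And>k. z \<noteq> mscale k h"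
proof -
  let ?e = "\<lambda>i. root_vector (axis i 1)"
  obtain c where c: "h = root_vector c" using h root_vector_range by blast
  have c0: "c \<noteq> 0" using h c module_hom.zero[OF module_hom_root_vector] by metis
  define M :: "complex^14^14" where "M = (\<chi> i j. trace (lie_bracket h (?e i) ** ?e j))"
  have anti: "trace (lie_bracket h x ** y) = - trace (lie_bracket h y ** x)" for x y :: "complex^8^8"
  proof -
    have 1: "trace (h ** x ** y) = trace (y ** h ** x)" by (metis trace_mul_sym matrix_mul_assoc)
    have 2: "trace (x ** h ** y) = trace (h ** y ** x)" by (metis trace_mul_sym matrix_mul_assoc)
    show ?thesis
      by (simp add: lie_bracket_def matrix_diff_mult trace_sub 1 2)
  qed
  have M: "(M *v d)$i = - trace (lie_bracket h (root_vector d) ** ?e i)" for d i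
  proof -
    have lin: "Vector_Spaces.linear (*s) (*) (\<lambda>z. trace (lie_bracket h (?e i) ** root_vector z))"
      using Vector_Spaces.linear_compose[OF linear_root_vector linear_trace_mult] by (simp add: o_def)
    have "trace (lie_bracket h (?e i) ** root_vector (\<Sum>j\<in>UNIV. d$j *s axis j 1)) = (\<Sum>j\<in>UNIV. d$j * M$i$j)"
      using module_hom.sum[OF lin[unfolded linear_iff_module_hom], of "\<lambda>j. d$j *s axis j 1" UNIV]
        module_hom.scale[OF lin[unfolded linear_iff_module_hom]] by (simp add: M_def)
    then show ?thesis
      by (simp add: matrix_vector_mult_def basis_expansion mult.commute anti[of "root_vector d"])
  qed
  have "transpose M$i$j = (- M)$i$j" for i j
    unfolding transpose_def vec_lambda_beta vector_uminus_component M_def by (rule anti)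
  then have "transpose M = - M" by (simp add: vec_eq_iff)
  moreover have "M *v c = 0" by (simp add: vec_eq_iff M c[symmetric])
      (simp add: trace_def matrix_matrix_mult_def)
  ultimately obtain d where d: "M *v d = 0" "\<And>k. d \<noteq> k *s c"
    using skew_second_kernel_vector[of M c] c0 by auto
  show ?thesis
  proof (rule that)
    show dg: "root_vector d \<in> g2C" using root_vector_range by blast
    have "trace (lie_bracket h (root_vector d) ** ?e i) = 0" for i
      using M[of d i] d(1) by simp
    then show "lie_bracket h (root_vector d) = 0"
      by (rule trace_pairing_nondegenerate[OF g2C_bracket[OF h(1) dg]])
    show "root_vector d \<noteq> mscale k h" for k
    proof
      assume "root_vector d = mscale k h"
      then have "root_vector (d - k *s c) = 0"
        using module_hom.diff[OF module_hom_root_vector]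
          module_hom.scale[OF module_hom_root_vector] by (simp add: c)
      from root_vector_eq_0[OF this] d(2) show False by simp
    qed
  qed
qed

definition torus :: "(complex^8^8) set" where
  "torus = {root_matrix p q 0 0 0 0 0 0 0 0 0 0 0 0 | p q. True}"

lemma root_matrix_zero: "root_matrix 0 0 0 0 0 0 0 0 0 0 0 0 0 0 = 0"
  by (simp add: root_matrix_eq_0_iff)

lemma mat_span_pair: "mat.span {a, b} = {mscale x a + mscale y b | x y. True}"
proof -
  have "\<And>z k x. z - mscale k a = mscale x b \<longleftrightarrow> z = mscale k a + mscale x b" by (auto simp: algebra_simps)
  then show ?thesis by (auto simp: mat.span_insert mat.span_singleton image_iff)
qed

lemma mat_independent_pair:
  assumes "b \<noteq> 0" "\<And>k. a \<noteq> mscale k b" shows "mat.independent {a, b}"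
  using assms by (intro mat.independent_insertI) (auto simp: mat.span_singleton mat.independent_empty)

lemma mat_dim_span_pair:
  assumes "b \<noteq> 0" "\<And>k. a \<noteq> mscale k b" shows "mat.dim (mat.span {a, b}) = 2"
proof -
  have "a \<noteq> b" using assms(2)[of 1] by auto
  then show ?thesis using mat.dim_span_eq_card_independent[OF mat_independent_pair[OF assms]] by simp
qed

lemma torus_span: "torus = mat.span {root_matrix 1 0 0 0 0 0 0 0 0 0 0 0 0 0, root_matrix 0 1 0 0 0 0 0 0 0 0 0 0 0 0}"
  by (simp add: mat_span_pair torus_def root_matrix_scale root_matrix_add)

lemma dim_torus: "mat.dim torus = 2"
  unfolding torus_span
  by (rule mat_dim_span_pair) (simp_all add: root_matrix_eq_0_iff root_matrix_scale root_matrix_eq_iff)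

lemma cartan_torus: "cartan_subalgebra g2C torus"
proof -
  have comm: "lie_bracket x y = 0" if "x \<in> torus" "y \<in> torus" for x y
    using that by (auto simp: torus_def lie_bracket_torus_root_matrix root_matrix_zero)
  have sub: "mat.subspace torus" unfolding torus_span by (rule mat.subspace_span)
  have "{lie_bracket x y | x y. x \<in> torus \<and> y \<in> torus} = {0}"
  proof
    show "{0} \<subseteq> {lie_bracket x y | x y. x \<in> torus \<and> y \<in> torus}"
      using comm[OF mat.subspace_0[OF sub] mat.subspace_0[OF sub], symmetric] mat.subspace_0[OF sub] by blast
  qed (use comm in auto)
  then have "lower_central torus (Suc 0) = {0}"
    by (simp del: mat.span_insert_0)
  then have nil: "lie_nilpotent torus"
    unfolding lie_nilpotent_def lie_subalgebra_def using sub comm mat.subspace_0[OF sub]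
    by (auto intro!: exI[of _ "Suc 0"])
  have norm: "z \<in> torus" if z: "z \<in> g2C" and n: "\<And>h. h \<in> torus \<Longrightarrow> lie_bracket z h \<in> torus" for z
  proof -
    obtain t1 t2 a1 a2 a3 a4 a5 a6 b1 b2 b3 b4 b5 b6 where
      Z: "z = root_matrix t1 t2 a1 a2 a3 a4 a5 a6 b1 b2 b3 b4 b5 b6"
      using z root_matrix_cases unfolding g2C_iff by blast
    \<comment> \<open>A regular element: the positive roots take the values 1, 1, 2, 3, 4, 5 on it,
      none of them zero. Normalizing the torus therefore kills all root coordinates.\<close>
    let ?h = "root_matrix 1 2 0 0 0 0 0 0 0 0 0 0 0 0"
    have "lie_bracket z ?h \<in> torus" by (rule n) (auto simp: torus_def)
    then have "mscale (-1) (lie_bracket z ?h) \<in> torus" by (rule mat.subspace_scale[OF sub])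
    then have "lie_bracket ?h z \<in> torus"
      by (simp add: mscale_minus_one[symmetric] lie_bracket_swap[of ?h])
    then show ?thesis
      by (auto simp: torus_def Z lie_bracket_torus_root_matrix root_matrix_eq_iff algebra_simps)
  qed
  have tg: "torus \<subseteq> g2C" by (auto simp: torus_def root_matrix_in_g2C)
  show ?thesis
    unfolding cartan_subalgebra_def
  proof (intro conjI tg nil subset_antisym subsetI)
    fix z assume "z \<in> {z \<in> g2C. \<forall>h\<in>torus. lie_bracket z h \<in> torus}"
    then show "z \<in> torus" using norm by simp
  next
    fix z assume z: "z \<in> torus"
    have "lie_bracket z h \<in> torus" if "h \<in> torus" for h
      unfolding comm[OF z that] by (rule mat.subspace_0[OF sub])
    with z tg show "z \<in> {z \<in> g2C. \<forall>h\<in>torus. lie_bracket z h \<in> torus}" by blast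
  qed
qed

lemma finite_spanning_g2C: "\<exists>B. finite B \<and> g2C \<subseteq> mat.span B"
proof (intro exI conjI)
  let ?B = "(\<lambda>i. root_vector (axis i 1)) ` UNIV"
  show "finite ?B" by simp
  show "g2C \<subseteq> mat.span ?B"
  proof
    fix D assume "D \<in> g2C"
    then obtain z where D: "D = root_vector z" using root_vector_range by blast
    have "D = root_vector (\<Sum>i\<in>UNIV. z$i *s axis i 1)" by (simp add: D basis_expansion)
    also have "\<dots> = (\<Sum>i\<in>UNIV. mscale (z$i) (root_vector (axis i 1)))"
      using module_hom.sum[OF module_hom_root_vector, of "\<lambda>i. z$i *s axis i 1" UNIV]
        module_hom.scale[OF module_hom_root_vector] by simp
    also have "\<dots> \<in> mat.span ?B"
      by (intro mat.span_sum mat.span_scale mat.span_base) auto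
    finally show "D \<in> mat.span ?B" .
  qed
qed

text \<open>The torus gives the upper bound. For the lower bound, dimension 0 is impossible because
  everything normalizes {0}, and a line is impossible because a generator h commutes with an element
  outside its line, which then normalizes the line.\<close>

theorem lie_rank_g2C: "lie_rank g2C = 2"
  unfolding lie_rank_def
proof (rule Least_equality)
  show "\<exists>H. cartan_subalgebra g2C H \<and> mat.dim H = 2" using cartan_torus dim_torus by blast
next
  fix d assume "\<exists>H. cartan_subalgebra g2C H \<and> mat.dim H = d"
  then obtain H where H: "cartan_subalgebra g2C H" and d: "mat.dim H = d" by blast
  have Hg: "H \<subseteq> g2C" and nz: "{z \<in> g2C. \<forall>h\<in>H. lie_bracket z h \<in> H} = H" and sub: "mat.subspace H"
    using H by (auto simp: cartan_subalgebra_def lie_nilpotent_def lie_subalgebra_def)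
  obtain B where B: "B \<subseteq> H" "mat.independent B" "H \<subseteq> mat.span B" "card B = mat.dim H"
    using mat.basis_exists by blast
  have "finite B" using finite_spanning_g2C B(1,2) Hg mat.independent_span_bound by (meson order_trans)
  show "2 \<le> d"
  proof (rule ccontr)
    assume "\<not> 2 \<le> d"
    then consider "card B = 0" | "card B = 1" using d B(4) by linarith
    then show False
    proof cases
      case 1
      then have "H = {0}" using \<open>finite B\<close> B(3) mat.subspace_0[OF sub] by auto
      moreover have "root_matrix 1 0 0 0 0 0 0 0 0 0 0 0 0 0 \<in> H"
        using root_matrix_in_g2C by (subst nz[symmetric]) (simp add: \<open>H = {0}\<close> lie_bracket_def)
      ultimately show False by (simp add: root_matrix_eq_0_iff)
    next
      case 2
      then obtain h where h: "B = {h}" by (auto simp: card_1_singleton_iff)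
      have h0: "h \<noteq> 0" using B(2) h by auto
      have hH: "h \<in> H" using B h by auto
      obtain z where z: "z \<in> g2C" "lie_bracket h z = 0" "\<And>k. z \<noteq> mscale k h"
        using centralizer_not_line hH Hg h0 by blast
      have sp: "x \<in> H \<Longrightarrow> \<exists>k. x = mscale k h" for x using B(3) h by (auto simp: mat.span_singleton)
      have "lie_bracket z (mscale k h) = 0" for k
        using z(2) module_hom.scale[OF linear_lie_bracket[unfolded linear_iff_module_hom], of z k h]
        by (simp add: lie_bracket_swap[of z h])
      then have "lie_bracket z x = 0" if "x \<in> H" for x using sp[OF that] by auto
      then have "z \<in> H" using z(1) mat.subspace_0[OF sub] by (subst nz[symmetric]) auto
      then show False using sp z(3) by blast
    qed
  qed
qed

lemma root_matrix_dim_two_contradiction: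
  assumes V: "mat.dim V = 2" and abc: "a \<in> V" "b \<in> V" "c \<in> V"
    and "c \<noteq> 0" "\<And>k. b \<noteq> mscale k c" "\<And>k l. a \<noteq> mscale k b + mscale l c"
  shows False
proof -
  obtain B where B: "B \<subseteq> V" "mat.independent B" "V \<subseteq> mat.span B" "card B = 2"
    using mat.basis_exists V by metis
  have fin: "finite B" using B(4) card.infinite by fastforce
  have ind: "mat.independent {a, b, c}"
    using assms by (intro mat.independent_insertI[of a "{b, c}"] mat_independent_pair) (auto simp: mat_span_pair)
  have "b \<noteq> c" "a \<noteq> b" "a \<noteq> c"
    using assms(6)[of 1] assms(7)[of 1 0] assms(7)[of 0 1] by auto
  then have "card {a, b, c} = 3" by simp
  moreover have "card {a, b, c} \<le> card B"
    using mat.independent_span_bound[OF fin ind] B(3) abc by blast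
  ultimately show False using B(4) by simp
qed


section \<open>Principal nilpotents in root coordinates\<close>

text \<open>The exponents of G2 are 1 and 5: the centralizer is spanned by e, of height 1, and by
  the highest root vector, of height 5.\<close>

lemma lie_centralizer_principal:
  assumes "x \<noteq> 0" "y \<noteq> 0"
  shows "mat.dim (lie_centralizer g2C (root_matrix 0 0 x y 0 0 0 0 0 0 0 0 0 0)) = 2"
proof -
  let ?E = "root_matrix 0 0 x y 0 0 0 0 0 0 0 0 0 0" and ?e = "root_matrix 0 0 0 0 0 0 0 1 0 0 0 0 0 0"
  have swap: "lie_bracket z ?E = 0 \<longleftrightarrow> lie_bracket ?E z = 0" for z
    by (auto simp: lie_bracket_def)
  have "lie_centralizer g2C ?E = mat.span {?e, ?E}"
  proof
    show "lie_centralizer g2C ?E \<subseteq> mat.span {?e, ?E}"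
    proof
      fix z assume "z \<in> lie_centralizer g2C ?E"
      then have z: "z \<in> g2C" "lie_bracket ?E z = 0" by (auto simp: lie_centralizer_def swap)
      obtain t1 t2 a1 a2 a3 a4 a5 a6 b1 b2 b3 b4 b5 b6 where
        Z: "z = root_matrix t1 t2 a1 a2 a3 a4 a5 a6 b1 b2 b3 b4 b5 b6"
        using z(1) root_matrix_cases unfolding g2C_iff by blast
      note e = z(2)[unfolded Z lie_bracket_principal_root_matrix root_matrix_eq_0_iff]
      have t1: "t1 = 0" and a0: "a3 = 0" "a4 = 0" "a5 = 0" "b3 = 0" "b4 = 0" "b5 = 0" "b6 = 0"
        using e assms by (elim conjE, simp)+
      then have t2: "t2 = 0" using e assms by (elim conjE, simp)
      have "\<i> * x * b1 = 0" using e by (elim conjE) algebra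
      then have b1: "b1 = 0" using assms by simp
      then have b2: "b2 = 0" using e assms by (elim conjE, simp)
      have a2: "x * a2 = y * a1" using e by (elim conjE) algebra
      have "z = mscale a6 ?e + mscale (a1 / x) ?E"
        unfolding Z root_matrix_scale root_matrix_add root_matrix_eq_iff
        using t1 t2 a0 a2 b1 b2 assms by (simp add: field_simps)
      then show "z \<in> mat.span {?e, ?E}" unfolding mat_span_pair by blast
    qed
    show "mat.span {?e, ?E} \<subseteq> lie_centralizer g2C ?E"
      by (auto simp: mat_span_pair lie_centralizer_def swap root_matrix_scale root_matrix_add
          root_matrix_in_g2C lie_bracket_principal_root_matrix root_matrix_eq_0_iff)
  qed
  moreover have "mat.dim (mat.span {?e, ?E}) = 2"
    by (rule mat_dim_span_pair) (use assms in \<open>simp_all add: root_matrix_eq_0_iff root_matrix_scale root_matrix_eq_iff\<close>)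
  ultimately show ?thesis by simp
qed

lemma nilpotent_principal:
  "nilpotent_element g2C (root_matrix 0 0 x y 0 0 0 0 0 0 0 0 0 0)"
proof -
  let ?E = "root_matrix 0 0 x y 0 0 0 0 0 0 0 0 0 0"
  \<comment> \<open>Bracketing with simple root vectors raises the height by one, and heights range
    from -5 to 5.\<close>
  have "(lie_bracket ?E ^^ 11) z = 0" if z: "z \<in> g2C" for z
  proof -
    obtain t1 t2 a1 a2 a3 a4 a5 a6 b1 b2 b3 b4 b5 b6 where
      Z: "z = root_matrix t1 t2 a1 a2 a3 a4 a5 a6 b1 b2 b3 b4 b5 b6"
      using z root_matrix_cases unfolding g2C_iff by blast
    show ?thesis
      unfolding Z by (simp add: numeral_eq_Suc lie_bracket_principal_root_matrix root_matrix_zero)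
  qed
  then show ?thesis unfolding nilpotent_element_def using root_matrix_in_g2C by blast
qed

theorem principal_nilpotent_root_matrix:
  assumes "x \<noteq> 0" "y \<noteq> 0"
  shows "principal_nilpotent g2C (root_matrix 0 0 x y 0 0 0 0 0 0 0 0 0 0)"
  unfolding principal_nilpotent_def
  using nilpotent_principal lie_centralizer_principal[OF assms] lie_rank_g2C by simp

lemma positive_centralizerI:
  assumes "w1 * c2 = w2 * c1" "w1 * c3 = w3 * c1" "w1 * c4 = w4 * c1"
    "2 * w2 * c5 - 6 * w3 * c4 + 6 * w4 * c3 - 2 * w5 * c2 = 0"
  shows "root_matrix 0 0 w1 w2 w3 w4 w5 w6 0 0 0 0 0 0 \<in> lie_centralizer g2C (root_matrix 0 0 c1 c2 c3 c4 c5 c6 0 0 0 0 0 0)"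
  unfolding lie_centralizer_def mem_Collect_eq lie_bracket_positive_root_matrix root_matrix_eq_0_iff
  using assms by (simp add: root_matrix_in_g2C)

text \<open>If a simple root vanishes on the semisimple part, the six positive root vectors contain too
  many elements commuting with \<open>e\<close>.\<close>

lemma regular_of_dim_centralizer:
  fixes p q :: real
  assumes dim: "mat.dim (lie_centralizer g2C (root_matrix 0 0 c1 c2 c3 c4 c5 c6 0 0 0 0 0 0)) = 2"
    and pq: "0 \<le> p" "p \<le> q" "0 < q"
    and c: "p \<noteq> 1 \<Longrightarrow> c1 = 0" "q - p \<noteq> 1 \<Longrightarrow> c2 = 0" "q \<noteq> 1 \<Longrightarrow> c3 = 0" "p + q \<noteq> 1 \<Longrightarrow> c4 = 0"
      "2 * p + q \<noteq> 1 \<Longrightarrow> c5 = 0" "p + 2 * q \<noteq> 1 \<Longrightarrow> c6 = 0"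
  shows "0 < p \<and> p < q"
proof (rule ccontr)
  assume "\<not> ?thesis"
  then consider "p = 0" | "p = q" "0 < p" using pq by linarith
  then show False
  proof cases
    case 1
    then have c1: "c1 = 0" using c(1) by simp
    show False
    proof (cases "q = 1")
      case True
      \<comment> \<open>As c1 = 0, the only brackets left pair root 2 with 5 and root 3 with 4.
        Hence the part of e in the roots 2, 5 and the part in 3, 4 each commute with e, as does the
        highest root vector; a part that is zero is replaced by a root vector.\<close>
      define u v where "u = (if c2 = 0 \<and> c5 = 0 then 1 else c2)" and "v = (if c3 = 0 \<and> c4 = 0 then 1 else c3)"
      have u: "u \<noteq> 0 \<or> c5 \<noteq> 0" "u * c5 = c5 * c2" and v: "v \<noteq> 0 \<or> c4 \<noteq> 0" "v * c4 = c4 * c3"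
        by (auto simp: u_def v_def)
      show False
        by (rule root_matrix_dim_two_contradiction[OF dim,
              of "root_matrix 0 0 0 u 0 0 c5 0 0 0 0 0 0 0" "root_matrix 0 0 0 0 v c4 0 0 0 0 0 0 0 0"
                 "root_matrix 0 0 0 0 0 0 0 1 0 0 0 0 0 0"])
          (use c1 u v in \<open>auto intro!: positive_centralizerI simp: root_matrix_eq_0_iff root_matrix_scale
             root_matrix_add root_matrix_eq_iff\<close>)
    next
      case False
      \<comment> \<open>Only the highest root remains in e, and it commutes with the root vectors 4,
        5 and 6.\<close>
      then have c0: "c2 = 0" "c3 = 0" "c4 = 0" "c5 = 0" using 1 c by simp_all
      show False
        by (rule root_matrix_dim_two_contradiction[OF dim,
              of "root_matrix 0 0 0 0 0 1 0 0 0 0 0 0 0 0" "root_matrix 0 0 0 0 0 0 1 0 0 0 0 0 0 0"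
                 "root_matrix 0 0 0 0 0 0 0 1 0 0 0 0 0 0"])
          (use c1 c0 in \<open>auto intro!: positive_centralizerI simp: root_matrix_eq_0_iff root_matrix_scale
             root_matrix_add root_matrix_eq_iff\<close>)
    qed
  next
    case 2
    then have c2: "c2 = 0" using c(2) by simp
    show False
    proof (cases "p = 1")
      case True
      then have c0: "c4 = 0" "c5 = 0" "c6 = 0" using 2 c by simp_all
      \<comment> \<open>Here e has only the coordinates c1 and c3. It serves as the first of three
        commuting elements, and w supplies a root vector instead when e is zero.\<close>
      define w where "w = (if c1 = 0 \<and> c3 = 0 then (1::complex) else 0)"
      have w: "c1 \<noteq> 0 \<or> c3 \<noteq> 0 \<or> w \<noteq> 0" "w * c1 = 0" "w * c3 = 0" by (auto simp: w_def)
      show False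
        by (rule root_matrix_dim_two_contradiction[OF dim,
              of "root_matrix 0 0 c1 0 c3 w 0 0 0 0 0 0 0 0" "root_matrix 0 0 0 0 0 0 1 0 0 0 0 0 0 0"
                 "root_matrix 0 0 0 0 0 0 0 1 0 0 0 0 0 0"])
          (use c2 c0 w in \<open>auto intro!: positive_centralizerI simp: root_matrix_eq_0_iff root_matrix_scale
             root_matrix_add root_matrix_eq_iff\<close>)
    next
      case False
      then have c0: "c1 = 0" "c3 = 0" using 2 c by simp_all
      show False
        by (rule root_matrix_dim_two_contradiction[OF dim,
              of "root_matrix 0 0 0 0 0 1 0 0 0 0 0 0 0 0" "root_matrix 0 0 0 0 0 0 1 0 0 0 0 0 0 0"
                 "root_matrix 0 0 0 0 0 0 0 1 0 0 0 0 0 0"])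
          (use c2 c0 in \<open>auto intro!: positive_centralizerI simp: root_matrix_eq_0_iff root_matrix_scale
             root_matrix_add root_matrix_eq_iff\<close>)
    qed
  qed
qed

text \<open>A regular dominant element that is a nonnegative combination of the coroots of those positive
  roots which take the value 1 on it is the sum of the fundamental coweights.\<close>

lemma principal_weights:
  fixes p q :: real
  assumes pq: "0 < p" "p < q"
    and p: "p = 4 * r1 - 2 * r2 - 2 * r3 + 2 * r4 + 2 * r5" and q: "q = - 2 * r1 + 2 * r2 + 4 * r3 + 2 * r4 + 2 * r6"
    and r: "0 \<le> r1" "0 \<le> r2" "0 \<le> r3"
    and c': "(p \<noteq> 1 \<longrightarrow> r1 = 0) \<and> (q - p \<noteq> 1 \<longrightarrow> r2 = 0) \<and> (q \<noteq> 1 \<longrightarrow> r3 = 0) \<and> (p + q \<noteq> 1 \<longrightarrow> r4 = 0) \<and>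
      (2 * p + q \<noteq> 1 \<longrightarrow> r5 = 0) \<and> (p + 2 * q \<noteq> 1 \<longrightarrow> r6 = 0)"
  shows "p = 1" "q = 2" "r1 = 3 / 2" "r2 = 5 / 2" "r3 = 0" "r4 = 0" "r5 = 0" "r6 = 0"
proof -
  have c: "p \<noteq> 1 \<Longrightarrow> r1 = 0" "q - p \<noteq> 1 \<Longrightarrow> r2 = 0" "q \<noteq> 1 \<Longrightarrow> r3 = 0" "p + q \<noteq> 1 \<Longrightarrow> r4 = 0"
    "2 * p + q \<noteq> 1 \<Longrightarrow> r5 = 0" "p + 2 * q \<noteq> 1 \<Longrightarrow> r6 = 0"
    using c' by blast+
  \<comment> \<open>If p is not 1, the other roots are excluded one after another. As soon as one of
    them takes the value 1, regularity moves later ones away from 1, and the formulas for p and q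
    contradict 0 < p < q.\<close>
  have r1: "p = 1"
  proof (rule ccontr)
    assume "p \<noteq> 1"
    then have 1: "r1 = 0" using c(1) by simp
    have "q - p \<noteq> 1"
    proof
      assume "q - p = 1"
      then have "r3 = 0" "r4 = 0" "r5 = 0" using pq c(3-5) by auto
      then show False using p 1 r pq by linarith
    qed
    then have 2: "r2 = 0" using c(2) by simp
    have "q \<noteq> 1"
    proof
      assume "q = 1"
      then have "r4 = 0" "r5 = 0" using pq c(4,5) by auto
      then show False using p 1 2 r pq by linarith
    qed
    then have 3: "r3 = 0" using c(3) by simp
    have "p + q \<noteq> 1"
    proof
      assume "p + q = 1"
      then have "r5 = 0" "r6 = 0" using pq c(5,6) by auto
      then show False using p q 1 2 3 pq by linarith
    qed
    then have 4: "r4 = 0" using c(4) by simp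
    have "2 * p + q \<noteq> 1"
    proof
      assume "2 * p + q = 1"
      then have "r6 = 0" using pq c(6) by auto
      then show False using q 1 2 3 4 pq by linarith
    qed
    then show False using c(5) p 1 2 3 4 pq by linarith
  qed
  then show "p = 1" .
  show 0: "r3 = 0" "r4 = 0" "r5 = 0" "r6 = 0" using r1 pq c by auto
  have "q = 2"
  proof (rule ccontr)
    assume "q \<noteq> 2"
    then have "r2 = 0" using c(2) r1 by auto
    then show False using q 0 r pq by linarith
  qed
  then show "q = 2" .
  then show "r1 = 3 / 2" "r2 = 5 / 2" using p q r1 0 by linarith+
qed

lemma lie_bracket_zero [simp]: "lie_bracket 0 A = 0" "lie_bracket A 0 = 0"
  by (simp_all add: vec_eq_iff matrix_entry_lie_bracket)

section \<open>Compact three-dimensional subalgebras\<close>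

definition so3_triple :: "real^8^8 \<Rightarrow> real^8^8 \<Rightarrow> real^8^8 \<Rightarrow> bool" where
  "so3_triple X Y Z \<longleftrightarrow> X \<in> g2 \<and> Y \<in> g2 \<and> Z \<in> g2 \<and> Z \<noteq> 0 \<and>
    lie_bracket X Y = Z \<and> lie_bracket Y Z = X \<and> lie_bracket Z X = Y"

lemma so3_triple_brackets:
  assumes "so3_triple X Y Z"
  shows "lie_bracket X Y = Z" "lie_bracket Y Z = X" "lie_bracket Z X = Y"
    "lie_bracket Y X = - Z" "lie_bracket Z Y = - X" "lie_bracket X Z = - Y"
  using assms lie_bracket_swap[of Y X] lie_bracket_swap[of Z Y] lie_bracket_swap[of X Z]
  by (auto simp: so3_triple_def)

lemma root_matrix_cnj:
  assumes "cmat X Y = root_matrix t1 t2 a1 a2 a3 a4 a5 a6 b1 b2 b3 b4 b5 b6"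
  shows "cmat X (- Y) = root_matrix (cnj t1) (cnj t2) (cnj b1) (cnj b2) (cnj b3) (cnj b4) (cnj b5) (cnj b6)
    (cnj a1) (cnj a2) (cnj a3) (cnj a4) (cnj a5) (cnj a6)"
proof -
  have "cmat X (- Y)$i$j = cnj (root_matrix t1 t2 a1 a2 a3 a4 a5 a6 b1 b2 b3 b4 b5 b6$i$j)" for i j
    unfolding assms[symmetric] by (simp add: complex_eq_iff)
  then show ?thesis
    unfolding vec_eq_iff forall_8 by (simp add: root_matrix_nth)
qed

text \<open>The entries (4, 2) and (7, 3) hold the torus coordinates t1 and t2. Only opposite roots
  contribute to them, by multiples of their coroots; for b = conj a the products become squared
  moduli.\<close>

lemma lie_bracket_positive_negative:
  "lie_bracket (root_matrix 0 0 a1 a2 a3 a4 a5 a6 0 0 0 0 0 0) (root_matrix 0 0 0 0 0 0 0 0 b1 b2 b3 b4 b5 b6)$4$2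
    = - 8 * \<i> * (a1 * b1) + 4 * \<i> * (a2 * b2) + 4 * \<i> * (a3 * b3) - 4 * \<i> * (a4 * b4) - 4 * \<i> * (a5 * b5)"
  "lie_bracket (root_matrix 0 0 a1 a2 a3 a4 a5 a6 0 0 0 0 0 0) (root_matrix 0 0 0 0 0 0 0 0 b1 b2 b3 b4 b5 b6)$7$3
    = 4 * \<i> * (a1 * b1) - 4 * \<i> * (a2 * b2) - 8 * \<i> * (a3 * b3) - 4 * \<i> * (a4 * b4) - 4 * \<i> * (a6 * b6)"
  unfolding matrix_entry_lie_bracket sum_8 root_matrix_nth by (simp_all add: algebra_simps)

lemma so3_triple_weight_coordinates:
  fixes p q :: real
  assumes t: "so3_triple X Y Z" and Z: "cmat Z 0 = root_matrix p q 0 0 0 0 0 0 0 0 0 0 0 0"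
    and pq: "0 \<le> p" "p \<le> q"
  shows "\<exists>a1 a2 a3 a4 a5 a6. cmat X Y = root_matrix 0 0 a1 a2 a3 a4 a5 a6 0 0 0 0 0 0 \<and>
    (p \<noteq> 1 \<longrightarrow> a1 = 0) \<and> (q - p \<noteq> 1 \<longrightarrow> a2 = 0) \<and> (q \<noteq> 1 \<longrightarrow> a3 = 0) \<and> (p + q \<noteq> 1 \<longrightarrow> a4 = 0) \<and>
    (2 * p + q \<noteq> 1 \<longrightarrow> a5 = 0) \<and> (p + 2 * q \<noteq> 1 \<longrightarrow> a6 = 0)"
proof -
  have "cmat X Y \<in> g2C" using t by (auto simp: so3_triple_def complexification_cmat)
  then obtain t1 t2 a1 a2 a3 a4 a5 a6 b1 b2 b3 b4 b5 b6 where
    E: "cmat X Y = root_matrix t1 t2 a1 a2 a3 a4 a5 a6 b1 b2 b3 b4 b5 b6"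
    using root_matrix_cases unfolding g2C_iff by blast
  have "lie_bracket (cmat Z 0) (cmat X Y) = cmat Y (- X)"
    using t lie_bracket_swap[of Z Y] by (simp add: lie_bracket_cmat so3_triple_def)
  also have "\<dots> = mscale (- \<i>) (cmat X Y)"
    by (simp add: vec_eq_iff mscale_def complex_eq_iff)
  finally have "lie_bracket (root_matrix p q 0 0 0 0 0 0 0 0 0 0 0 0) (root_matrix t1 t2 a1 a2 a3 a4 a5 a6 b1 b2 b3 b4 b5 b6)
      = root_matrix (- \<i> * t1) (- \<i> * t2) (- \<i> * a1) (- \<i> * a2) (- \<i> * a3) (- \<i> * a4) (- \<i> * a5) (- \<i> * a6)
       (- \<i> * b1) (- \<i> * b2) (- \<i> * b3) (- \<i> * b4) (- \<i> * b5) (- \<i> * b6)"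
    unfolding Z E root_matrix_scale .
  note e = this[unfolded lie_bracket_torus_root_matrix root_matrix_eq_iff]
  have w: "z = 0 \<or> x = 1" if "\<i> * (of_real x * z) = \<i> * z" for x z using that by auto
  have t0: "t1 = 0" "t2 = 0" using e by (elim conjE, simp)+
  have a: "\<i> * (of_real p * a1) = \<i> * a1" "\<i> * (of_real (q - p) * a2) = \<i> * a2" "\<i> * (of_real q * a3) = \<i> * a3"
    "\<i> * (of_real (p + q) * a4) = \<i> * a4" "\<i> * (of_real (2 * p + q) * a5) = \<i> * a5" "\<i> * (of_real (p + 2 * q) * a6) = \<i> * a6"
    unfolding of_real_diff of_real_add of_real_mult of_real_numeral
    using e by (elim conjE, algebra)+
  have b: "\<i> * (of_real (- p) * b1) = \<i> * b1" "\<i> * (of_real (p - q) * b2) = \<i> * b2" "\<i> * (of_real (- q) * b3) = \<i> * b3"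
    "\<i> * (of_real (- p - q) * b4) = \<i> * b4" "\<i> * (of_real (- 2 * p - q) * b5) = \<i> * b5" "\<i> * (of_real (- p - 2 * q) * b6) = \<i> * b6"
    unfolding of_real_diff of_real_add of_real_mult of_real_numeral of_real_minus of_real_neg_numeral
    using e by (elim conjE, algebra)+
  \<comment> \<open>The negative roots are nonpositive on Z because of 0 \<le> p \<le> q, so none of
    them takes the value 1.\<close>
  have b0: "b1 = 0" "b2 = 0" "b3 = 0" "b4 = 0" "b5 = 0" "b6 = 0"
    using w[OF b(1)] w[OF b(2)] w[OF b(3)] w[OF b(4)] w[OF b(5)] w[OF b(6)] pq by auto
  show ?thesis
    by (intro exI conjI, rule E[unfolded t0 b0])
      (use w[OF a(1)] w[OF a(2)] w[OF a(3)] w[OF a(4)] w[OF a(5)] w[OF a(6)] in auto)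
qed

theorem so3_triple_principal_coordinates:
  fixes p q :: real
  assumes t: "so3_triple X Y Z" and Z: "cmat Z 0 = root_matrix p q 0 0 0 0 0 0 0 0 0 0 0 0"
    and pq: "0 \<le> p" "p \<le> q" and dim: "mat.dim (lie_centralizer g2C (cmat X Y)) = 2"
  obtains a1 a2 where "p = 1" "q = 2" "cmat X Y = root_matrix 0 0 a1 a2 0 0 0 0 0 0 0 0 0 0"
    "(cmod a1)\<^sup>2 = 3 / 2" "(cmod a2)\<^sup>2 = 5 / 2"
proof -
  obtain a1 a2 a3 a4 a5 a6 where E: "cmat X Y = root_matrix 0 0 a1 a2 a3 a4 a5 a6 0 0 0 0 0 0" and
    c': "(p \<noteq> 1 \<longrightarrow> a1 = 0) \<and> (q - p \<noteq> 1 \<longrightarrow> a2 = 0) \<and> (q \<noteq> 1 \<longrightarrow> a3 = 0) \<and> (p + q \<noteq> 1 \<longrightarrow> a4 = 0) \<and>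
    (2 * p + q \<noteq> 1 \<longrightarrow> a5 = 0) \<and> (p + 2 * q \<noteq> 1 \<longrightarrow> a6 = 0)"
    using so3_triple_weight_coordinates[OF t Z pq] by (elim exE conjE) blast
  have c: "p \<noteq> 1 \<Longrightarrow> a1 = 0" "q - p \<noteq> 1 \<Longrightarrow> a2 = 0" "q \<noteq> 1 \<Longrightarrow> a3 = 0" "p + q \<noteq> 1 \<Longrightarrow> a4 = 0"
    "2 * p + q \<noteq> 1 \<Longrightarrow> a5 = 0" "p + 2 * q \<noteq> 1 \<Longrightarrow> a6 = 0"
    using c' by blast+
  have "q \<noteq> 0"
  proof
    assume "q = 0"
    then have "cmat Z 0 = 0" using Z pq root_matrix_zero by simp
    then have "Z = 0" by (auto simp: vec_eq_iff complex_eq_iff)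
    then show False using t by (simp add: so3_triple_def)
  qed
  then have q0: "0 < q" using pq by simp
  have reg: "0 < p" "p < q"
    using regular_of_dim_centralizer[OF dim[unfolded E] pq q0 c] by auto
  define r where "r z = (cmod z)\<^sup>2" for z
  have r: "z * cnj z = of_real (r z)" for z unfolding r_def by (rule complex_norm_square[symmetric])
  have ZZ: "Z$4$2 = p" "Z$7$3 = q"
  proof -
    have "cmat Z 0$4$2 = of_real p" "cmat Z 0$7$3 = of_real q" unfolding Z root_matrix_nth by simp_all
    then show "Z$4$2 = p" "Z$7$3 = q" by (simp_all add: complex_eq_iff)
  qed
  have br: "lie_bracket (cmat X Y) (cmat X (- Y)) = cmat 0 (- 2 *\<^sub>R Z)"
  proof -
    have "lie_bracket X (- Y) = - Z" "lie_bracket Y X = - Z" "lie_bracket Y (- Y) = 0"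
      using t lie_bracket_swap[of Y X] by (simp_all add: so3_triple_def lie_bracket_def matrix_mult_minus)
    then show ?thesis by (simp add: lie_bracket_cmat scaleR_2[symmetric])
  qed
  note cn = root_matrix_cnj[OF E, unfolded complex_cnj_zero]
  have "Complex 0 (- 2 * p) = - 8 * \<i> * of_real (r a1) + 4 * \<i> * of_real (r a2) + 4 * \<i> * of_real (r a3)
      - 4 * \<i> * of_real (r a4) - 4 * \<i> * of_real (r a5)"
    using arg_cong[OF br, of "\<lambda>M. M$4$2"]
    unfolding E cn lie_bracket_positive_negative r by (simp add: ZZ)
  then have P: "p = 4 * r a1 - 2 * r a2 - 2 * r a3 + 2 * r a4 + 2 * r a5" by (simp add: complex_eq_iff)
  have "Complex 0 (- 2 * q) = 4 * \<i> * of_real (r a1) - 4 * \<i> * of_real (r a2) - 8 * \<i> * of_real (r a3)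
      - 4 * \<i> * of_real (r a4) - 4 * \<i> * of_real (r a6)"
    using arg_cong[OF br, of "\<lambda>M. M$7$3"]
    unfolding E cn lie_bracket_positive_negative r by (simp add: ZZ)
  then have Q: "q = - 2 * r a1 + 2 * r a2 + 4 * r a3 + 2 * r a4 + 2 * r a6" by (simp add: complex_eq_iff)
  have r0: "0 \<le> r z" "r z = 0 \<longleftrightarrow> z = 0" for z by (simp_all add: r_def)
  note w = principal_weights[OF reg P Q r0(1) r0(1) r0(1), unfolded r0(2), OF c']
  show ?thesis
  proof (rule that)
    show "p = 1" "q = 2" using w(1,2) .
    show "cmat X Y = root_matrix 0 0 a1 a2 0 0 0 0 0 0 0 0 0 0" using E w(5-8) by simp
    show "(cmod a1)\<^sup>2 = 3 / 2" "(cmod a2)\<^sup>2 = 5 / 2" using w(3,4) by (simp_all add: r_def)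
  qed
qed

section \<open>The standard principal subalgebra\<close>

text \<open>The squares r1 = 3/2 and r2 = 5/2 solve 4 r1 - 2 r2 = 1 and -2 r1 + 2 r2 = 2, the torus
  part of [e, conj e] = -2iZ for Z = \<open>real_torus 1 2\<close>.\<close>

definition std_E :: "complex^8^8" where
  "std_E = root_matrix 0 0 (of_real (sqrt (3/2))) (of_real (sqrt (5/2))) 0 0 0 0 0 0 0 0 0 0"

definition std_X :: "real^8^8" where "std_X = (\<chi> i j. Re (std_E$i$j))"
definition std_Y :: "real^8^8" where "std_Y = (\<chi> i j. Im (std_E$i$j))"
definition real_torus :: "real \<Rightarrow> real \<Rightarrow> real^8^8" where
  "real_torus p q = (\<chi> i j. Re (root_matrix (of_real p) (of_real q) 0 0 0 0 0 0 0 0 0 0 0 0$i$j))"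

lemma cmat_std: "cmat std_X std_Y = std_E"
  by (simp add: vec_eq_iff std_X_def std_Y_def)

lemma cmat_real_torus: "cmat (real_torus p q) 0 = root_matrix (of_real p) (of_real q) 0 0 0 0 0 0 0 0 0 0 0 0"
proof -
  have "\<forall>i j. Im (root_matrix (of_real p) (of_real q) 0 0 0 0 0 0 0 0 0 0 0 0$i$j) = 0"
    unfolding forall_8 root_matrix_nth by simp
  then show ?thesis by (simp add: vec_eq_iff real_torus_def complex_eq_iff)
qed

lemma cmat_in_g2C: "cmat X Y \<in> g2C \<longleftrightarrow> X \<in> g2 \<and> Y \<in> g2"
  by (auto simp: complexification_cmat cmat_eq_iff)

lemma real_torus_in_g2: "real_torus p q \<in> g2"
  using root_matrix_in_g2C[of "of_real p" "of_real q" 0 0 0 0 0 0 0 0 0 0 0 0]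
  unfolding cmat_real_torus[symmetric] cmat_in_g2C by simp

lemma real_torus_mult_vec:
  "real_torus p q *v oct_unit 1 = 0"
  "real_torus p q *v oct_unit 2 = p *\<^sub>R oct_unit 4"
  "real_torus p q *v oct_unit 3 = q *\<^sub>R oct_unit 7"
  by (simp_all add: vec_eq_iff forall_8 matrix_vector_oct_unit real_torus_def root_matrix_nth)

lemma so3_triple_std: "so3_triple std_X std_Y (real_torus 1 2)"
proof -
  let ?Z = "real_torus 1 2"
  have XY: "std_X \<in> g2" "std_Y \<in> g2"
    using cmat_in_g2C[of std_X std_Y] root_matrix_in_g2C by (auto simp: cmat_std std_E_def)
  have "?Z$4$2 = 1" by (simp add: real_torus_def root_matrix_nth)
  then have Z0: "?Z \<noteq> 0" by auto
  have "lie_bracket (cmat ?Z 0) (cmat std_X std_Y) = mscale (- \<i>) (cmat std_X std_Y)"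
    unfolding cmat_real_torus cmat_std std_E_def lie_bracket_torus_root_matrix root_matrix_scale root_matrix_eq_iff
    by (simp add: algebra_simps)
  also have "\<dots> = cmat std_Y (- std_X)" by (simp add: vec_eq_iff mscale_def complex_eq_iff)
  finally have 1: "lie_bracket ?Z std_X = std_Y" "lie_bracket ?Z std_Y = - std_X"
    by (simp_all add: lie_bracket_cmat cmat_eq_iff)
  have sq: "complex_of_real (sqrt x) * complex_of_real (sqrt x) = of_real x" if "x \<ge> 0" for x
    using that by (simp flip: of_real_mult)
  have "cmat std_X (- std_Y) = root_matrix 0 0 0 0 0 0 0 0 (of_real (sqrt (3/2))) (of_real (sqrt (5/2))) 0 0 0 0"
    using root_matrix_cnj[OF cmat_std[unfolded std_E_def]] by simp
  then have "lie_bracket (cmat std_X std_Y) (cmat std_X (- std_Y)) = mscale (- 2 * \<i>) (cmat ?Z 0)"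
    unfolding cmat_std std_E_def lie_bracket_principal_root_matrix cmat_real_torus root_matrix_scale root_matrix_eq_iff
    by (simp add: mult.assoc sq lie_bracket_principal_root_matrix root_matrix_eq_iff)
  also have "\<dots> = cmat 0 (- 2 *\<^sub>R ?Z)" by (simp add: vec_eq_iff mscale_def complex_eq_iff)
  finally have "lie_bracket std_X (- std_Y) + lie_bracket std_Y std_X = - 2 *\<^sub>R ?Z"
    by (simp add: lie_bracket_cmat cmat_eq_iff)
  then have "2 *\<^sub>R lie_bracket std_X std_Y = 2 *\<^sub>R ?Z"
    by (simp add: lie_bracket_def matrix_mult_minus scaleR_2 algebra_simps)
  then have "lie_bracket std_X std_Y = ?Z" by simp
  then show ?thesis
    using XY Z0 1 lie_bracket_swap[of std_Y ?Z] by (simp add: so3_triple_def real_torus_in_g2)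
qed

lemma principal_nilpotent_std: "principal_nilpotent g2C (cmat std_X std_Y)"
  unfolding cmat_std std_E_def by (rule principal_nilpotent_root_matrix) auto


section \<open>Conjugation\<close>

text \<open>On \<open>G2\<close> the transpose is the inverse. Written this way, conjugation depends
  continuously on g and makes sense for complex matrices as well.\<close>

definition conj_by :: "'a::comm_ring_1^'n^'n \<Rightarrow> 'a^'n^'n \<Rightarrow> 'a^'n^'n" where
  "conj_by g A = g ** A ** transpose g"

lemma matrix_mult_diff_gen: "C ** (A - B) = C ** A - C ** B" for A B :: "'a::ring_1^'n^'m"
  by (simp add: matrix_matrix_mult_def vec_eq_iff sum_subtractf algebra_simps)

lemma lie_bracket_conj_by:
  assumes "transpose g ** g = mat 1"
  shows "lie_bracket (conj_by g A) (conj_by g B) = conj_by g (lie_bracket A B)"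
proof -
  have "conj_by g A ** conj_by g B = conj_by g (A ** B)" for A B
  proof -
    have "conj_by g A ** conj_by g B = g ** A ** (transpose g ** g) ** B ** transpose g"
      unfolding conj_by_def by (simp only: matrix_mul_assoc)
    then show ?thesis by (simp add: assms conj_by_def matrix_mul_assoc)
  qed
  then show ?thesis
    by (simp add: lie_bracket_def) (simp add: conj_by_def matrix_diff_mult matrix_mult_diff_gen)
qed

lemma conj_by_conj_by: "conj_by g (conj_by h A) = conj_by (g ** h) A"
  by (simp add: conj_by_def matrix_transpose_mul matrix_mul_assoc)

lemma conj_by_1 [simp]: "conj_by (mat 1) A = A"
  by (simp add: conj_by_def)

lemma conj_by_cancel:
  assumes "g \<in> carrier G2"
  shows "conj_by (transpose g) (conj_by g A) = A" "conj_by g (conj_by (transpose g) A) = A"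
  using G2_orthogonal_matrix[OF assms] by (simp_all add: conj_by_conj_by)

lemma linear_conj_by: "linear (conj_by g)" for g :: "real^'n^'n"
  unfolding conj_by_def
  by (intro linearI) (simp_all add: matrix_add_ldistrib matrix_add_rdistrib matrix_mult_scaleR)

lemma linear_conj_by_mat: "Vector_Spaces.linear mscale mscale (conj_by g)" for g :: "'a::field^'n^'n"
  unfolding Vector_Spaces.linear_iff conj_by_def
  by (intro conjI mat.vector_space_axioms allI)
    (simp_all add: vec_eq_iff matrix_matrix_mult_def mscale_def sum.distrib sum_distrib_left algebra_simps)

lemma conj_by_g2: "g \<in> carrier G2 \<Longrightarrow> X \<in> g2 \<Longrightarrow> conj_by g X \<in> g2"
  unfolding conj_by_def by (rule g2_conj)

lemma cmat_mult: "cmat X Y ** cmat X' Y' = cmat (X ** X' - Y ** Y') (X ** Y' + Y ** X')"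
  by (simp add: vec_eq_iff matrix_matrix_mult_def complex_eq_iff sum.distrib sum_subtractf algebra_simps)

lemma transpose_cmat: "transpose (cmat X Y) = cmat (transpose X) (transpose Y)"
  by (simp add: vec_eq_iff transpose_def)

lemma conj_by_cmat: "conj_by (cmat g 0) (cmat X Y) = cmat (conj_by g X) (conj_by g Y)"
proof -
  have z: "transpose (0 :: real^'n^'n) = 0" by (simp add: vec_eq_iff transpose_def)
  have "A ** (0 :: real^'n^'n) = 0" "0 ** A = (0 :: real^'n^'n)" for A
    by (simp_all add: vec_eq_iff matrix_matrix_mult_def)
  then show ?thesis by (simp add: conj_by_def cmat_mult transpose_cmat z)
qed

lemma cmat_mat_1: "cmat (mat 1) 0 = mat 1"
  by (simp add: vec_eq_iff mat_def complex_eq_iff)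

lemma cmat_orthogonal:
  assumes "g \<in> carrier G2" shows "transpose (cmat g 0) ** cmat g 0 = mat 1"
proof -
  have z: "transpose (0 :: real^8^8) = 0" by (simp add: vec_eq_iff transpose_def)
  have "A ** (0 :: real^8^8) = 0" "0 ** A = (0 :: real^8^8)" for A
    by (simp_all add: vec_eq_iff matrix_matrix_mult_def)
  then show ?thesis by (simp add: transpose_cmat z cmat_mult G2_orthogonal_matrix[OF assms] cmat_mat_1)
qed

lemma conj_by_g2C:
  assumes "g \<in> carrier G2" "D \<in> g2C" shows "conj_by (cmat g 0) D \<in> g2C"
proof -
  obtain X Y where "D = cmat X Y" "X \<in> g2" "Y \<in> g2" using assms(2) by (auto simp: complexification_cmat)
  then show ?thesis by (simp add: conj_by_cmat cmat_in_g2C conj_by_g2[OF assms(1)])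
qed

lemma conj_by_cmat_cancel:
  assumes "g \<in> carrier G2"
  shows "conj_by (cmat (transpose g) 0) (conj_by (cmat g 0) D) = D"
    "conj_by (cmat g 0) (conj_by (cmat (transpose g) 0) D) = D"
proof -
  obtain X Y where "D = cmat X Y" by (rule cmat_cases)
  then show "conj_by (cmat (transpose g) 0) (conj_by (cmat g 0) D) = D"
    "conj_by (cmat g 0) (conj_by (cmat (transpose g) 0) D) = D"
    by (simp_all add: conj_by_cmat conj_by_cancel[OF assms])
qed

lemma mat_dim_injective_image:
  fixes f :: "'a::field^'n^'n \<Rightarrow> 'a^'n^'n"
  assumes lin: "Vector_Spaces.linear mscale mscale f" and inj: "inj f"
  shows "mat.dim (f ` V) = mat.dim V"
proof -
  interpret vector_space_pair "mscale :: 'a \<Rightarrow> 'a^'n^'n \<Rightarrow> 'a^'n^'n" "mscale :: 'a \<Rightarrow> 'a^'n^'n \<Rightarrow> 'a^'n^'n" ..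
  obtain B where B: "B \<subseteq> V" "mat.independent B" "V \<subseteq> mat.span B" "card B = mat.dim V"
    using mat.basis_exists by blast
  have "mat.independent (f ` B)"
    by (rule linear_independent_injective_image[OF lin B(2) inj_on_subset[OF inj]]) simp
  moreover have "f ` V \<subseteq> mat.span (f ` B)"
    using B(3) linear_span_image[OF lin, of B] by blast
  ultimately have "card (f ` B) = mat.dim (f ` V)"
    using B(1) by (intro mat.basis_card_eq_dim) auto
  then show ?thesis using B(4) card_image[OF inj_on_subset[OF inj, of B]] by simp
qed

lemma lie_centralizer_conj_by:
  assumes g: "g \<in> carrier G2"
  shows "lie_centralizer g2C (conj_by (cmat g 0) E) = conj_by (cmat g 0) ` lie_centralizer g2C E"
proof -
  let ?c = "conj_by (cmat g 0)" and ?c' = "conj_by (cmat (transpose g) 0)"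
  note can = conj_by_cmat_cancel[OF g]
  note br = lie_bracket_conj_by[OF cmat_orthogonal[OF g]]
  have c0: "?c D = 0 \<longleftrightarrow> D = 0" for D
    using can(1)[of D] can(1)[of 0] by (metis mat.scale_zero_left linear_conj_by_mat module_hom.zero linear_iff_module_hom)
  show ?thesis
  proof
    show "?c ` lie_centralizer g2C E \<subseteq> lie_centralizer g2C (?c E)"
      by (auto simp: lie_centralizer_def conj_by_g2C[OF g] br c0)
    show "lie_centralizer g2C (?c E) \<subseteq> ?c ` lie_centralizer g2C E"
    proof
      fix z assume z: "z \<in> lie_centralizer g2C (?c E)"
      have "lie_bracket (?c (?c' z)) (?c E) = 0" using z can by (simp add: lie_centralizer_def)
      then have "lie_bracket (?c' z) E = 0" by (simp add: br c0)
      then have "?c' z \<in> lie_centralizer g2C E"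
        using z conj_by_g2C[OF G2_transpose[OF g]] by (simp add: lie_centralizer_def)
      then show "z \<in> ?c ` lie_centralizer g2C E" using can(2)[of z] by (metis image_eqI)
    qed
  qed
qed

lemma inj_conj_by_cmat: "g \<in> carrier G2 \<Longrightarrow> inj (conj_by (cmat g 0))"
  using conj_by_cmat_cancel(1) by (metis injI)

lemma dim_lie_centralizer_conj_by:
  "g \<in> carrier G2 \<Longrightarrow>
    mat.dim (lie_centralizer g2C (conj_by (cmat g 0) E)) = mat.dim (lie_centralizer g2C E)"
  by (simp add: lie_centralizer_conj_by mat_dim_injective_image linear_conj_by_mat inj_conj_by_cmat)

lemma principal_nilpotent_conj_by:
  assumes g: "g \<in> carrier G2" and E: "principal_nilpotent g2C E"
  shows "principal_nilpotent g2C (conj_by (cmat g 0) E)"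
proof -
  let ?c = "conj_by (cmat g 0)" and ?c' = "conj_by (cmat (transpose g) 0)"
  obtain k where k: "E \<in> g2C" "\<And>z. z \<in> g2C \<Longrightarrow> (lie_bracket E ^^ k) z = 0"
    using E by (auto simp: principal_nilpotent_def nilpotent_element_def)
  have it: "(lie_bracket (?c E) ^^ n) (?c z) = ?c ((lie_bracket E ^^ n) z)" for n z
    by (induction n) (simp_all add: lie_bracket_conj_by[OF cmat_orthogonal[OF g]])
  have "(lie_bracket (?c E) ^^ k) z = 0" if "z \<in> g2C" for z
  proof -
    have "(lie_bracket (?c E) ^^ k) (?c (?c' z)) = ?c 0"
      using k(2)[OF conj_by_g2C[OF G2_transpose[OF g] that]] by (simp only: it)
    also have "?c 0 = 0" by (simp add: conj_by_def vec_eq_iff matrix_matrix_mult_def)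
    finally show ?thesis by (simp add: conj_by_cmat_cancel[OF g])
  qed
  then show ?thesis
    using E conj_by_g2C[OF g k(1)]
    by (auto simp: principal_nilpotent_def nilpotent_element_def dim_lie_centralizer_conj_by[OF g])
qed

lemma so3_triple_conj_by:
  assumes g: "g \<in> carrier G2" and t: "so3_triple X Y Z"
  shows "so3_triple (conj_by g X) (conj_by g Y) (conj_by g Z)"
proof -
  have "conj_by g Z \<noteq> 0"
  proof
    assume "conj_by g Z = 0"
    then have "conj_by (transpose g) (conj_by g Z) = 0" by (simp add: linear_0[OF linear_conj_by])
    then show False using t by (simp add: conj_by_cancel[OF g] so3_triple_def)
  qed
  then show ?thesis
    using t by (simp add: so3_triple_def conj_by_g2[OF g] lie_bracket_conj_by[OF G2_orthogonal_matrix(1)[OF g]])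
qed

section \<open>Normal form of principal triples\<close>

lemma std_X_mult_vec:
  "std_X *v oct_unit 1 = - (2 * sqrt (3/2)) *\<^sub>R oct_unit 4"
  "std_X *v oct_unit 2 = - sqrt (5/2) *\<^sub>R oct_unit 3"
  "std_X *v oct_unit 3 = sqrt (5/2) *\<^sub>R oct_unit 2 - sqrt (3/2) *\<^sub>R oct_unit 5"
  by (simp_all add: vec_eq_iff forall_8 matrix_vector_oct_unit std_X_def std_E_def root_matrix_nth)

text \<open>The torus element with angles x and y multiplies the coordinates a1 and a2 by exp(-ix)
  and exp(-i(y - x)). The two simple roots are independent, so both phases can be prescribed: x is
  read off a1, and y off the product of the phases of a1 and a2, which is w.\<close>

lemma torus_phase:
  assumes X: "X \<in> g2" and E: "cmat X Y = root_matrix 0 0 a1 a2 0 0 0 0 0 0 0 0 0 0"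
    and a: "(cmod a1)\<^sup>2 = 3 / 2" "(cmod a2)\<^sup>2 = 5 / 2"
  obtains g where "g \<in> carrier G2" "conj_by g std_X = X" "conj_by g (real_torus 1 2) = real_torus 1 2"
proof -
  define s t where "s = sqrt (3/2)" and "t = sqrt (5/2)"
  have st: "s > 0" "t > 0" "s\<^sup>2 = 3/2" "t\<^sup>2 = 5/2" by (simp_all add: s_def t_def)
  define c2 s2 where "c2 = Re a1 / s" and "s2 = - Im a1 / s"
  define w where "w = a2 / of_real t * Complex c2 (- s2)"
  define c3 s3 where "c3 = Re w" and "s3 = - Im w"
  have a1: "Re a1 = s * c2" "Im a1 = - s * s2" using st by (simp_all add: c2_def s2_def)
  have n2: "c2\<^sup>2 + s2\<^sup>2 = 1"
    using a(1) st by (simp add: c2_def s2_def cmod_power2 power_divide add_divide_distrib[symmetric])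
  have cw: "Complex c2 (- s2) * Complex c2 s2 = 1"
    using n2 by (simp add: complex_eq_iff power2_eq_square)
  have "a2 = of_real t * (w * Complex c2 s2)"
    unfolding w_def using st cw by (simp add: mult.assoc)
  then have a2: "Re a2 = t * (c3 * c2 + s3 * s2)" "Im a2 = t * (c3 * s2 - s3 * c2)"
    by (simp_all add: c3_def s3_def algebra_simps)
  have "(cmod w)\<^sup>2 = 1"
    using a(2) st n2 by (simp add: w_def norm_mult norm_divide power_mult_distrib power_divide cmod_power2)
  then have n3: "c3\<^sup>2 + s3\<^sup>2 = 1" by (simp add: c3_def s3_def cmod_power2)
  define u a b where "u = oct_unit 1" and "a = c2 *\<^sub>R oct_unit 2 + s2 *\<^sub>R oct_unit 4"
    and "b = c3 *\<^sub>R oct_unit 3 + s3 *\<^sub>R oct_unit 7"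
  have ua: "u \<odot> a = c2 *\<^sub>R oct_unit 4 - s2 *\<^sub>R oct_unit 2"
    and ub: "u \<odot> b = c3 *\<^sub>R oct_unit 7 - s3 *\<^sub>R oct_unit 3"
    and ab: "a \<odot> b = (c2 * c3 - s2 * s3) *\<^sub>R oct_unit 5 - (c2 * s3 + s2 * c3) *\<^sub>R oct_unit 6"
    by (simp_all add: u_def a_def b_def octonion_coords algebra_simps)
  have "basic_triple u a b"
    using n2 n3 unfolding basic_triple_def ua
    by (simp add: u_def a_def b_def inner_add_left inner_add_right inner_diff_left power2_eq_square)
  then obtain g where g: "g \<in> carrier G2" "g *v oct_unit 1 = u" "g *v oct_unit 2 = a" "g *v oct_unit 3 = b"
    using basic_triple_automorphism by metis
  have g4: "g *v oct_unit 4 = u \<odot> a" and g7: "g *v oct_unit 7 = u \<odot> b" and g5: "g *v oct_unit 5 = a \<odot> b"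
    using G2_mult[OF g(1)] g(2-4) oct_unit_mults by metis+
  have XR: "X$i$j = Re (root_matrix 0 0 a1 a2 0 0 0 0 0 0 0 0 0 0$i$j)" for i j
    unfolding E[symmetric] by simp
  have T: "real_torus 1 2 *v (g *v oct_unit i) = g *v (real_torus 1 2 *v oct_unit i)" if "i \<in> {1,2,3}" for i
  proof -
    have "real_torus 1 2 *v oct_unit 4 = - oct_unit 2" "real_torus 1 2 *v oct_unit 7 = - 2 *\<^sub>R oct_unit 3"
      by (simp_all add: vec_eq_iff forall_8 matrix_vector_oct_unit real_torus_def root_matrix_nth)
    then show ?thesis using that
      by (auto simp: real_torus_mult_vec g g4 g7 ua ub matrix_vector_mult_scaleR)
        (simp_all add: u_def a_def b_def real_torus_mult_vec matrix_vector_right_distrib matrix_vector_mult_scaleR algebra_simps)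
  qed
  have X1: "X *v u = g *v (std_X *v oct_unit 1)"
    unfolding std_X_mult_vec s_def[symmetric] t_def[symmetric] matrix_vector_mult_scaleR g4 ua
    by (simp add: u_def vec_eq_iff forall_8 matrix_vector_oct_unit XR root_matrix_nth a1)
  have X2: "X *v a = g *v (std_X *v oct_unit 2)"
    unfolding std_X_mult_vec s_def[symmetric] t_def[symmetric] matrix_vector_mult_scaleR g(4)
    unfolding a_def b_def vec_eq_iff forall_8 matrix_vector_mult_8 XR root_matrix_nth
    using n2 n3 by (simp add: a1 a2) algebra
  have X3: "X *v b = g *v (std_X *v oct_unit 3)"
    unfolding std_X_mult_vec s_def[symmetric] t_def[symmetric] matrix_vector_mult_scaleR matrix_vector_mult_diff_distrib g(3) g5 ab
    unfolding a_def b_def vec_eq_iff forall_8 matrix_vector_mult_8 XR root_matrix_nth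
    using n2 n3 by (simp add: a1 a2) algebra
  have stdX: "std_X \<in> g2" using so3_triple_std by (simp add: so3_triple_def)
  \<comment> \<open>Derivations that agree on e1, e2, e3 coincide, so a conjugacy relation needs to
    be tested on three vectors only.\<close>
  have conj: "conj_by g A = B" if AB: "A \<in> g2" "B \<in> g2" and eq: "\<And>i. i \<in> {1,2,3} \<Longrightarrow> B *v (g *v oct_unit i) = g *v (A *v oct_unit i)" for A B
  proof -
    have "conj_by (transpose g) B = A"
    proof (rule g2_generators)
      show "conj_by (transpose g) B \<in> g2" by (rule conj_by_g2[OF G2_transpose[OF g(1)] AB(2)])
      have "conj_by (transpose g) B *v oct_unit i = A *v oct_unit i" if "i \<in> {1,2,3}" for i
      proof -
        have "conj_by (transpose g) B *v oct_unit i = transpose g *v (B *v (g *v oct_unit i))"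
          by (simp only: conj_by_def matrix_vector_mul_assoc matrix_mul_assoc transpose_transpose)
        also have "\<dots> = A *v oct_unit i"
          unfolding eq[OF that] by (simp add: matrix_vector_mul_assoc matrix_mul_assoc G2_orthogonal_matrix[OF g(1)] del: transpose_matrix_vector)
        finally show ?thesis .
      qed
      then show "conj_by (transpose g) B *v oct_unit 1 = A *v oct_unit 1" "conj_by (transpose g) B *v oct_unit 2 = A *v oct_unit 2"
        "conj_by (transpose g) B *v oct_unit 3 = A *v oct_unit 3" by simp_all
    qed (rule AB(1))
    then show ?thesis using conj_by_cancel(2)[OF g(1)] by metis
  qed
  show thesis
  proof (rule that[OF g(1)])
    show "conj_by g std_X = X" by (rule conj[OF stdX X]) (use X1 X2 X3 g in auto)
    show "conj_by g (real_torus 1 2) = real_torus 1 2" by (rule conj[OF real_torus_in_g2 real_torus_in_g2 T])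
  qed
qed

text \<open>The orbit of one standard triple. The next lemmas identify it with the so(3) triples for
  which X + iY is a principal nilpotent.\<close>

definition principal_triple :: "real^8^8 \<Rightarrow> real^8^8 \<Rightarrow> real^8^8 \<Rightarrow> bool" where
  "principal_triple X Y Z \<longleftrightarrow>
    (\<exists>g\<in>carrier G2. X = conj_by g std_X \<and> Y = conj_by g std_Y \<and> Z = conj_by g (real_torus 1 2))"

lemma so3_triple_imp_principal_triple:
  assumes t: "so3_triple X Y Z" and dim: "mat.dim (lie_centralizer g2C (cmat X Y)) = 2"
  shows "principal_triple X Y Z"
proof -
  have Zg: "Z \<in> g2" using t by (simp add: so3_triple_def)
  obtain u a b p q where f: "torus_frame Z u a b p q" and pq: "0 \<le> p" "p \<le> q"
    using torus_frame_dominant[OF Zg] by metis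
  then have bt: "basic_triple u a b" and Z: "Z *v u = 0" "Z *v a = p *\<^sub>R (u \<odot> a)" "Z *v b = q *\<^sub>R (u \<odot> b)"
    by (auto simp: torus_frame_def)
  obtain g where g: "g \<in> carrier G2" "g *v oct_unit 1 = u" "g *v oct_unit 2 = a" "g *v oct_unit 3 = b"
    using basic_triple_automorphism[OF bt] by metis
  note h = G2_transpose[OF g(1)]
  let ?X = "conj_by (transpose g) X" and ?Y = "conj_by (transpose g) Y" and ?Z = "conj_by (transpose g) Z"
  have gi: "transpose g *v (g *v x) = x" for x
    by (simp add: matrix_vector_mul_assoc G2_orthogonal_matrix[OF g(1)] del: transpose_matrix_vector)
  have cz: "?Z *v x = transpose g *v (Z *v (g *v x))" for x
    by (simp only: conj_by_def matrix_vector_mul_assoc matrix_mul_assoc transpose_transpose)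
  have ZT: "?Z = real_torus p q"
  proof (rule g2_generators[OF conj_by_g2[OF h Zg] real_torus_in_g2])
    show "?Z *v oct_unit 1 = real_torus p q *v oct_unit 1"
      unfolding cz by (simp add: g Z real_torus_mult_vec)
    have "u \<odot> a = g *v oct_unit 4" "u \<odot> b = g *v oct_unit 7"
      using G2_mult[OF g(1)] g(2-4) oct_unit_mults by metis+
    then show "?Z *v oct_unit 2 = real_torus p q *v oct_unit 2" "?Z *v oct_unit 3 = real_torus p q *v oct_unit 3"
      unfolding cz by (simp_all add: g Z real_torus_mult_vec matrix_vector_mult_scaleR gi del: transpose_matrix_vector)
  qed
  have t': "so3_triple ?X ?Y ?Z" by (rule so3_triple_conj_by[OF h t])
  have dim': "mat.dim (lie_centralizer g2C (cmat ?X ?Y)) = 2"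
    using dim dim_lie_centralizer_conj_by[OF h, of "cmat X Y"] by (simp add: conj_by_cmat)
  obtain a1 a2 where c: "p = 1" "q = 2" "cmat ?X ?Y = root_matrix 0 0 a1 a2 0 0 0 0 0 0 0 0 0 0"
    "(cmod a1)\<^sup>2 = 3 / 2" "(cmod a2)\<^sup>2 = 5 / 2"
    using so3_triple_principal_coordinates[OF t' _ pq dim'] cmat_real_torus[of p q] ZT by metis
  have "?X \<in> g2" using t' by (simp add: so3_triple_def)
  then obtain k where k: "k \<in> carrier G2" "conj_by k std_X = ?X" "conj_by k (real_torus 1 2) = real_torus 1 2"
    using torus_phase[OF _ c(3-5)] by metis
  have "conj_by (g ** k) std_X = X" "conj_by (g ** k) (real_torus 1 2) = Z"
    using k ZT c conj_by_cancel(2)[OF g(1)] by (metis conj_by_conj_by)+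
  \<comment> \<open>Y is the bracket of Z and X, so matching X and Z is enough.\<close>
  moreover have "conj_by (g ** k) std_Y = Y"
  proof -
    have "std_Y = lie_bracket (real_torus 1 2) std_X" "Y = lie_bracket Z X"
      using so3_triple_std t by (simp_all add: so3_triple_def)
    then show ?thesis
      using lie_bracket_conj_by[OF G2_orthogonal_matrix(1)[OF G2_times[OF g(1) k(1)]], of "real_torus 1 2" std_X] calculation
      by simp
  qed
  ultimately show ?thesis unfolding principal_triple_def using G2_times[OF g(1) k(1)] by metis
qed

lemma principal_triple_so3: "principal_triple X Y Z \<Longrightarrow> so3_triple X Y Z"
  unfolding principal_triple_def using so3_triple_conj_by[OF _ so3_triple_std] by auto

lemma principal_triple_nilpotent: "principal_triple X Y Z \<Longrightarrow> principal_nilpotent g2C (cmat X Y)"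
  unfolding principal_triple_def using principal_nilpotent_conj_by[OF _ principal_nilpotent_std]
  by (auto simp: conj_by_cmat)

lemma principal_triple_conj_by:
  "g \<in> carrier G2 \<Longrightarrow> principal_triple X Y Z \<Longrightarrow> principal_triple (conj_by g X) (conj_by g Y) (conj_by g Z)"
  unfolding principal_triple_def using G2_times by (auto simp: conj_by_conj_by)

lemma principal_triple_std: "principal_triple std_X std_Y (real_torus 1 2)"
  unfolding principal_triple_def by (rule bexI[OF _ G2_mat_1]) simp


section \<open>Principal subalgebras and principal triples\<close>

lemma mscale_real: "mscale = ((*\<^sub>R) :: real \<Rightarrow> real^'n^'n \<Rightarrow> real^'n^'n)"
  by (intro ext) (simp add: mscale_def vec_eq_iff)

lemma mat_real_eqs:
  fixes S :: "(real^'n^'n) set"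
  shows "mat.subspace S = subspace S" "mat.dim S = dim S" "mat.span S = span S"
  by (simp_all add: mscale_real subspace_raw_def dim_raw_def span_raw_def)

lemma bounded_bilinear_lie_bracket:
  "bounded_bilinear (lie_bracket :: real^'n^'n \<Rightarrow> real^'n^'n \<Rightarrow> real^'n^'n)"
  unfolding bilinear_conv_bounded_bilinear[symmetric] bilinear_def linear_iff
  by (simp add: lie_bracket_def matrix_add_ldistrib matrix_add_rdistrib matrix_mult_scaleR algebra_simps)

lemmas lie_bracket_bilinear =
  bounded_bilinear.add_left[OF bounded_bilinear_lie_bracket] bounded_bilinear.add_right[OF bounded_bilinear_lie_bracket]
  bounded_bilinear.diff_left[OF bounded_bilinear_lie_bracket] bounded_bilinear.diff_right[OF bounded_bilinear_lie_bracket]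
  bounded_bilinear.scaleR_left[OF bounded_bilinear_lie_bracket] bounded_bilinear.scaleR_right[OF bounded_bilinear_lie_bracket]
  bounded_bilinear.minus_left[OF bounded_bilinear_lie_bracket] bounded_bilinear.minus_right[OF bounded_bilinear_lie_bracket]

lemma inner_matrix: "A \<bullet> B = (\<Sum>i\<in>UNIV. \<Sum>j\<in>UNIV. A$i$j * B$i$j)" for A B :: "real^'n^'m"
  by (simp add: inner_vec_def)

lemma inner_matrix_mult_left: "(A ** B) \<bullet> C = B \<bullet> (transpose A ** C)" for A B C :: "real^'n^'n"
proof -
  have "(A ** B) \<bullet> C = (\<Sum>i\<in>UNIV. \<Sum>j\<in>UNIV. \<Sum>k\<in>UNIV. A$i$k * B$k$j * C$i$j)"
    by (simp add: inner_matrix matrix_matrix_mult_def sum_distrib_right)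
  also have "\<dots> = (\<Sum>i\<in>UNIV. \<Sum>k\<in>UNIV. \<Sum>j\<in>UNIV. A$i$k * B$k$j * C$i$j)"
    by (intro sum.cong refl sum.swap)
  also have "\<dots> = (\<Sum>k\<in>UNIV. \<Sum>i\<in>UNIV. \<Sum>j\<in>UNIV. A$i$k * B$k$j * C$i$j)"
    by (rule sum.swap)
  also have "\<dots> = (\<Sum>k\<in>UNIV. \<Sum>j\<in>UNIV. \<Sum>i\<in>UNIV. A$i$k * B$k$j * C$i$j)"
    by (intro sum.cong refl sum.swap)
  also have "\<dots> = B \<bullet> (transpose A ** C)"
    by (simp add: inner_matrix matrix_matrix_mult_def transpose_def sum_distrib_left mult_ac)
  finally show ?thesis .
qed

lemma inner_transpose: "transpose A \<bullet> transpose B = A \<bullet> B" for A B :: "real^'n^'m"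
  unfolding inner_matrix transpose_def by (simp, rule sum.swap)

lemma inner_matrix_mult_right: "(A ** B) \<bullet> C = A \<bullet> (C ** transpose B)" for A B C :: "real^'n^'n"
proof -
  have "(A ** B) \<bullet> C = (transpose B ** transpose A) \<bullet> transpose C"
    by (metis inner_transpose matrix_transpose_mul)
  also have "\<dots> = transpose A \<bullet> (B ** transpose C)" by (simp add: inner_matrix_mult_left)
  also have "\<dots> = A \<bullet> (C ** transpose B)"
    by (metis inner_transpose matrix_transpose_mul transpose_transpose)
  finally show ?thesis .
qed

text \<open>The entrywise inner product of A and C is tr(A^T C), and bracketing with a skew matrix
  is a skew operator for it.\<close>

lemma inner_lie_bracket:
  assumes "B \<in> g2" shows "lie_bracket A B \<bullet> C = A \<bullet> lie_bracket B C"
  by (simp add: lie_bracket_def inner_diff_left inner_diff_right inner_matrix_mult_left[of B A]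
      inner_matrix_mult_right[of A B] g2_transpose[OF assms] matrix_mult_minus)

lemma inner_conj_by:
  assumes "g \<in> carrier G2" shows "conj_by g A \<bullet> conj_by g B = A \<bullet> B"
  by (simp add: conj_by_def inner_matrix_mult_right[of _ "transpose g"] inner_matrix_mult_left[of g]
      matrix_mul_assoc[symmetric] G2_orthogonal_matrix[OF assms]) (simp add: G2_cancel[OF assms])

lemma so3_triple_inner:
  assumes t: "so3_triple X Y Z"
  shows "X \<bullet> Y = 0" "X \<bullet> Z = 0" "Y \<bullet> Z = 0" "X \<bullet> X = Z \<bullet> Z" "Y \<bullet> Y = Z \<bullet> Z" "0 < Z \<bullet> Z"
proof -
  have g: "X \<in> g2" "Y \<in> g2" "Z \<in> g2" and b: "lie_bracket X Y = Z" "lie_bracket Y Z = X" "lie_bracket Z X = Y" and "Z \<noteq> 0"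
    using t by (auto simp: so3_triple_def)
  show "0 < Z \<bullet> Z" using \<open>Z \<noteq> 0\<close> by simp
  show "X \<bullet> Y = 0" using inner_lie_bracket[OF g(3), of Y Y] b by (simp add: lie_bracket_swap[of Z Y] inner_commute[of X Y])
  show "X \<bullet> Z = 0" using inner_lie_bracket[OF g(3), of Y Z] b by simp
  show "Y \<bullet> Z = 0" using inner_lie_bracket[OF g(1), of Z Z] b by (simp add: lie_bracket_swap[of X Z] inner_commute[of Y Z])
  show "X \<bullet> X = Z \<bullet> Z" using inner_lie_bracket[OF g(2), of X Z] b by simp
  show "Y \<bullet> Y = Z \<bullet> Z" using inner_lie_bracket[OF g(1), of Z Y] b by simp
qed

lemma span_triple: "span {a, b, c} = {x *\<^sub>R a + y *\<^sub>R b + z *\<^sub>R c | x y z. True}"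
proof -
  have "v - k *\<^sub>R a - l *\<^sub>R b = m *\<^sub>R c \<longleftrightarrow> v = k *\<^sub>R a + l *\<^sub>R b + m *\<^sub>R c" for v k l m by (auto simp: algebra_simps)
  then show ?thesis by (auto simp: span_insert span_singleton image_iff)
qed

lemma orthogonal_triple_independent:
  fixes a b c :: "'a::euclidean_space"
  assumes "a \<noteq> 0" "b \<noteq> 0" "c \<noteq> 0" "a \<bullet> b = 0" "a \<bullet> c = 0" "b \<bullet> c = 0"
  shows "independent {a, b, c}" "card {a, b, c} = 3"
proof -
  show "independent {a, b, c}"
    using assms by (intro pairwise_orthogonal_independent) (auto simp: pairwise_insert orthogonal_def inner_commute)
  have "a \<noteq> b" "a \<noteq> c" "b \<noteq> c" using assms by auto
  then show "card {a, b, c} = 3" by simp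
qed

section \<open>From complex sl2 triples to compact bases and back\<close>

lemma trace_square_cmat:
  assumes "A \<in> g2" "B \<in> g2"
  shows "trace (cmat A B ** cmat A B) = Complex (B \<bullet> B - A \<bullet> A) (- 2 * (A \<bullet> B))"
proof -
  have "trace (cmat A B ** cmat A B) = (\<Sum>i\<in>UNIV. \<Sum>k\<in>UNIV. Complex (A$i$k) (B$i$k) * Complex (A$k$i) (B$k$i))"
    by (simp add: trace_def matrix_matrix_mult_def)
  also have "\<dots> = (\<Sum>i\<in>UNIV. \<Sum>k\<in>UNIV. Complex (B$i$k * B$i$k - A$i$k * A$i$k) (- 2 * (A$i$k * B$i$k)))"
  proof (intro sum.cong refl)
    fix i k :: 8
    show "Complex (A$i$k) (B$i$k) * Complex (A$k$i) (B$k$i) = Complex (B$i$k * B$i$k - A$i$k * A$i$k) (- 2 * (A$i$k * B$i$k))"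
      unfolding g2_skew[OF assms(1), of k i] g2_skew[OF assms(2), of k i] by (simp add: complex_eq_iff)
  qed
  also have "\<dots> = Complex (B \<bullet> B - A \<bullet> A) (- 2 * (A \<bullet> B))"
    by (simp add: complex_eq_iff inner_matrix sum_subtractf sum_distrib_left sum_negf)
  finally show ?thesis .
qed

text \<open>By cyclicity 2 tr(e e) = tr([h, e] e) = 0. With \<open>trace_square_cmat\<close> this
  makes the real and imaginary parts of e orthogonal and equally long.\<close>

lemma sl2_triple_trace_square:
  assumes t: "sl2_triple g2C e h f" shows "trace (e ** e) = 0"
proof -
  have h: "lie_bracket h e = mscale 2 e" using t by (simp add: sl2_triple_def)
  have "trace (lie_bracket h e ** e) = 0"
    by (simp add: lie_bracket_def matrix_diff_mult trace_sub)
      (metis matrix_mul_assoc trace_mul_sym)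
  moreover have "trace (mscale 2 e ** e) = 2 * trace (e ** e)"
    by (simp add: trace_def matrix_matrix_mult_def mscale_def sum_distrib_left mult.assoc)
  ultimately show ?thesis by (simp add: h)
qed

lemma orthogonal_triple_expansion:
  fixes A B C :: "real^8^8"
  assumes V: "V \<in> span {A, B, C}" and n: "A \<bullet> A = r" "B \<bullet> B = r" "C \<bullet> C = r" "r > 0"
    and o: "A \<bullet> B = 0" "A \<bullet> C = 0" "B \<bullet> C = 0"
  shows "V = (V \<bullet> A / r) *\<^sub>R A + (V \<bullet> B / r) *\<^sub>R B + (V \<bullet> C / r) *\<^sub>R C"
proof -
  obtain x y z where V: "V = x *\<^sub>R A + y *\<^sub>R B + z *\<^sub>R C" using V by (auto simp: span_triple)
  show ?thesis
    using n o inner_commute[of B A] inner_commute[of C A] inner_commute[of C B] by (simp add: V inner_add_left)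
qed

text \<open>Write e = A + iB and complete the equally long orthogonal A, B by C to an orthogonal
  basis of S. Invariance of the inner product makes the brackets those of so(3) up to one factor
  \<kappa>, which is nonzero as S is not abelian. Dividing by \<kappa> keeps X + iY proportional to
  e, so the centralizer does not change.\<close>

lemma M8_so3_triple:
  assumes S: "S \<in> M8"
  obtains X Y Z where "so3_triple X Y Z" "S = span {X, Y, Z}" "mat.dim (lie_centralizer g2C (cmat X Y)) = 2"
proof -
  have Sg: "S \<subseteq> g2" and dS: "dim S = 3" and simple: "lie_simple S"
    and "principal_subalgebra g2C (complexification S)"
    using S by (auto simp: M8_def principal_3dim_subalgebra_def mat_real_eqs)
  then obtain e h f where t: "sl2_triple g2C e h f" and pr: "principal_nilpotent g2C e"
    and sp: "complexification S = mat.span {e, h, f}" by (auto simp: principal_subalgebra_def)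
  have subS: "subspace S" and closed: "\<And>x y. x \<in> S \<Longrightarrow> y \<in> S \<Longrightarrow> lie_bracket x y \<in> S"
    and nonab: "\<exists>x\<in>S. \<exists>y\<in>S. lie_bracket x y \<noteq> 0"
    using simple by (auto simp: lie_simple_def lie_subalgebra_def mat_real_eqs)
  have "e \<in> complexification S" unfolding sp by (rule mat.span_base) simp
  then obtain A B where e: "e = cmat A B" and AB: "A \<in> S" "B \<in> S" by (auto simp: complexification_cmat)
  have ABg: "A \<in> g2" "B \<in> g2" using AB Sg by auto
  have e0: "e \<noteq> 0"
  proof
    assume e: "e = 0"
    then have "h = 0" using t by (simp add: sl2_triple_def)
    then have "f = 0" using t by (simp add: sl2_triple_def eq_commute[of 0])
    then have "complexification S = {0}" unfolding sp by (simp add: e \<open>h = 0\<close>)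
    moreover have "cmat X 0 \<in> complexification S" if "X \<in> S" for X
      using that subspace_0[OF subS] by (auto simp: complexification_cmat)
    ultimately have "S \<subseteq> {0}" by (auto simp: vec_eq_iff complex_eq_iff)
    then show False using dS dim_eq_0[of S] by simp
  qed
  have "Complex (B \<bullet> B - A \<bullet> A) (- 2 * (A \<bullet> B)) = 0"
    using trace_square_cmat[OF ABg] sl2_triple_trace_square[OF t] by (simp add: e)
  then have r: "B \<bullet> B = A \<bullet> A" and AB0: "A \<bullet> B = 0" by (simp_all add: complex_eq_iff)
  define \<rho> where "\<rho> = A \<bullet> A"
  have "A \<noteq> 0"
  proof
    assume "A = 0"
    then have "B = 0" using r by simp
    then have "e = 0" using \<open>A = 0\<close> e by (simp add: vec_eq_iff complex_eq_iff)
    then show False using e0 by simp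
  qed
  then have \<rho>: "\<rho> > 0" by (simp add: \<rho>_def)
  have "dim {A, B} < dim S"
    using dim_le_card'[of "{A, B}"] card_length[of "[A, B]"] dS by simp
  have "span {A, B} \<subseteq> span S" using AB by (intro span_mono) auto
  moreover have "span {A, B} \<noteq> span S"
    using \<open>dim {A, B} < dim S\<close> by (metis dim_span less_irrefl)
  ultimately have "span {A, B} \<subset> span S" by blast
  then obtain C0 where C0: "C0 \<noteq> 0" "C0 \<in> span S" "\<And>y. y \<in> span {A, B} \<Longrightarrow> orthogonal C0 y"
    using orthogonal_to_subspace_exists_gen by metis
  define C where "C = (sqrt \<rho> / norm C0) *\<^sub>R C0"
  have C: "C \<in> S" using C0(2) subS by (metis C_def span_eq_iff subspace_scale)
  have CA: "A \<bullet> C = 0" "B \<bullet> C = 0"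
    using C0(3)[OF span_base[of A]] C0(3)[OF span_base[of B]] by (simp_all add: C_def orthogonal_def inner_commute)
  have "C \<bullet> C = (sqrt \<rho>)\<^sup>2 * ((C0 \<bullet> C0) / (norm C0)\<^sup>2)" by (simp add: C_def power2_eq_square)
  then have CC: "C \<bullet> C = \<rho>" using C0(1) \<rho> by (simp add: dot_square_norm)
  have Cg: "C \<in> g2" using C Sg by auto
  have "B \<noteq> 0" "C \<noteq> 0" using CC r \<rho> by (auto simp: \<rho>_def)
  note ind = orthogonal_triple_independent[OF \<open>A \<noteq> 0\<close> this AB0 CA]
  have "S \<subseteq> span {A, B, C}"
    by (rule card_ge_dim_independent[OF _ ind(1)]) (use AB C ind dS in auto)
  moreover have "span {A, B, C} \<subseteq> S" using AB C subS by (intro span_minimal) auto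
  ultimately have SE: "S = span {A, B, C}" by blast
  note ex = orthogonal_triple_expansion[OF _ \<rho>_def[symmetric] r[folded \<rho>_def] CC \<rho> AB0 CA, folded SE]
  \<comment> \<open>The trilinear form [P, Q] . R is alternating on S, hence given by one number in
    dimension three.\<close>
  define \<kappa> where "\<kappa> = lie_bracket A B \<bullet> C / \<rho>"
  have 1: "lie_bracket B C \<bullet> A = \<kappa> * \<rho>"
    using inner_lie_bracket[OF ABg(2), of A C] \<rho> by (simp add: \<kappa>_def inner_commute)
  have 2: "lie_bracket C A \<bullet> B = \<kappa> * \<rho>"
    using inner_lie_bracket[OF ABg(1), of C B] \<rho> by (simp add: \<kappa>_def inner_commute)
  have 3: "lie_bracket P Q \<bullet> Q = 0" "lie_bracket P Q \<bullet> P = 0" if "P \<in> g2" "Q \<in> g2" for P Q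
    using inner_lie_bracket[OF that(2), of P Q] inner_lie_bracket[OF that(1), of Q P]
    by (simp_all add: lie_bracket_swap[of P Q])
  have br: "lie_bracket A B = \<kappa> *\<^sub>R C" "lie_bracket B C = \<kappa> *\<^sub>R A" "lie_bracket C A = \<kappa> *\<^sub>R B"
    using ex[OF closed[OF AB]] ex[OF closed[OF AB(2) C]] ex[OF closed[OF C AB(1)]] 1 2 \<rho>
      3[OF ABg] 3[OF ABg(2) Cg] 3[OF Cg ABg(1)]
    by (simp_all add: \<kappa>_def)
  have \<kappa>: "\<kappa> \<noteq> 0"
  proof
    assume "\<kappa> = 0"
    then have z: "lie_bracket A B = 0" "lie_bracket B C = 0" "lie_bracket C A = 0"
      "lie_bracket B A = 0" "lie_bracket C B = 0" "lie_bracket A C = 0"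
      using br lie_bracket_swap[of B A] lie_bracket_swap[of C B] lie_bracket_swap[of A C] by simp_all
    have "lie_bracket x y = 0" if "x \<in> S" "y \<in> S" for x y
      using that unfolding SE span_triple by (auto simp: lie_bracket_bilinear z)
    then show False using nonab by blast
  qed
  define X Y Z where "X = (1 / \<kappa>) *\<^sub>R A" and "Y = (1 / \<kappa>) *\<^sub>R B" and "Z = (1 / \<kappa>) *\<^sub>R C"
  have so3: "so3_triple X Y Z"
    using \<kappa> ABg Cg CC \<rho> by (auto simp: so3_triple_def X_def Y_def Z_def lie_bracket_bilinear br g2_scale)
  have XS: "{X, Y, Z} \<subseteq> S" using AB C subS by (simp add: X_def Y_def Z_def subspace_scale)
  have "A = \<kappa> *\<^sub>R X" "B = \<kappa> *\<^sub>R Y" "C = \<kappa> *\<^sub>R Z" using \<kappa> by (simp_all add: X_def Y_def Z_def)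
  then have "{A, B, C} \<subseteq> span {X, Y, Z}" by (auto intro: span_scale span_base)
  then have "S = span {X, Y, Z}"
    unfolding SE using XS[unfolded SE] by (intro subset_antisym span_minimal) auto
  moreover have "mat.dim (lie_centralizer g2C (cmat X Y)) = 2"
  proof -
    have "e = mscale (of_real \<kappa>) (cmat X Y)"
      using \<kappa> by (simp add: e X_def Y_def vec_eq_iff mscale_def complex_eq_iff)
    then have "lie_bracket z e = mscale (of_real \<kappa>) (lie_bracket z (cmat X Y))" for z
      using module_hom.scale[OF linear_lie_bracket[unfolded linear_iff_module_hom]] by simp
    then have "lie_centralizer g2C e = lie_centralizer g2C (cmat X Y)"
      using \<kappa> by (simp add: lie_centralizer_def)
    then show ?thesis using pr lie_rank_g2C by (simp add: principal_nilpotent_def)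
  qed
  ultimately show ?thesis using so3 that by blast
qed

lemma so3_triple_simple:
  assumes t: "so3_triple X Y Z"
  shows "lie_simple (span {X, Y, Z})"
proof -
  note b = so3_triple_brackets[OF t]
  have Z0: "Z \<noteq> 0" using t by (auto simp: so3_triple_def)
  let ?S = "span {X, Y, Z}"
  have S: "X \<in> ?S" "Y \<in> ?S" "Z \<in> ?S" by (auto intro: span_base)
  have cl: "lie_bracket x y \<in> ?S" if xy: "x \<in> ?S" "y \<in> ?S" for x y
  proof -
    obtain a b' c a' b'' c' where "x = a *\<^sub>R X + b' *\<^sub>R Y + c *\<^sub>R Z" "y = a' *\<^sub>R X + b'' *\<^sub>R Y + c' *\<^sub>R Z"
      using xy unfolding span_triple by blast
    then show ?thesis
      by (simp add: lie_bracket_bilinear b) (intro span_add span_diff span_neg span_scale S)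
  qed
  have "I = {0} \<or> I = ?S" if I: "lie_ideal ?S I" for I
  proof (cases "I = {0}")
    case False
    have sub: "subspace I" "I \<subseteq> ?S" and id: "\<And>x y. x \<in> ?S \<Longrightarrow> y \<in> I \<Longrightarrow> lie_bracket x y \<in> I"
      using I by (auto simp: lie_ideal_def mat_real_eqs)
    obtain x where x: "x \<in> I" "x \<noteq> 0" using False subspace_0[OF sub(1)] by blast
    then obtain \<alpha> \<beta> \<gamma> where xe: "x = \<alpha> *\<^sub>R X + \<beta> *\<^sub>R Y + \<gamma> *\<^sub>R Z" using sub(2) unfolding span_triple by blast
    \<comment> \<open>On the other two basis vectors the square of ad X is -1, and it kills X. So 1
      + (ad X)^2 extracts the X-component; likewise for Y and Z.\<close>
    have "x + lie_bracket X (lie_bracket X x) \<in> I" "x + lie_bracket Y (lie_bracket Y x) \<in> I"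
      "x + lie_bracket Z (lie_bracket Z x) \<in> I"
      by (intro subspace_add[OF sub(1)] x id S)+
    then have co: "\<alpha> *\<^sub>R X \<in> I" "\<beta> *\<^sub>R Y \<in> I" "\<gamma> *\<^sub>R Z \<in> I" by (simp_all add: xe lie_bracket_bilinear b)
    have un: "V \<in> I" if "k *\<^sub>R V \<in> I" "k \<noteq> 0" for k V
      using subspace_scale[OF sub(1) that(1), of "1 / k"] that(2) by simp
    have "X \<in> I \<or> Y \<in> I \<or> Z \<in> I" using x(2) un[OF co(1)] un[OF co(2)] un[OF co(3)] xe by fastforce
    then have "X \<in> I \<and> Y \<in> I \<and> Z \<in> I"
      using id[OF S(1), of Y] id[OF S(2), of Z] id[OF S(3), of X] subspace_neg[OF sub(1)]
        id[OF S(2), of X] id[OF S(3), of Y] id[OF S(1), of Z] b by (metis minus_minus)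
    then have "?S \<subseteq> I" by (intro span_minimal sub) auto
    then show ?thesis using sub(2) by blast
  qed simp
  moreover have "\<exists>x\<in>?S. \<exists>y\<in>?S. lie_bracket x y \<noteq> 0" using S b Z0 by metis
  ultimately show ?thesis
    using cl by (auto simp: lie_simple_def lie_subalgebra_def mat_real_eqs)
qed

lemma so3_triple_principal_imp_M8:
  assumes t: "so3_triple X Y Z" and pr: "principal_nilpotent g2C (cmat X Y)"
  shows "span {X, Y, Z} \<in> M8"
proof -
  let ?S = "span {X, Y, Z}"
  note o = so3_triple_inner[OF t]
  have S: "X \<in> ?S" "Y \<in> ?S" "Z \<in> ?S" by (auto intro: span_base)
  note b = so3_triple_brackets[OF t]
  have g: "X \<in> g2" "Y \<in> g2" "Z \<in> g2" using t by (auto simp: so3_triple_def)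
  have "X \<noteq> 0" "Y \<noteq> 0" "Z \<noteq> 0" using o by auto
  then have "dim ?S = 3"
    using orthogonal_triple_independent[of X Y Z] o dim_span_eq_card_independent[of "{X, Y, Z}"] by metis
  moreover have "?S \<subseteq> g2" using g subspace_g2 by (intro span_minimal) auto
  moreover have "principal_subalgebra g2C (complexification ?S)"
    unfolding principal_subalgebra_def
  proof (intro exI conjI)
    \<comment> \<open>With e = X + iY, h = 2iZ and f = -conj e, the relation [Z, e] = -ie gives
      weight 2, and [e, conj e] = -2iZ gives [e, f] = h.\<close>
    let ?e = "cmat X Y" and ?h = "cmat 0 (2 *\<^sub>R Z)" and ?f = "cmat (- X) Y"
    show "sl2_triple g2C ?e ?h ?f"
      unfolding sl2_triple_def using g
      by (simp add: cmat_in_g2C g2_scale g2_neg g2_zero lie_bracket_cmat lie_bracket_bilinear b scaleR_2[symmetric])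
        (simp add: vec_eq_iff mscale_def complex_eq_iff)
    show "principal_nilpotent g2C ?e" by (rule pr)
    let ?T = "mat.span {?e, ?h, ?f}"
    have T: "?e \<in> ?T" "?h \<in> ?T" "?f \<in> ?T" by (auto intro: mat.span_base)
    have "mscale (1/2) ?e - mscale (1/2) ?f \<in> ?T" "mscale (- \<i> / 2) (?e + ?f) \<in> ?T" "mscale (- \<i> / 2) ?h \<in> ?T"
      by (intro mat.span_diff mat.span_scale mat.span_add T)+
    moreover have "mscale (1/2) ?e - mscale (1/2) ?f = cmat X 0" "mscale (- \<i> / 2) (?e + ?f) = cmat Y 0"
      "mscale (- \<i> / 2) ?h = cmat Z 0"
      by (simp_all add: vec_eq_iff mscale_def complex_eq_iff)
    ultimately have base: "cmat X 0 \<in> ?T" "cmat Y 0 \<in> ?T" "cmat Z 0 \<in> ?T" by simp_all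
    show "complexification ?S = ?T"
    proof
      show "complexification ?S \<subseteq> ?T"
      proof
        fix D assume "D \<in> complexification ?S"
        then obtain P Q where D: "D = cmat P Q" and PQ: "P \<in> ?S" "Q \<in> ?S" by (auto simp: complexification_cmat)
        obtain a b c a' b' c' where "P = a *\<^sub>R X + b *\<^sub>R Y + c *\<^sub>R Z" "Q = a' *\<^sub>R X + b' *\<^sub>R Y + c' *\<^sub>R Z"
          using PQ unfolding span_triple by blast
        then have "D = mscale (Complex a a') (cmat X 0) + mscale (Complex b b') (cmat Y 0) + mscale (Complex c c') (cmat Z 0)"
          by (simp add: D vec_eq_iff mscale_def complex_eq_iff)
        then show "D \<in> ?T" using base by (simp add: mat.span_add mat.span_scale)
      qed
      have "mat.subspace (complexification ?S)"
      proof -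
        have "cmat 0 0 = (0 :: complex^8^8)" by (simp add: vec_eq_iff complex_eq_iff)
        then have "0 \<in> complexification ?S" unfolding complexification_cmat using span_zero by (metis (mono_tags, lifting) mem_Collect_eq)
        moreover have add: "cmat P Q + cmat P' Q' = cmat (P + P') (Q + Q')" for P Q P' Q' :: "real^8^8"
          by (simp add: vec_eq_iff complex_eq_iff)
        moreover have scl: "mscale c (cmat P Q) = cmat (Re c *\<^sub>R P - Im c *\<^sub>R Q) (Re c *\<^sub>R Q + Im c *\<^sub>R P)" for P Q :: "real^8^8" and c
          by (simp add: vec_eq_iff mscale_def complex_eq_iff)
        ultimately show ?thesis
          unfolding mat.subspace_def
        proof (intro conjI ballI allI)
          fix D D' c assume D: "D \<in> complexification ?S"
          then obtain P Q where P: "D = cmat P Q" "P \<in> ?S" "Q \<in> ?S" by (auto simp: complexification_cmat)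
          show "mscale c D \<in> complexification ?S"
            unfolding P(1) scl complexification_cmat using P(2,3) by (blast intro: span_add span_diff span_scale)
          assume "D' \<in> complexification ?S"
          then obtain P' Q' where P': "D' = cmat P' Q'" "P' \<in> ?S" "Q' \<in> ?S" by (auto simp: complexification_cmat)
          show "D + D' \<in> complexification ?S"
            unfolding P(1) P'(1) add complexification_cmat using P(2,3) P'(2,3) by (blast intro: span_add)
        qed
      qed
      moreover have "?e \<in> complexification ?S" "?h \<in> complexification ?S" "?f \<in> complexification ?S"
        unfolding complexification_cmat using S by (auto intro!: exI span_neg span_scale span_zero)
      ultimately show "?T \<subseteq> complexification ?S" by (intro mat.span_minimal) auto
    qed
  qed
  ultimately show ?thesis
    using so3_triple_simple[OF t] by (simp add: M8_def principal_3dim_subalgebra_def mat_real_eqs)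
qed

text \<open>From here on \<open>M8\<close> is handled as the orbit of the span of one explicit
  triple.\<close>

theorem M8_iff: "S \<in> M8 \<longleftrightarrow> (\<exists>X Y Z. principal_triple X Y Z \<and> S = span {X, Y, Z})"
  using M8_so3_triple so3_triple_imp_principal_triple so3_triple_principal_imp_M8
    principal_triple_so3 principal_triple_nilpotent by metis

section \<open>The action of G2 on \<open>M8\<close> and its transitivity\<close>

lemma conj_by_span: "conj_by g ` span {X, Y, Z} = span {conj_by g X, conj_by g Y, conj_by g Z}" for X :: "real^'n^'n"
  using linear_span_image[OF linear_conj_by, of g "{X, Y, Z}"] by simp

lemma M8_action_eq: "S \<in> M8 \<Longrightarrow> g \<in> carrier G2 \<Longrightarrow> M8_action g S = conj_by g ` S"
  by (simp add: M8_action_def conj_by_def G2_matrix_inv)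

lemma M8_action_closed: "S \<in> M8 \<Longrightarrow> g \<in> carrier G2 \<Longrightarrow> conj_by g ` S \<in> M8"
  unfolding M8_iff using principal_triple_conj_by conj_by_span by metis

lemma conj_by_image_mult: "conj_by g ` (conj_by h ` S) = conj_by (g ** h) ` S"
  by (simp add: image_image conj_by_conj_by)

lemma M8_group_action: "group_action G2 M8 M8_action"
proof -
  have bij: "M8_action g \<in> carrier (BijGroup M8)" if g: "g \<in> carrier G2" for g
  proof -
    have "bij_betw (M8_action g) M8 M8"
    proof (rule bij_betw_byWitness[where f' = "M8_action (transpose g)"])
      note h = G2_transpose[OF g]
      show "\<forall>S\<in>M8. M8_action (transpose g) (M8_action g S) = S" "\<forall>S\<in>M8. M8_action g (M8_action (transpose g) S) = S"
        by (simp_all add: M8_action_eq g h M8_action_closed conj_by_image_mult G2_orthogonal_matrix)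
      show "M8_action g ` M8 \<subseteq> M8" "M8_action (transpose g) ` M8 \<subseteq> M8"
        using g h by (auto simp: M8_action_eq M8_action_closed)
    qed
    then show ?thesis by (simp add: BijGroup_def Bij_def M8_action_def)
  qed
  have "group_hom G2 (BijGroup M8) M8_action"
  proof (rule group_hom.intro[OF group_G2 group_BijGroup], unfold group_hom_axioms_def, rule homI)
    show "M8_action g \<in> carrier (BijGroup M8)" if "g \<in> carrier G2" for g by (rule bij[OF that])
    fix g h assume g: "g \<in> carrier G2" and h: "h \<in> carrier G2"
    have "M8_action (g ** h) = compose M8 (M8_action g) (M8_action h)"
    proof
      fix S
      show "M8_action (g ** h) S = compose M8 (M8_action g) (M8_action h) S"
      proof (cases "S \<in> M8")
        case True
        then show ?thesis
          by (simp add: compose_def M8_action_eq G2_times[OF g h] g h M8_action_closed conj_by_image_mult)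
      next
        case False
        then show ?thesis by (simp add: compose_def M8_action_def)
      qed
    qed
    then show "M8_action (g \<otimes>\<^bsub>G2\<^esub> h) = M8_action g \<otimes>\<^bsub>BijGroup M8\<^esub> M8_action h"
      using bij[OF g] bij[OF h] by (simp add: BijGroup_def G2_mult_eq)
  qed
  then show ?thesis by (simp add: group_action_def)
qed

lemma M8_transitive:
  assumes "S \<in> M8" "S' \<in> M8" obtains g where "g \<in> carrier G2" "conj_by g ` S = S'"
proof -
  have std: "\<exists>g\<in>carrier G2. S = conj_by g ` span {std_X, std_Y, real_torus 1 2}" if S: "S \<in> M8" for S
    using S unfolding M8_iff principal_triple_def by (auto simp: conj_by_span)
  obtain g h where g: "g \<in> carrier G2" "S = conj_by g ` span {std_X, std_Y, real_torus 1 2}"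
    and h: "h \<in> carrier G2" "S' = conj_by h ` span {std_X, std_Y, real_torus 1 2}" using std assms by metis
  have "conj_by (h ** transpose g) ` S = S'"
    by (simp add: g(2) h(2) conj_by_image_mult matrix_mul_assoc[symmetric] G2_orthogonal_matrix[OF g(1)])
  then show ?thesis using that G2_times[OF h(1) G2_transpose[OF g(1)]] by blast
qed

lemma M8_transitive_action: "transitive_action G2 M8 M8_action"
proof -
  interpret group_action G2 M8 M8_action by (rule M8_group_action)
  show ?thesis
  proof
    fix S S' assume S: "S \<in> M8" "S' \<in> M8"
    obtain g where "g \<in> carrier G2" "conj_by g ` S = S'" using M8_transitive[OF S] .
    then show "\<exists>g\<in>carrier G2. M8_action g S = S'" using M8_action_eq[OF S(1)] by blast
  qed
qed

lemma M8_nonempty: "M8 \<noteq> {}"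
  using M8_iff principal_triple_std by blast


section \<open>Centralizers of principal subalgebras\<close>

text \<open>The three planes have the nonzero weights 1, 2 and -3; within the imaginary octonions
  only the line of e1 has weight zero.\<close>

lemma real_torus_kernel:
  assumes "real_torus 1 2 *v v = 0" "v$0 = 0" shows "v = v$1 *\<^sub>R oct_unit 1"
proof -
  have "(real_torus 1 2 *v v)$i = 0" for i using assms(1) by simp
  from this[of 2] this[of 3] this[of 4] this[of 5] this[of 6] this[of 7]
  show ?thesis using assms(2)
    by (simp add: vec_eq_iff forall_8 matrix_vector_mult_8 real_torus_def root_matrix_nth)
qed

text \<open>A chain e1, e4, e2, e3 in which X, Z and X lead from each unit to a multiple of the
  next. Whatever commutes with X and Z acts on all of them by its eigenvalue on e1: an explicit form
  of Schur's lemma.\<close>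

lemma std_triple_on_units:
  "real_torus 1 2 *v oct_unit 4 = - oct_unit 2" "oct_unit 4 = (- (1 / (2 * sqrt (3/2)))) *\<^sub>R (std_X *v oct_unit 1)"
  "oct_unit 3 = (- (1 / sqrt (5/2))) *\<^sub>R (std_X *v oct_unit 2)"
  by (simp_all add: vec_eq_iff forall_8 matrix_vector_oct_unit real_torus_def root_matrix_nth std_X_mult_vec)

lemma commuting_eigenvector:
  fixes A B :: "real^'n^'n"
  assumes "\<And>x. A *v (B *v x) = B *v (A *v x)" "A *v x = r *\<^sub>R x"
  shows "A *v (c *\<^sub>R (B *v x)) = r *\<^sub>R (c *\<^sub>R (B *v x))"
  by (simp add: assms matrix_vector_mult_scaleR)

text \<open>k preserves the kernel of Z, so e1 is an eigenvector and its eigenvalue v spreads to e4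
  and e2. The product e1 e2 = e4 gives v = v^2, and v is not zero, so k fixes generators.\<close>

lemma G2_centralizer_std:
  assumes k: "k \<in> carrier G2" and X: "conj_by k std_X = std_X" and Z: "conj_by k (real_torus 1 2) = real_torus 1 2"
  shows "k = mat 1"
proof -
  have comm: "k *v (A *v x) = A *v (k *v x)" if "conj_by k A = A" for A x
  proof -
    have "k ** A = A ** k" using G2_cancel(4)[OF k, of "k ** A"] that by (simp add: conj_by_def)
    then show ?thesis by (simp add: matrix_vector_mul_assoc)
  qed
  note cX = comm[OF X] and cZ = comm[OF Z]
  define v where "v = k *v oct_unit 1"
  have "real_torus 1 2 *v v = 0" using cZ[of "oct_unit 1"] by (simp add: v_def real_torus_mult_vec)
  moreover have "v$0 = 0" using G2_nth_0[OF k] by (simp add: v_def)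
  ultimately have v: "v = v$1 *\<^sub>R oct_unit 1" by (rule real_torus_kernel)
  have k1: "k *v oct_unit 1 = v$1 *\<^sub>R oct_unit 1" using v by (simp add: v_def)
  have k4: "k *v oct_unit 4 = v$1 *\<^sub>R oct_unit 4"
    using commuting_eigenvector[OF cX k1, where c = "- (1 / (2 * sqrt (3/2)))"] unfolding std_triple_on_units(2)[symmetric] .
  have k2: "k *v oct_unit 2 = v$1 *\<^sub>R oct_unit 2"
    using cZ[of "oct_unit 4"] by (simp add: std_triple_on_units(1) k4 matrix_vector_mult_scaleR linear_neg[OF matrix_vector_mul_linear])
  have "k *v oct_unit 4 = (v$1 * v$1) *\<^sub>R oct_unit 4"
    unfolding oct_unit_mults(1)[symmetric] G2_mult[OF k] k1 k2 by (simp add: octonion_bilinear)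
  then have "v$1 *\<^sub>R oct_unit 4 = (v$1 * v$1) *\<^sub>R oct_unit 4" using k4 by simp
  then have "(v$1 *\<^sub>R oct_unit 4)$4 = ((v$1 * v$1) *\<^sub>R oct_unit 4)$4" by (rule arg_cong)
  moreover have "v$1 \<noteq> 0"
  proof
    assume "v$1 = 0"
    then have "k *v oct_unit 1 = 0" using k1 by simp
    then show False using G2_norm[OF k, of "oct_unit 1"] by simp
  qed
  ultimately have v1: "v$1 = 1" by simp
  have k3: "k *v oct_unit 3 = oct_unit 3"
    using commuting_eigenvector[OF cX k2, where c = "- (1 / sqrt (5/2))"] unfolding std_triple_on_units(3)[symmetric] v1 by simp
  show ?thesis by (rule G2_generators_fixed[OF k G2_mat_1]) (simp_all add: k1 k2 k3 v1)
qed

text \<open>Infinitesimal version: the eigenvalue on e1 is zero because A is skew.\<close>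

lemma g2_centralizer_std:
  assumes A: "A \<in> g2" and X: "lie_bracket A std_X = 0" and Z: "lie_bracket A (real_torus 1 2) = 0"
  shows "A = 0"
proof -
  have comm: "A *v (B *v x) = B *v (A *v x)" if "lie_bracket A B = 0" for B x
    using that lie_bracket_mult_vec[of A B x] by simp
  note cX = comm[OF X] and cZ = comm[OF Z]
  define v where "v = A *v oct_unit 1"
  have "real_torus 1 2 *v v = 0" using cZ[of "oct_unit 1"] by (simp add: v_def real_torus_mult_vec)
  moreover have "v$0 = 0" using g2_nth_0[OF A] by (simp add: v_def)
  ultimately have v: "v = v$1 *\<^sub>R oct_unit 1" by (rule real_torus_kernel)
  moreover have "v$1 = 0" using g2_inner_self[OF A, of "oct_unit 1"] by (simp add: v_def)
  ultimately have k1: "A *v oct_unit 1 = 0" by (simp add: v_def)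
  have k4: "A *v oct_unit 4 = 0"
    using commuting_eigenvector[OF cX, where x = "oct_unit 1" and r = 0 and c = "- (1 / (2 * sqrt (3/2)))"] k1 unfolding std_triple_on_units(2)[symmetric] by simp
  have k2: "A *v oct_unit 2 = 0"
    using cZ[of "oct_unit 4"] by (simp add: std_triple_on_units(1) k4 linear_neg[OF matrix_vector_mul_linear])
  have k3: "A *v oct_unit 3 = 0"
    using commuting_eigenvector[OF cX, where x = "oct_unit 2" and r = 0 and c = "- (1 / sqrt (5/2))"] k2 unfolding std_triple_on_units(3)[symmetric] by simp
  show ?thesis by (rule g2_generators[OF A g2_zero]) (simp_all add: k1 k2 k3)
qed

lemma principal_triple_G2_centralizer:
  assumes t: "principal_triple X Y Z" and k: "k \<in> carrier G2" and c: "conj_by k X = X" "conj_by k Z = Z"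
  shows "k = mat 1"
proof -
  obtain g where g: "g \<in> carrier G2" "X = conj_by g std_X" "Z = conj_by g (real_torus 1 2)"
    using t by (auto simp: principal_triple_def)
  let ?k = "transpose g ** k ** g"
  have "conj_by ?k std_X = std_X" "conj_by ?k (real_torus 1 2) = real_torus 1 2"
    using c conj_by_cancel(1)[OF g(1)] unfolding g(2,3) by (simp_all flip: conj_by_conj_by)
  moreover have "?k \<in> carrier G2" by (intro G2_times G2_transpose g k)
  ultimately have "?k = mat 1" by (intro G2_centralizer_std)
  then have "g ** ?k ** transpose g = mat 1" by (simp add: G2_orthogonal_matrix[OF g(1)])
  moreover have "g ** ?k ** transpose g = (g ** transpose g) ** k ** (g ** transpose g)"
    by (simp only: matrix_mul_assoc)
  ultimately show ?thesis by (simp add: G2_orthogonal_matrix[OF g(1)])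
qed

lemma principal_triple_g2_centralizer:
  assumes t: "principal_triple X Y Z" and A: "A \<in> g2" and c: "lie_bracket A X = 0" "lie_bracket A Z = 0"
  shows "A = 0"
proof -
  obtain g where g: "g \<in> carrier G2" "X = conj_by g std_X" "Z = conj_by g (real_torus 1 2)"
    using t by (auto simp: principal_triple_def)
  note h = G2_transpose[OF g(1)]
  let ?A = "conj_by (transpose g) A"
  note br = lie_bracket_conj_by[OF G2_orthogonal_matrix(1)[OF h]]
  have "lie_bracket ?A (conj_by (transpose g) X) = 0" "lie_bracket ?A (conj_by (transpose g) Z) = 0"
    unfolding br c by (rule linear_0[OF linear_conj_by])+
  then have "?A = 0"
    unfolding g(2,3) conj_by_cancel(1)[OF g(1)] by (rule g2_centralizer_std[OF conj_by_g2[OF h A]])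
  then have "conj_by g ?A = 0" by (simp add: linear_0[OF linear_conj_by])
  then show ?thesis by (simp add: conj_by_cancel(2)[OF g(1)])
qed

section \<open>The stabilizer of a principal subalgebra\<close>

text \<open>Identifies the span of an so(3) triple with Euclidean 3-space under the cross product.\<close>

definition frame_vec :: "real^8^8 \<Rightarrow> real^8^8 \<Rightarrow> real^8^8 \<Rightarrow> real^3 \<Rightarrow> real^8^8" where
  "frame_vec X Y Z v = v$1 *\<^sub>R X + v$2 *\<^sub>R Y + v$3 *\<^sub>R Z"

lemma linear_frame_vec: "linear (frame_vec X Y Z)"
  by (intro linearI) (simp_all add: frame_vec_def algebra_simps)

lemma range_frame_vec: "range (frame_vec X Y Z) = span {X, Y, Z}"
proof
  show "range (frame_vec X Y Z) \<subseteq> span {X, Y, Z}" by (auto simp: span_triple frame_vec_def)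
  show "span {X, Y, Z} \<subseteq> range (frame_vec X Y Z)"
  proof
    fix V assume "V \<in> span {X, Y, Z}"
    then obtain x y z where "V = x *\<^sub>R X + y *\<^sub>R Y + z *\<^sub>R Z" by (auto simp: span_triple)
    then have "V = frame_vec X Y Z (vector [x, y, z])" by (simp add: frame_vec_def)
    then show "V \<in> range (frame_vec X Y Z)" by blast
  qed
qed

lemma frame_vec_bracket:
  assumes "so3_triple X Y Z"
  shows "lie_bracket (frame_vec X Y Z v) (frame_vec X Y Z w) = frame_vec X Y Z (cross3 v w)"
proof -
  note b = so3_triple_brackets[OF assms]
  show ?thesis by (simp add: frame_vec_def lie_bracket_bilinear b cross_components) (simp add: algebra_simps)
qed

lemma frame_vec_inner:
  assumes t: "so3_triple X Y Z"
  shows "frame_vec X Y Z v \<bullet> frame_vec X Y Z w = (Z \<bullet> Z) * (v \<bullet> w)"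
  using so3_triple_inner[OF t] inner_commute[of Y X] inner_commute[of Z X] inner_commute[of Z Y]
  by (simp add: frame_vec_def inner_add_left inner_add_right inner_vec_def[of v] sum_3 algebra_simps)

lemma frame_vec_inj:
  assumes t: "so3_triple X Y Z" and "frame_vec X Y Z v = frame_vec X Y Z w" shows "v = w"
proof -
  have "frame_vec X Y Z (v - w) = 0" using assms(2) by (simp add: linear_diff[OF linear_frame_vec])
  then have "(Z \<bullet> Z) * ((v - w) \<bullet> (v - w)) = 0" using frame_vec_inner[OF t, of "v - w" "v - w"] by simp
  then show ?thesis using so3_triple_inner(6)[OF t] by simp
qed

lemma orthonormal_frame:
  fixes n :: "real^3"
  assumes n: "n \<bullet> n = 1"
  obtains m l where "l = cross3 n m" "cross3 n l = - m" "m \<bullet> m = 1" "l \<bullet> l = 1" "n \<bullet> m = 0" "n \<bullet> l = 0" "m \<bullet> l = 0"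
    "\<And>w. w = (w \<bullet> n) *\<^sub>R n + (w \<bullet> m) *\<^sub>R m + (w \<bullet> l) *\<^sub>R l"
proof -
  obtain m0 :: "real^3" where m0: "m0 \<noteq> 0" "orthogonal n m0" using orthogonal_to_vector_exists[of n] by auto
  define m where "m = (1 / norm m0) *\<^sub>R m0"
  have m: "m \<bullet> m = 1" "n \<bullet> m = 0"
    using m0 by (simp_all add: m_def orthogonal_def dot_square_norm power2_eq_square)
  define l where "l = cross3 n m"
  \<comment> \<open>The triple product expansion.\<close>
  have lag: "cross3 x (cross3 y z) = (x \<bullet> z) *\<^sub>R y - (x \<bullet> y) *\<^sub>R z" for x y z
    by (simp add: vec_eq_iff forall_3 cross_components inner_vec_def sum_3 algebra_simps)
  have nl: "n \<bullet> l = 0" "m \<bullet> l = 0" by (simp_all add: l_def dot_cross_self)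
  have "norm n = 1" "norm m = 1" using n m by (simp_all add: norm_eq_1)
  then have "norm l = 1" using norm_cross_dot[of n m] m norm_ge_zero[of "cross3 n m"] unfolding l_def power2_eq_1_iff
    by (auto simp: power2_eq_1_iff)
  then have l: "l \<bullet> l = 1" by (simp add: norm_eq_1)
  \<comment> \<open>Orthogonal to n and m, d is parallel to l = n x m; orthogonal to l as well, it
    is zero.\<close>
  have perp: "d = 0" if d: "d \<bullet> n = 0" "d \<bullet> m = 0" "d \<bullet> l = 0" for d
  proof -
    have "cross3 d l = 0" unfolding l_def lag by (simp add: d)
    then have "(norm d)\<^sup>2 = 0" using norm_cross_dot[of d l] d \<open>norm l = 1\<close> by simp
    then show ?thesis by simp
  qed
  have "w = (w \<bullet> n) *\<^sub>R n + (w \<bullet> m) *\<^sub>R m + (w \<bullet> l) *\<^sub>R l" for w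
  proof -
    have "w - ((w \<bullet> n) *\<^sub>R n + (w \<bullet> m) *\<^sub>R m + (w \<bullet> l) *\<^sub>R l) = 0"
      by (rule perp) (use n m l nl in \<open>simp_all add: inner_diff_right inner_add_right inner_commute\<close>)
    then show ?thesis by simp
  qed
  moreover have "cross3 n l = - m" unfolding l_def lag using n m by simp
  ultimately show ?thesis using that l_def m l nl by blast
qed

lemma conj_by_mexp_rotation:
  assumes t: "so3_triple X Y Z" and f: "l = cross3 n m" "cross3 n l = - m"
  defines "F \<equiv> frame_vec X Y Z"
  shows "mexp (a *\<^sub>R F n) \<in> carrier G2" "conj_by (mexp (a *\<^sub>R F n)) (F n) = F n"
    "conj_by (mexp (a *\<^sub>R F n)) (F m) = cos a *\<^sub>R F m + sin a *\<^sub>R F l"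
    "conj_by (mexp (a *\<^sub>R F n)) (F l) = cos a *\<^sub>R F l - sin a *\<^sub>R F m"
proof -
  have g: "F v \<in> g2" for v
    using t by (auto simp: F_def frame_vec_def so3_triple_def intro!: g2_add g2_scale)
  show E: "mexp (a *\<^sub>R F n) \<in> carrier G2" by (rule mexp_in_G2[OF g])
  note T = transpose_mexp[OF E]
  have "mexp (a *\<^sub>R F n) ** F n = F n ** mexp (a *\<^sub>R F n)" by (rule mexp_scaleR_commute[symmetric])
  then show "conj_by (mexp (a *\<^sub>R F n)) (F n) = F n"
    by (simp add: conj_by_def G2_cancel[OF E])
  have br: "F n ** F v - F v ** F n = F (cross3 n v)" for v
    using frame_vec_bracket[OF t, of n v] by (simp add: F_def lie_bracket_def)
  have neg: "F (- v) = - F v" for v by (simp add: F_def linear_neg[OF linear_frame_vec])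
  show "conj_by (mexp (a *\<^sub>R F n)) (F m) = cos a *\<^sub>R F m + sin a *\<^sub>R F l"
    unfolding conj_by_def T by (rule mexp_rotation) (simp_all add: br f(1)[symmetric] f(2) neg)
  \<comment> \<open>The pair l, -m satisfies the same relations as m, l, so the same rotation
    formula applies.\<close>
  have "conj_by (mexp (a *\<^sub>R F n)) (F l) = cos a *\<^sub>R F l + sin a *\<^sub>R (- F m)"
    unfolding conj_by_def T
  proof (rule mexp_rotation)
    show "F n ** F l - F l ** F n = - F m" by (simp only: br f(2) neg)
    have "F n ** F (- m) - F (- m) ** F n = F (- l)" by (simp only: br cross_minus_right f(1))
    then show "F n ** - F m - - F m ** F n = - F l" by (simp only: neg)
  qed
  then show "conj_by (mexp (a *\<^sub>R F n)) (F l) = cos a *\<^sub>R F l - sin a *\<^sub>R F m" by simp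
qed

lemma frame_vec_scaled_unit:
  fixes v :: "real^3"
  obtains a n where "n \<bullet> n = 1" "frame_vec X Y Z v = a *\<^sub>R frame_vec X Y Z n"
proof (cases "v = 0")
  case True
  have "(axis 1 1 :: real^3) \<bullet> axis 1 1 = 1" by (simp add: inner_axis)
  then show ?thesis using that[of "axis 1 1" 0] True by (simp add: linear_0[OF linear_frame_vec])
next
  case False
  then have "((1 / norm v) *\<^sub>R v) \<bullet> ((1 / norm v) *\<^sub>R v) = 1" by (simp add: dot_square_norm power2_eq_square)
  then show ?thesis using that[of "(1 / norm v) *\<^sub>R v" "norm v"] False by (simp add: linear_scale[OF linear_frame_vec])
qed

lemma conj_by_subset_imp_eq:
  assumes k: "k \<in> carrier G2" and S: "subspace S" and sub: "conj_by k ` S \<subseteq> S"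
  shows "conj_by k ` S = S"
proof -
  have "inj (conj_by k)" using conj_by_cancel(1)[OF k] by (metis injI)
  then have "dim (conj_by k ` S) = dim S" by (intro dim_image_eq linear_conj_by) (auto intro: inj_on_subset)
  then show ?thesis
    using sub by (intro subspace_dim_equal linear_subspace_image linear_conj_by S) auto
qed

text \<open>Each element of the span is a multiple of a unit vector n in the frame. Its exponential
  fixes n and rotates the plane orthogonal to n, so it maps the span into itself.\<close>

lemma mexp_normalizes:
  assumes t: "so3_triple X Y Z" and A: "A \<in> span {X, Y, Z}"
  shows "mexp A \<in> carrier G2" "conj_by (mexp A) ` span {X, Y, Z} = span {X, Y, Z}"
proof -
  let ?F = "frame_vec X Y Z"
  obtain v where v: "A = ?F v" using A range_frame_vec[of X Y Z] by blast
  obtain a n where n: "n \<bullet> n = 1" and A: "A = a *\<^sub>R ?F n" using frame_vec_scaled_unit[of X Y Z v] v by metis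
  obtain m l where f: "l = cross3 n m" "cross3 n l = - m" and ex: "\<And>w. w = (w \<bullet> n) *\<^sub>R n + (w \<bullet> m) *\<^sub>R m + (w \<bullet> l) *\<^sub>R l"
    using orthonormal_frame[OF n] by metis
  note r = conj_by_mexp_rotation[OF t f, of a, folded A]
  show "mexp A \<in> carrier G2" by (rule r(1))
  have Fs: "?F w \<in> span {X, Y, Z}" for w using range_frame_vec by blast
  have "conj_by (mexp A) (?F w) \<in> span {X, Y, Z}" for w
  proof -
    have "?F w = (w \<bullet> n) *\<^sub>R ?F n + (w \<bullet> m) *\<^sub>R ?F m + (w \<bullet> l) *\<^sub>R ?F l"
      by (subst ex) (simp add: linear_add[OF linear_frame_vec] linear_scale[OF linear_frame_vec])
    then have "conj_by (mexp A) (?F w) = (w \<bullet> n) *\<^sub>R ?F n + (w \<bullet> m) *\<^sub>R (cos a *\<^sub>R ?F m + sin a *\<^sub>R ?F l)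
        + (w \<bullet> l) *\<^sub>R (cos a *\<^sub>R ?F l - sin a *\<^sub>R ?F m)"
      by (simp add: linear_add[OF linear_conj_by] linear_scale[OF linear_conj_by] r)
    also have "\<dots> \<in> span {X, Y, Z}" by (intro span_add span_scale span_diff Fs)
    finally show ?thesis .
  qed
  then have "conj_by (mexp A) ` span {X, Y, Z} \<subseteq> span {X, Y, Z}" unfolding range_frame_vec[symmetric] by auto
  then show "conj_by (mexp A) ` span {X, Y, Z} = span {X, Y, Z}"
    by (intro conj_by_subset_imp_eq r(1) subspace_span)
qed

text \<open>det(R - 1) = det R det(1 - R^T) = det(1 - R) = -det(R - 1), the last step because the
  dimension is odd. So 1 is an eigenvalue.\<close>

lemma rotation_axis:
  fixes R :: "real^3^3"
  assumes o: "orthogonal_matrix R" and d: "det R = 1"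
  obtains n where "n \<bullet> n = 1" "R *v n = n"
proof -
  have "det (mat 1 - M) = - det (M - mat 1)" for M :: "real^3^3"
    by (simp add: det_3 mat_def) (simp add: algebra_simps)
  moreover have "R - mat 1 = R ** (mat 1 - transpose R)"
    using o by (simp add: orthogonal_matrix_def matrix_mult_diff_gen)
  moreover have "mat 1 - transpose R = transpose (mat 1 - R)"
    by (simp add: vec_eq_iff transpose_def mat_def)
  ultimately have "det (R - mat 1) = - det (R - mat 1)"
    using d by (metis det_mul det_transpose mult_1)
  then have "det (R - mat 1) = 0" by simp
  then obtain x where x: "x \<noteq> 0" "(R - mat 1) *v x = 0"
    by (metis invertible_det_nz invertible_left_inverse matrix_left_invertible_ker)
  then have Rx: "R *v x = x" by (simp add: matrix_vector_mult_diff_rdistrib)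
  show ?thesis
  proof (rule that)
    show "((1 / norm x) *\<^sub>R x) \<bullet> ((1 / norm x) *\<^sub>R x) = 1" using x(1) by (simp add: dot_square_norm power2_eq_square)
    show "R *v ((1 / norm x) *\<^sub>R x) = (1 / norm x) *\<^sub>R x" by (simp add: matrix_vector_mult_scaleR Rx)
  qed
qed

text \<open>An element of the normalizer acts on the subalgebra by a rotation. The exponential of a multiple of
  its axis acts in the same way, and the centralizer is trivial.\<close>

lemma normalizer_mexp:
  assumes p: "principal_triple X Y Z" and k: "k \<in> carrier G2"
    and sub: "conj_by k ` span {X, Y, Z} = span {X, Y, Z}"
  obtains A where "A \<in> span {X, Y, Z}" "k = mexp A"
proof -
  have t: "so3_triple X Y Z" by (rule principal_triple_so3[OF p])
  let ?F = "frame_vec X Y Z"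
  have Fs: "?F w \<in> span {X, Y, Z}" for w using range_frame_vec by blast
  have "\<exists>c. conj_by k (?F w) = ?F c" for w
  proof -
    have "conj_by k (?F w) \<in> span {X, Y, Z}" using sub Fs[of w] by blast
    then show ?thesis unfolding range_frame_vec[symmetric] by auto
  qed
  then obtain \<phi> where \<phi>: "\<And>w. conj_by k (?F w) = ?F (\<phi> w)" by metis
  note inj = frame_vec_inj[OF t]
  have lin: "linear \<phi>"
  proof (rule linearI)
    show "\<phi> (v + w) = \<phi> v + \<phi> w" for v w
      by (rule inj) (simp add: \<phi>[symmetric] linear_add[OF linear_frame_vec] linear_add[OF linear_conj_by])
    show "\<phi> (c *\<^sub>R v) = c *\<^sub>R \<phi> v" for c v
      by (rule inj) (simp add: \<phi>[symmetric] linear_scale[OF linear_frame_vec] linear_scale[OF linear_conj_by])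
  qed
  have \<phi>_inner: "\<phi> v \<bullet> \<phi> w = v \<bullet> w" for v w
    using inner_conj_by[OF k, of "?F v" "?F w"] so3_triple_inner(6)[OF t]
    by (simp add: \<phi> frame_vec_inner[OF t])
  have \<phi>_cross: "cross3 (\<phi> v) (\<phi> w) = \<phi> (cross3 v w)" for v w
    by (rule inj) (simp add: \<phi>[symmetric] frame_vec_bracket[OF t, symmetric]
        lie_bracket_conj_by[OF G2_orthogonal_matrix(1)[OF k]])
  have \<phi>m: "matrix \<phi> *v x = \<phi> x" for x by (rule matrix_works) (simp add: linear_matrix_vector_mul_eq lin)
  have o: "orthogonal_matrix (matrix \<phi>)"
    using lin \<phi>_inner orthogonal_transformation_matrix[of \<phi>] unfolding orthogonal_transformation_def by blast
  \<comment> \<open>An orthogonal matrix respects the cross product up to its determinant. Here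
    \<phi> respects it exactly, since conjugation preserves brackets.\<close>
  have "det (matrix \<phi>) *\<^sub>R \<phi> (axis 3 1) = \<phi> (axis 3 1)"
    using cross_orthogonal_matrix[OF o, of "axis 1 1" "axis 2 1"] \<phi>_cross[of "axis 1 1" "axis 2 1"]
    by (simp add: \<phi>m cross_basis)
  moreover have "\<phi> (axis 3 1) \<noteq> 0"
    using \<phi>_inner[of "axis 3 1" "axis 3 1"] by (auto simp: inner_axis)
  ultimately have "det (matrix \<phi>) = 1" by (metis scaleR_cancel_right scaleR_one)
  then obtain n where n: "n \<bullet> n = 1" "\<phi> n = n" using rotation_axis[OF o] \<phi>m by metis
  obtain m l where f: "l = cross3 n m" "cross3 n l = - m" and m: "m \<bullet> m = 1" "l \<bullet> l = 1" "n \<bullet> m = 0" "m \<bullet> l = 0"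
    and ex: "\<And>w. w = (w \<bullet> n) *\<^sub>R n + (w \<bullet> m) *\<^sub>R m + (w \<bullet> l) *\<^sub>R l"
    using orthonormal_frame[OF n(1)] by metis
  have "\<phi> m \<bullet> n = 0" using \<phi>_inner[of m n] n(2) m(3) by (simp add: inner_commute)
  then have \<phi>me: "\<phi> m = (\<phi> m \<bullet> m) *\<^sub>R m + (\<phi> m \<bullet> l) *\<^sub>R l" using ex[of "\<phi> m"] by simp
  have "1 = \<phi> m \<bullet> ((\<phi> m \<bullet> m) *\<^sub>R m + (\<phi> m \<bullet> l) *\<^sub>R l)" using \<phi>_inner[of m m] m(1) \<phi>me by simp
  then have "(\<phi> m \<bullet> m)\<^sup>2 + (\<phi> m \<bullet> l)\<^sup>2 = 1" by (simp add: inner_add_right power2_eq_square)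
  then obtain a where a: "\<phi> m \<bullet> m = cos a" "\<phi> m \<bullet> l = sin a" using sincos_total_2pi by metis
  let ?E = "mexp (a *\<^sub>R ?F n)"
  note r = conj_by_mexp_rotation[OF t f, of a]
  let ?j = "transpose ?E ** k"
  have j: "?j \<in> carrier G2" by (intro G2_times G2_transpose r(1) k)
  have 1: "conj_by ?j (?F n) = ?F n"
    using conj_by_cancel(1)[OF r(1), of "?F n"] r(2) by (simp add: conj_by_conj_by[symmetric] \<phi> n)
  have "conj_by k (?F m) = conj_by ?E (?F m)"
    unfolding r(3) \<phi> by (subst \<phi>me) (simp add: a linear_add[OF linear_frame_vec] linear_scale[OF linear_frame_vec])
  then have 2: "conj_by ?j (?F m) = ?F m"
    using conj_by_cancel(1)[OF r(1), of "?F m"] by (simp add: conj_by_conj_by[symmetric])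
  \<comment> \<open>The third frame vector is the bracket of the first two, both fixed.\<close>
  have 3: "conj_by ?j (?F l) = ?F l"
    using lie_bracket_conj_by[OF G2_orthogonal_matrix(1)[OF j], of "?F n" "?F m"]
    by (simp add: 1 2 frame_vec_bracket[OF t] f(1)[symmetric])
  have "conj_by ?j (?F w) = ?F w" for w
    by (subst (1 2) ex) (simp add: linear_add[OF linear_frame_vec] linear_scale[OF linear_frame_vec]
        linear_add[OF linear_conj_by] linear_scale[OF linear_conj_by] 1 2 3)
  from this[of "axis 1 1"] this[of "axis 3 1"] have "conj_by ?j X = X" "conj_by ?j Z = Z"
    by (simp_all add: frame_vec_def axis_def)
  then have "?j = mat 1" by (rule principal_triple_G2_centralizer[OF p j])
  then have "?E ** ?j = ?E" by simp
  then have "k = ?E" by (simp add: matrix_mul_assoc G2_orthogonal_matrix[OF r(1)])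
  moreover have "a *\<^sub>R ?F n \<in> span {X, Y, Z}" by (intro span_scale Fs)
  ultimately show ?thesis using that by blast
qed

lemma stabilizer_M8:
  assumes "S \<in> M8"
  shows "stabilizer G2 M8_action S = {k \<in> carrier G2. conj_by k ` S = S}"
  unfolding stabilizer_def by (simp add: M8_action_eq[OF assms] cong: conj_cong)

lemma stabilizer_eq_mexp:
  assumes S: "S \<in> M8" shows "stabilizer G2 M8_action S = mexp ` S"
proof -
  obtain X Y Z where p: "principal_triple X Y Z" and SE: "S = span {X, Y, Z}" using S M8_iff by auto
  note t = principal_triple_so3[OF p]
  show ?thesis
    unfolding stabilizer_M8[OF S]
  proof
    show "{k \<in> carrier G2. conj_by k ` S = S} \<subseteq> mexp ` S"
      using normalizer_mexp[OF p] unfolding SE by blast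
    show "mexp ` S \<subseteq> {k \<in> carrier G2. conj_by k ` S = S}"
      using mexp_normalizes[OF t] unfolding SE by blast
  qed
qed

lemma M8_subspace: "S \<in> M8 \<Longrightarrow> subspace S"
  unfolding M8_iff by auto

lemma M8_subset_g2: "S \<in> M8 \<Longrightarrow> S \<subseteq> g2"
  by (simp add: M8_def principal_3dim_subalgebra_def)

text \<open>An element A of the Lie algebra normalizes S, and ad A is skew on S for the invariant
  inner product. A skew operator on 3-space is a cross product, so ad A agrees on S with ad W for
  some W in S. Then A - W centralizes S and vanishes.\<close>

theorem lie_algebra_of_stabilizer:
  assumes S: "S \<in> M8" shows "lie_algebra_of (stabilizer G2 M8_action S) = S"
proof
  show "S \<subseteq> lie_algebra_of (stabilizer G2 M8_action S)"
    unfolding stabilizer_eq_mexp[OF S] lie_algebra_of_def using subspace_scale[OF M8_subspace[OF S]] by auto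
  show "lie_algebra_of (stabilizer G2 M8_action S) \<subseteq> S"
  proof
    fix A assume "A \<in> lie_algebra_of (stabilizer G2 M8_action S)"
    then have G: "\<And>t. mexp (t *\<^sub>R A) \<in> carrier G2" and inv: "\<And>t. conj_by (mexp (t *\<^sub>R A)) ` S = S"
      by (simp_all add: lie_algebra_of_def stabilizer_M8[OF S])
    have A: "A \<in> g2" by (rule lie_algebra_of_G2[OF G])
    obtain X Y Z where p: "principal_triple X Y Z" and SE: "S = span {X, Y, Z}" using S M8_iff by auto
    have t: "so3_triple X Y Z" by (rule principal_triple_so3[OF p])
    have XS: "X \<in> S" "Y \<in> S" "Z \<in> S" unfolding SE by (auto intro: span_base)
    have XG: "X \<in> g2" "Y \<in> g2" "Z \<in> g2" using t by (auto simp: so3_triple_def)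
    have norm: "lie_bracket A V \<in> S" if "V \<in> S" for V
    proof (rule lie_algebra_of_normalizer[OF M8_subspace[OF S] G])
      show "mexp (t *\<^sub>R A) ** V ** transpose (mexp (t *\<^sub>R A)) \<in> S" for t
        using inv[of t] that unfolding conj_by_def by blast
    qed
    note i = so3_triple_inner[OF t]
    define r where "r = Z \<bullet> Z"
    have ex: "V = (V \<bullet> X / r) *\<^sub>R X + (V \<bullet> Y / r) *\<^sub>R Y + (V \<bullet> Z / r) *\<^sub>R Z" if "V \<in> S" for V
      using orthogonal_triple_expansion[of V X Y Z r] that i unfolding SE r_def by blast
    have sk: "lie_bracket A V \<bullet> W = - (lie_bracket A W \<bullet> V)" if "V \<in> g2" "W \<in> g2" for V W
      using inner_lie_bracket[OF A, of V W] by (simp add: lie_bracket_swap[of V A] inner_commute)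
    have self: "lie_bracket A V \<bullet> V = 0" if "V \<in> g2" for V using sk[OF that that] by simp
    define \<alpha> \<beta> \<gamma> where "\<alpha> = lie_bracket A X \<bullet> Y / r" and "\<beta> = lie_bracket A X \<bullet> Z / r" and "\<gamma> = lie_bracket A Y \<bullet> Z / r"
    note b = so3_triple_brackets[OF t]
    have AX: "lie_bracket A X = \<alpha> *\<^sub>R Y + \<beta> *\<^sub>R Z"
      using ex[OF norm[OF XS(1)]] self[OF XG(1)] by (simp add: \<alpha>_def \<beta>_def)
    have AZ: "lie_bracket A Z = - \<beta> *\<^sub>R X - \<gamma> *\<^sub>R Y"
      using ex[OF norm[OF XS(3)]] self[OF XG(3)] sk[OF XG(3) XG(1)] sk[OF XG(3) XG(2)] by (simp add: \<gamma>_def \<beta>_def)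
    \<comment> \<open>The axial vector of the skew operator with matrix entries \<alpha>, \<beta>,
      \<gamma>; [W, X] and [W, Z] reproduce \<open>AX\<close> and \<open>AZ\<close>.\<close>
    define W where "W = \<gamma> *\<^sub>R X - \<beta> *\<^sub>R Y + \<alpha> *\<^sub>R Z"
    have WS: "W \<in> S" unfolding W_def SE by (intro span_add span_diff span_scale span_base) auto
    have "A - W = 0"
    proof (rule principal_triple_g2_centralizer[OF p])
      show "A - W \<in> g2" using A WS M8_subset_g2[OF S] by (intro g2_diff) auto
      show "lie_bracket (A - W) X = 0" "lie_bracket (A - W) Z = 0"
        by (simp_all add: lie_bracket_bilinear AX AZ) (simp_all add: W_def lie_bracket_bilinear b)
    qed
    then show "A \<in> S" using WS by simp
  qed
qed

section \<open>Closedness of the stabilizer and the coset space\<close>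

lemma continuous_on_transpose: "continuous_on UNIV (transpose :: real^'n^'m \<Rightarrow> real^'m^'n)"
  by (intro linear_continuous_on linear_conv_bounded_linear[THEN iffD1] linearI)
    (simp_all add: transpose_def vec_eq_iff)

lemma closed_G2: "closed (carrier G2)"
proof -
  have "carrier G2 = {g. transpose g ** g = mat 1} \<inter> (\<Inter>x. \<Inter>y. {g. g *v (x \<odot> y) = (g *v x) \<odot> (g *v y)})"
    using G2_iff_orthogonal by blast
  moreover have mv: "continuous_on UNIV (\<lambda>g::real^8^8. g *v x)" for x
    by (intro linear_continuous_on bounded_bilinear.bounded_linear_left[OF bounded_bilinear_matrix_vector_mult])
  moreover have "closed {g::real^8^8. transpose g ** g = mat 1}"
    by (intro closed_Collect_eq bounded_bilinear.continuous_on[OF bounded_bilinear_matrix_mult] continuous_on_transpose continuous_on_id continuous_on_const)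
  moreover have "closed {g. g *v (x \<odot> y) = (g *v x) \<odot> (g *v y)}" for x y
    by (intro closed_Collect_eq bounded_bilinear.continuous_on[OF bounded_bilinear_octonion_mult] mv)
  ultimately show ?thesis by (simp add: closed_Int closed_INT)
qed

lemma closed_stabilizer:
  assumes S: "S \<in> M8" shows "closed (stabilizer G2 M8_action S)"
proof -
  \<comment> \<open>By dimension, equality of the image with S follows from inclusion, which is a
    closed condition for each V.\<close>
  have "stabilizer G2 M8_action S = carrier G2 \<inter> (\<Inter>V\<in>S. {k. conj_by k V \<in> S})"
    unfolding stabilizer_M8[OF S] using conj_by_subset_imp_eq[OF _ M8_subspace[OF S]] by blast
  moreover have "closed {k. conj_by k V \<in> S}" for V
  proof -
    have "continuous_on UNIV (\<lambda>k. conj_by k V)"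
      unfolding conj_by_def
      by (intro bounded_bilinear.continuous_on[OF bounded_bilinear_matrix_mult] continuous_on_transpose continuous_on_id continuous_on_const)
    from closed_vimage[OF closed_subspace[OF M8_subspace[OF S]] this] show ?thesis by (simp add: vimage_def)
  qed
  ultimately show ?thesis using closed_G2 by (simp add: closed_Int closed_INT)
qed

text \<open>The exponential already maps S onto the stabilizer, which is a subgroup, so generating
  adds nothing.\<close>

lemma SO3_irr_eq_stabilizer:
  assumes S: "S \<in> M8" shows "SO3_irr S = stabilizer G2 M8_action S"
proof -
  have sg: "subgroup (stabilizer G2 M8_action S) G2"
    by (rule group_action.stabilizer_subgroup[OF M8_group_action S])
  show ?thesis
    unfolding connected_lie_subgroup_def stabilizer_eq_mexp[OF S, symmetric]
    using group.generate_subgroup_incl[OF group_G2 subset_refl sg] generate.incl[of _ "stabilizer G2 M8_action S" G2] by blast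
qed

lemma M8_coset_bijection:
  assumes S: "S \<in> M8"
  defines "K \<equiv> stabilizer G2 M8_action S"
  obtains \<Phi> where "bij_betw \<Phi> (lcosets\<^bsub>G2\<^esub> K) M8"
    "\<And>g. g \<in> carrier G2 \<Longrightarrow> \<Phi> (g <#\<^bsub>G2\<^esub> K) = M8_action g S"
    "\<And>g C. g \<in> carrier G2 \<Longrightarrow> C \<in> lcosets\<^bsub>G2\<^esub> K \<Longrightarrow> \<Phi> (g <#\<^bsub>G2\<^esub> C) = M8_action g (\<Phi> C)"
proof -
  interpret G: group G2 by (rule group_G2)
  have sg: "subgroup K G2" unfolding K_def by (rule group_action.stabilizer_subgroup[OF M8_group_action S])
  have KG: "K \<subseteq> carrier G2" by (rule subgroup.subset[OF sg])
  have act: "M8_action (g \<otimes>\<^bsub>G2\<^esub> h) S = conj_by g ` (conj_by h ` S)" if "g \<in> carrier G2" "h \<in> carrier G2" for g h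
    using that S by (simp add: M8_action_eq G2_mult_eq G2_times conj_by_image_mult)
  have KS: "conj_by k ` S = S" if "k \<in> K" for k using that by (simp add: K_def stabilizer_M8[OF S])
  \<comment> \<open>Orbit map on cosets through a chosen representative; the choice is immaterial
    because K fixes S.\<close>
  define \<Phi> where "\<Phi> C = M8_action (SOME g. g \<in> C) S" for C
  have \<Phi>: "\<Phi> (g <#\<^bsub>G2\<^esub> K) = M8_action g S" if g: "g \<in> carrier G2" for g
  proof -
    have "g \<in> g <#\<^bsub>G2\<^esub> K" by (rule G.lcos_self[OF g sg])
    then have "(SOME h. h \<in> g <#\<^bsub>G2\<^esub> K) \<in> g <#\<^bsub>G2\<^esub> K" by (rule someI)
    then obtain k where k: "k \<in> K" "(SOME h. h \<in> g <#\<^bsub>G2\<^esub> K) = g \<otimes>\<^bsub>G2\<^esub> k" by (auto simp: l_coset_def)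
    have "M8_action (g \<otimes>\<^bsub>G2\<^esub> k) S = conj_by g ` (conj_by k ` S)" using act[OF g] KG k(1) by blast
    then show ?thesis unfolding \<Phi>_def k(2) KS[OF k(1)] M8_action_eq[OF S g] .
  qed
  have "bij_betw \<Phi> (lcosets\<^bsub>G2\<^esub> K) M8"
  proof (rule bij_betw_imageI)
    show "inj_on \<Phi> (lcosets\<^bsub>G2\<^esub> K)"
    proof (rule inj_onI)
      fix C D assume "C \<in> lcosets\<^bsub>G2\<^esub> K" "D \<in> lcosets\<^bsub>G2\<^esub> K" and eq: "\<Phi> C = \<Phi> D"
      then obtain g h where g: "g \<in> carrier G2" "C = g <#\<^bsub>G2\<^esub> K" and h: "h \<in> carrier G2" "D = h <#\<^bsub>G2\<^esub> K"
        by (auto simp: LCOSETS_def)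
      have e: "conj_by g ` S = conj_by h ` S" using eq by (simp add: g h \<Phi> M8_action_eq[OF S])
      let ?k = "transpose g ** h"
      have "conj_by ?k ` S = S"
        unfolding conj_by_image_mult[symmetric] e[symmetric] by (simp add: conj_by_image_mult G2_orthogonal_matrix[OF g(1)])
      then have k: "?k \<in> K" using G2_times[OF G2_transpose[OF g(1)] h(1)] by (simp add: K_def stabilizer_M8[OF S])
      have "h = g \<otimes>\<^bsub>G2\<^esub> ?k" by (simp add: G2_mult_eq G2_cancel[OF g(1)])
      then have "D = g <#\<^bsub>G2\<^esub> (?k <#\<^bsub>G2\<^esub> K)"
        unfolding h(2) using G.lcos_m_assoc[OF KG g(1)] k KG by auto
      also have "?k <#\<^bsub>G2\<^esub> K = K" using k KG sg by (intro G.coset_join3) auto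
      finally show "C = D" by (simp add: g)
    qed
    show "\<Phi> ` (lcosets\<^bsub>G2\<^esub> K) = M8"
    proof
      show "\<Phi> ` (lcosets\<^bsub>G2\<^esub> K) \<subseteq> M8"
        using \<Phi> S by (auto simp: LCOSETS_def M8_action_eq M8_action_closed)
      show "M8 \<subseteq> \<Phi> ` (lcosets\<^bsub>G2\<^esub> K)"
      proof
        fix T assume T: "T \<in> M8"
        obtain g where g: "g \<in> carrier G2" "conj_by g ` S = T" using M8_transitive[OF S T] .
        then have "T = \<Phi> (g <#\<^bsub>G2\<^esub> K)" by (simp add: \<Phi> M8_action_eq[OF S])
        then show "T \<in> \<Phi> ` (lcosets\<^bsub>G2\<^esub> K)" using g(1) by (auto simp: LCOSETS_def)
      qed
    qed
  qed
  moreover have "\<Phi> (g <#\<^bsub>G2\<^esub> C) = M8_action g (\<Phi> C)" if g: "g \<in> carrier G2" and C: "C \<in> lcosets\<^bsub>G2\<^esub> K" for g C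
  proof -
    obtain h where h: "h \<in> carrier G2" "C = h <#\<^bsub>G2\<^esub> K" using C by (auto simp: LCOSETS_def)
    have "g <#\<^bsub>G2\<^esub> C = (g \<otimes>\<^bsub>G2\<^esub> h) <#\<^bsub>G2\<^esub> K" unfolding h(2) by (rule G.lcos_m_assoc[OF KG g h(1)])
    then have "\<Phi> (g <#\<^bsub>G2\<^esub> C) = M8_action (g \<otimes>\<^bsub>G2\<^esub> h) S" using \<Phi>[OF G.m_closed[OF g h(1)]] by simp
    then show ?thesis
      using act[OF g h(1)] g h S by (simp add: \<Phi> M8_action_eq M8_action_closed)
  qed
  ultimately show ?thesis using that \<Phi> by blast
qed

text \<open>Nonemptiness keeps the statements about all members of \<open>M8\<close> from being
  vacuous. The identification with the homogeneous space is an equivariant bijection from the left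
  cosets of a closed subgroup.\<close>

theorem mainTheorem3:
  shows "M8 \<noteq> {} \<and>
    transitive_action G2 M8 M8_action \<and>
    (\<forall>S\<in>M8. lie_algebra_of (stabilizer G2 M8_action S) = S) \<and>
    (\<forall>S\<in>M8. subgroup (SO3_irr S) G2 \<and> closed (SO3_irr S) \<and>
      (\<exists>\<Phi>. bij_betw \<Phi> (lcosets\<^bsub>G2\<^esub> (SO3_irr S)) M8 \<and>
        (\<forall>g\<in>carrier G2. \<Phi> (g <#\<^bsub>G2\<^esub> SO3_irr S) = M8_action g S) \<and>
        (\<forall>g\<in>carrier G2. \<forall>C\<in>lcosets\<^bsub>G2\<^esub> (SO3_irr S).
          \<Phi> (g <#\<^bsub>G2\<^esub> C) = M8_action g (\<Phi> C))))"
proof (intro conjI ballI)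
  fix S assume S: "S \<in> M8"
  show "lie_algebra_of (stabilizer G2 M8_action S) = S" by (rule lie_algebra_of_stabilizer[OF S])
  show "subgroup (SO3_irr S) G2"
    unfolding SO3_irr_eq_stabilizer[OF S] by (rule group_action.stabilizer_subgroup[OF M8_group_action S])
  show "closed (SO3_irr S)"
    unfolding SO3_irr_eq_stabilizer[OF S] by (rule closed_stabilizer[OF S])
  show "\<exists>\<Phi>. bij_betw \<Phi> (lcosets\<^bsub>G2\<^esub> (SO3_irr S)) M8 \<and>
        (\<forall>g\<in>carrier G2. \<Phi> (g <#\<^bsub>G2\<^esub> SO3_irr S) = M8_action g S) \<and>
        (\<forall>g\<in>carrier G2. \<forall>C\<in>lcosets\<^bsub>G2\<^esub> (SO3_irr S). \<Phi> (g <#\<^bsub>G2\<^esub> C) = M8_action g (\<Phi> C))"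
    unfolding SO3_irr_eq_stabilizer[OF S] using M8_coset_bijection[OF S] by metis
qed (rule M8_nonempty M8_transitive_action)+

end
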